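(* Let $f=(f_1,\dots,f_k)$ be a finite sequence of polynomials in $\mathbb{R}[x_1,\dots,x_d]$, let $L$ be a linear functional on $\mathbb{C}[x_1,\dots,x_d]$ such that $L(T_f)\ge0$, and let $\pi_L$ be the associated GNS representation on the pre-Hilbert space $\mathcal{D}_L$. If $p\in\mathbb{C}[x_1,\dots,x_d]$ is bounded on the set $K_f$, then the operator $\pi_L(p)$ is bounded on $\mathcal{D}_L$ and $\|\pi_L(p)\|\le\|p\|_K$, where $\|p\|_K=\sup\{|p(\lambda)|;\lambda\in K_f\}$.
   Context: Write $\mathbb{R}[x]=\mathbb{R}[x_1,\dots,x_d]$ and $\mathbb{C}[x]=\mathbb{C}[x_1,\dots,x_d]$; $\mathbb{C}[x]$ is a $*$-algebra with involution $p\mapsto\bar p$ (complex conjugation of coefficients). $K_f=\{x\in\mathbb{R}^d:f_1(x)\ge0,\dots,f_k(x)\ge0\}$, and $T_f$ is the set of all finite sums of elements $f_1^{\varepsilon_1}\cdots f_k^{\varepsilon_k}q^2$ with $q\in\mathbb{R}[x]$, $\varepsilon_i\in\{0,1\}$. $L(T_f)\ge0$ means $L(t)\ge0$ for all $t\in T_f$; then $L(p\bar p)\ge 0$ for all $p\in\mathbb{C}[x]$. GNS construction: $\mathcal{N}=\{p\in\mathbb{C}[x]:L(p\bar p)=0\}$ is an ideal of $\mathbb{C}[x]$; $\mathcal{D}_L:=\mathbb{C}[x]/\mathcal{N}$ is a pre-Hilbert space with scalar product $\langle p_1+\mathcal{N},p_2+\mathcal{N}\rangle=L(p_1\overline{p_2})$;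 and for $p\in\mathbb{C}[x]$ the linear operator $\pi_L(p):\mathcal{D}_L\to\mathcal{D}_L$ is defined by $\pi_L(p)(q+\mathcal{N})=pq+\mathcal{N}$. *)

theory Defs
  imports "HOL-Analysis.Analysis" "HOL-Library.Poly_Mapping" "HOL-Library.Nonpos_Ints"
begin

section \<open>Polynomials in the variables indexed by a finite type\<close>

text \<open>
  An exponent vector is a finitely supported map from variables to naturals, so multiplication
  of \<open>Poly_Mapping\<close> (convolution) is multiplication of polynomials. The number of variables is
  the cardinality of the index type.
\<close>

type_synonym ('n, 'a) mpoly = "('n \<Rightarrow>\<^sub>0 nat) \<Rightarrow>\<^sub>0 'a"

definition eval :: "('n::finite, 'a::comm_semiring_1) mpoly \<Rightarrow> ('n \<Rightarrow> 'a) \<Rightarrow> 'a" where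
  "eval p x = (\<Sum>m\<in>Poly_Mapping.keys p.
     Poly_Mapping.lookup p m * (\<Prod>i\<in>UNIV. x i ^ Poly_Mapping.lookup m i))"

definition eval_at :: "('n::finite, complex) mpoly \<Rightarrow> real ^ 'n \<Rightarrow> complex" where
  "eval_at p x = eval p (\<lambda>i. complex_of_real (x $ i))"

definition conj_poly :: "('n, complex) mpoly \<Rightarrow> ('n, complex) mpoly" where
  "conj_poly p = Poly_Mapping.map cnj p"

definition complexify :: "('n, real) mpoly \<Rightarrow> ('n, complex) mpoly" where
  "complexify p = Poly_Mapping.map complex_of_real p"

definition scale_poly :: "complex \<Rightarrow> ('n, complex) mpoly \<Rightarrow> ('n, complex) mpoly" where
  "scale_poly c p = Poly_Mapping.map ((*) c) p"


section \<open>Semi-algebraic sets and preorderings\<close>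

definition semialg_set :: "('n::finite, real) mpoly list \<Rightarrow> (real ^ 'n) set" where
  "semialg_set f = {x. \<forall>i < length f. 0 \<le> eval (f ! i) (\<lambda>j. x $ j)}"

definition preordering :: "('n, real) mpoly list \<Rightarrow> ('n, real) mpoly set" where
  "preordering f = {sum_list ts | ts.
     set ts \<subseteq> {(\<Prod>i<length f. (f ! i) ^ \<epsilon> i) * q\<^sup>2 | \<epsilon> q. \<forall>i. \<epsilon> i \<in> {0, 1::nat}}}"

definition nonneg_on_preordering ::
    "('n, real) mpoly list \<Rightarrow> (('n, complex) mpoly \<Rightarrow> complex) \<Rightarrow> bool" where
  "nonneg_on_preordering f L \<longleftrightarrow> (\<forall>t \<in> preordering f. L (complexify t) \<in> \<real>\<^sub>\<ge>\<^sub>0)"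

definition linear_functional :: "(('n, complex) mpoly \<Rightarrow> complex) \<Rightarrow> bool" where
  "linear_functional L \<longleftrightarrow> Vector_Spaces.linear scale_poly (*) L"

text \<open>
  The supremum is taken in the nonnegative reals, so it is 0 over the empty set
  (whereas \<open>Sup {}\<close> is unspecified on type \<open>real\<close>).
\<close>

definition sup_norm_on :: "(real ^ 'n) set \<Rightarrow> ('n::finite, complex) mpoly \<Rightarrow> real" where
  "sup_norm_on K p = (if K = {} then 0 else (SUP x\<in>K. cmod (eval_at p x)))"


section \<open>The GNS construction\<close>

text \<open>
  Elements of the quotient space are cosets, represented as sets of polynomials. The operations
  on cosets are unions over representatives; the lemmas \<open>gns_inner_class\<close>, \<open>gns_op_class\<close> below
  show that for nonnegative functionals they do not depend on the representatives.
\<close>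

definition gns_null :: "(('n, complex) mpoly \<Rightarrow> complex) \<Rightarrow> ('n, complex) mpoly set" where
  "gns_null L = {p. L (p * conj_poly p) = 0}"

definition gns_class ::
    "(('n, complex) mpoly \<Rightarrow> complex) \<Rightarrow> ('n, complex) mpoly \<Rightarrow> ('n, complex) mpoly set" where
  "gns_class L p = {q. q - p \<in> gns_null L}"

definition gns_space :: "(('n, complex) mpoly \<Rightarrow> complex) \<Rightarrow> ('n, complex) mpoly set set" where
  "gns_space L = range (gns_class L)"

definition gns_inner ::
    "(('n, complex) mpoly \<Rightarrow> complex)
       \<Rightarrow> ('n, complex) mpoly set \<Rightarrow> ('n, complex) mpoly set \<Rightarrow> complex" where
  "gns_inner L X Y = the_elem (\<Union>p\<in>X. \<Union>q\<in>Y. {L (p * conj_poly q)})"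

definition gns_norm ::
    "(('n, complex) mpoly \<Rightarrow> complex) \<Rightarrow> ('n, complex) mpoly set \<Rightarrow> real" where
  "gns_norm L X = sqrt (Re (gns_inner L X X))"

definition gns_op ::
    "(('n, complex) mpoly \<Rightarrow> complex)
       \<Rightarrow> ('n, complex) mpoly \<Rightarrow> ('n, complex) mpoly set \<Rightarrow> ('n, complex) mpoly set" where
  "gns_op L p X = (\<Union>q\<in>X. gns_class L (p * q))"

definition gns_bounded ::
    "(('n, complex) mpoly \<Rightarrow> complex)
       \<Rightarrow> (('n, complex) mpoly set \<Rightarrow> ('n, complex) mpoly set) \<Rightarrow> bool" where
  "gns_bounded L A \<longleftrightarrow> (\<exists>C. \<forall>X \<in> gns_space L. gns_norm L (A X) \<le> C * gns_norm L X)"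

definition gns_opnorm ::
    "(('n, complex) mpoly \<Rightarrow> complex)
       \<Rightarrow> (('n, complex) mpoly set \<Rightarrow> ('n, complex) mpoly set) \<Rightarrow> real" where
  "gns_opnorm L A = Sup {gns_norm L (A X) | X. X \<in> gns_space L \<and> gns_norm L X \<le> 1}"


section \<open>Well-definedness\<close>

lemma lookup_map_0: "h 0 = 0 \<Longrightarrow> Poly_Mapping.lookup (Poly_Mapping.map h p) m = h (Poly_Mapping.lookup p m)"
  by (simp add: Poly_Mapping.map.rep_eq when_def)

lemma lookup_conj [simp]: "Poly_Mapping.lookup (conj_poly p) m = cnj (Poly_Mapping.lookup p m)"
  by (simp add: conj_poly_def lookup_map_0)

lemma lookup_complexify [simp]:
  "Poly_Mapping.lookup (complexify p) m = complex_of_real (Poly_Mapping.lookup p m)"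
  by (simp add: complexify_def lookup_map_0)

lemma lookup_scale [simp]: "Poly_Mapping.lookup (scale_poly c p) m = c * Poly_Mapping.lookup p m"
  by (simp add: scale_poly_def lookup_map_0)

lemma scale_conv_mult: "scale_poly c p = Poly_Mapping.single 0 c * p"
  by (simp add: scale_poly_def mult_map_scale_conv_mult)

lemma vector_space_scale_poly: "vector_space scale_poly"
  by unfold_locales (auto intro!: poly_mapping_eqI simp: lookup_add algebra_simps)

lemma map_mult:
  fixes p q :: "('n, 'a::comm_ring_1) mpoly" and h :: "'a \<Rightarrow> 'b::comm_ring_1"
  assumes h: "h 0 = 0" "\<And>a b. h (a + b) = h a + h b" "\<And>a b. h (a * b) = h a * h b"
  shows "Poly_Mapping.map h (p * q) = Poly_Mapping.map h p * Poly_Mapping.map h q"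
proof -
  have add: "Poly_Mapping.map h (a + b) = Poly_Mapping.map h a + Poly_Mapping.map h b"
    for a b :: "('n, 'a) mpoly"
    by (auto intro!: poly_mapping_eqI simp: lookup_add lookup_map_0 h)
  have ms: "Poly_Mapping.map h (Poly_Mapping.single a c) = Poly_Mapping.single a (h c)"
    for a :: "'n \<Rightarrow>\<^sub>0 nat" and c
    using h(1) by (auto intro!: poly_mapping_eqI simp: lookup_map_0 lookup_single when_def)
  have z: "Poly_Mapping.map h 0 = (0 :: ('n, 'b) mpoly)"
    by (auto intro!: poly_mapping_eqI simp: lookup_map_0 h)
  have frag: "P r" if "P 0" "\<And>a c. P (Poly_Mapping.single a c)" 
      "\<And>a b. P a \<Longrightarrow> P b \<Longrightarrow> P (a + b)" for P and r :: "('n, 'a) mpoly"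
  proof (induction "card (Poly_Mapping.keys r)" arbitrary: r)
    case 0
    then have "r = 0" by simp
    then show ?case using that by simp
  next
    case (Suc n)
    then obtain k where k: "k \<in> Poly_Mapping.keys r" by (metis card.empty ex_in_conv nat.distinct(1))
    define s where "s = Poly_Mapping.update k 0 r"
    have ks: "Poly_Mapping.keys s = Poly_Mapping.keys r - {k}"
      by (auto simp: s_def in_keys_iff lookup_update split: if_splits)
    have r: "r = s + Poly_Mapping.single k (Poly_Mapping.lookup r k)"
      by (rule poly_mapping_eqI) (auto simp: s_def lookup_add lookup_single lookup_update when_def)
    have "card (Poly_Mapping.keys s) = n" using Suc(2) k by (simp add: ks)
    then have "P s" using Suc(1) by simp
    then show ?case using r that by metis
  qed
  have 1: "Poly_Mapping.map h (Poly_Mapping.single a c * q)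
      = Poly_Mapping.map h (Poly_Mapping.single a c) * Poly_Mapping.map h q" for a c
    by (induction rule: frag[of _ q])
       (simp_all add: z ms add mult_single h distrib_left)
  show ?thesis
    by (induction rule: frag[of _ p]) (simp_all add: z 1 add distrib_right)
qed

lemma conj_mult: "conj_poly (p * q) = conj_poly p * conj_poly q"
  unfolding conj_poly_def by (rule map_mult) auto

lemma complexify_mult: "complexify (p * q) = complexify p * complexify q"
  unfolding complexify_def by (rule map_mult) auto

lemma conj_add: "conj_poly (p + q) = conj_poly p + conj_poly q"
  by (rule poly_mapping_eqI) (simp add: lookup_add)

lemma complexify_add: "complexify (p + q) = complexify p + complexify q"
  by (rule poly_mapping_eqI) (simp add: lookup_add)

lemma conj_conj [simp]: "conj_poly (conj_poly p) = p"
  by (rule poly_mapping_eqI) simp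

lemma conj_scale: "conj_poly (scale_poly c p) = scale_poly (cnj c) (conj_poly p)"
  by (rule poly_mapping_eqI) simp

context
  fixes L :: "('n, complex) mpoly \<Rightarrow> complex" and f
  assumes lin: "linear_functional L" and pos: "nonneg_on_preordering f L"
begin

interpretation L: Vector_Spaces.linear scale_poly "(*)" L
  using lin by (simp add: linear_functional_def)

lemma nonneg_square: "L (p * conj_poly p) \<in> \<real>\<^sub>\<ge>\<^sub>0"
proof -
  define u where "u = Poly_Mapping.map Re p"
  define v where "v = Poly_Mapping.map Im p"
  have p: "p = complexify u + scale_poly \<i> (complexify v)"
    by (rule poly_mapping_eqI) (simp add: u_def v_def lookup_add lookup_map_0 complex_eq_iff)
  have cp: "conj_poly p = complexify u - scale_poly \<i> (complexify v)"
    by (rule poly_mapping_eqI)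
       (simp add: u_def v_def lookup_minus lookup_map_0 complex_eq_iff)
  have ii: "Poly_Mapping.single 0 \<i> * Poly_Mapping.single 0 \<i> = (- 1 :: ('n, complex) mpoly)"
    by (simp add: mult_single) (metis single_one single_uminus)
  have "scale_poly \<i> (complexify v) * scale_poly \<i> (complexify v)
      = (Poly_Mapping.single 0 \<i> * Poly_Mapping.single 0 \<i>) * (complexify v * complexify v)"
    by (simp only: scale_conv_mult ac_simps)
  then have "p * conj_poly p = complexify u * complexify u + complexify v * complexify v"
    by (simp add: cp ii) (simp add: p algebra_simps)
  also have "\<dots> = complexify (sum_list [u\<^sup>2, v\<^sup>2])"
    by (simp add: complexify_add complexify_mult power2_eq_square)
  finally have eq: "p * conj_poly p = complexify (sum_list [u\<^sup>2, v\<^sup>2])" .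
  have "w\<^sup>2 \<in> {(\<Prod>i<length f. (f ! i) ^ \<epsilon> i) * q\<^sup>2 | \<epsilon> q. \<forall>i. \<epsilon> i \<in> {0, 1::nat}}" for w
    by (rule CollectI, rule exI[of _ "\<lambda>_. 0"], rule exI[of _ w]) simp
  then have "set [u\<^sup>2, v\<^sup>2]
      \<subseteq> {(\<Prod>i<length f. (f ! i) ^ \<epsilon> i) * q\<^sup>2 | \<epsilon> q. \<forall>i. \<epsilon> i \<in> {0, 1::nat}}"
    by (metis (no_types, lifting) empty_subsetI insert_subset list.set(1) list.simps(15))
  then have "sum_list [u\<^sup>2, v\<^sup>2] \<in> preordering f"
    unfolding preordering_def by blast
  then show ?thesis using pos eq by (metis nonneg_on_preordering_def)
qed

lemma null_left:
  assumes "p \<in> gns_null L"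
  shows "L (p * conj_poly q) = 0" "L (q * conj_poly p) = 0"
proof -
  define a b s where "a = L (p * conj_poly q)" and "b = L (q * conj_poly p)"
    and "s = L (q * conj_poly q)"
  have key: "s + c * a + cnj c * b \<in> \<real>\<^sub>\<ge>\<^sub>0" for c
  proof -
    have "(q + scale_poly c p) * conj_poly (q + scale_poly c p)
      = q * conj_poly q + scale_poly c (p * conj_poly q) + scale_poly (cnj c) (q * conj_poly p)
        + scale_poly c (scale_poly (cnj c) (p * conj_poly p))"
      by (simp add: conj_add conj_scale) (simp add: scale_conv_mult mult_single algebra_simps)
    then have "L ((q + scale_poly c p) * conj_poly (q + scale_poly c p))
       = s + c * a + cnj c * b"
      using assms by (simp add: L.add L.scale a_def b_def s_def gns_null_def)
    then show ?thesis by (metis nonneg_square)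
  qed
  have zero: "c * a + cnj c * b = 0" for c
  proof -
    define z where "z = c * a + cnj c * b"
    have *: "s + of_real t * z \<in> \<real>\<^sub>\<ge>\<^sub>0" for t
      using key[of "of_real t * c"] by (simp add: z_def algebra_simps)
    have s: "Im s = 0" using *[of 0] by (simp add: complex_nonneg_Reals_iff)
    have "Im z = 0" using *[of 1] s by (simp add: complex_nonneg_Reals_iff)
    moreover have re: "Re s + t * Re z \<ge> 0" for t
      using *[of t] by (simp add: complex_nonneg_Reals_iff)
    have "Re z = 0"
    proof (rule ccontr)
      assume nz: "Re z \<noteq> 0"
      then have "(- (Re s + 1) / Re z) * Re z = - (Re s + 1)" by simp
      with re[of "- (Re s + 1) / Re z"] show False by linarith
    qed
    ultimately show ?thesis by (simp add: z_def[symmetric] complex_eq_iff)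
  qed
  have "a + b = 0" using zero[of 1] by simp
  moreover have "\<i> * (a - b) = 0" using zero[of \<i>] by (simp add: algebra_simps)
  ultimately have "a = 0 \<and> b = 0" by auto
  then show "L (p * conj_poly q) = 0" "L (q * conj_poly p) = 0" by (simp_all add: a_def b_def)
qed

lemma null_zero: "0 \<in> gns_null L"
  by (simp add: gns_null_def L.zero)

lemma null_add:
  assumes "p \<in> gns_null L" "q \<in> gns_null L"
  shows "p + q \<in> gns_null L"
  using null_left[OF assms(1)] null_left[OF assms(2)]
  by (simp add: gns_null_def conj_add distrib_left distrib_right L.add)

lemma null_mult:
  assumes "p \<in> gns_null L"
  shows "r * p \<in> gns_null L"
proof -
  have "(r * p) * conj_poly (r * p) = p * conj_poly (conj_poly r * (r * p))"
    by (simp add: conj_mult ac_simps)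
  then show ?thesis using null_left(1)[OF assms] by (simp add: gns_null_def)
qed

lemma null_diff: "p \<in> gns_null L \<Longrightarrow> q \<in> gns_null L \<Longrightarrow> p - q \<in> gns_null L"
  using null_add[of p "- q"] null_mult[of q "- 1"] by simp

lemma class_self: "p \<in> gns_class L p"
  by (simp add: gns_class_def null_zero)

lemma class_eqI: "q - p \<in> gns_null L \<Longrightarrow> gns_class L q = gns_class L p"
proof (intro set_eqI iffI)
  fix r assume d: "q - p \<in> gns_null L"
  show "r \<in> gns_class L p" if "r \<in> gns_class L q"
    using null_add[of "r - q" "q - p"] d that by (simp add: gns_class_def)
  show "r \<in> gns_class L q" if "r \<in> gns_class L p"
    using null_diff[of "r - p" "q - p"] d that by (simp add: gns_class_def)
qed

lemma gns_op_class: "gns_op L p (gns_class L q) = gns_class L (p * q)"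
proof -
  have "gns_class L (p * r) = gns_class L (p * q)" if "r \<in> gns_class L q" for r
    using that null_mult[of "r - q" p]
    by (intro class_eqI) (simp add: gns_class_def right_diff_distrib)
  then show ?thesis unfolding gns_op_def using class_self by blast
qed

lemma gns_inner_class:
  "gns_inner L (gns_class L p) (gns_class L q) = L (p * conj_poly q)"
proof -
  have "L (p' * conj_poly q') = L (p * conj_poly q)"
    if "p' \<in> gns_class L p" "q' \<in> gns_class L q" for p' q'
  proof -
    define m n where "m = p' - p" and "n = q' - q"
    have mn: "m \<in> gns_null L" "n \<in> gns_null L"
      using that by (simp_all add: m_def n_def gns_class_def)
    have "p' * conj_poly q' = p * conj_poly q + p * conj_poly n + m * conj_poly q'"
      using conj_add[of q n] by (simp add: m_def n_def algebra_simps)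
    then show ?thesis using null_left mn by (simp add: L.add)
  qed
  then have "(\<Union>p'\<in>gns_class L p. \<Union>q'\<in>gns_class L q. {L (p' * conj_poly q')})
      = {L (p * conj_poly q)}"
    using class_self[of p] class_self[of q] by blast
  then show ?thesis by (simp add: gns_inner_def)
qed

end

end

theory Submission
  imports Defs
begin

text \<open>
  Let \<open>c\<close> be larger than the supremum of \<open>|p|\<close> on \<open>K\<^sub>f\<close> and put \<open>u = p p\<^sup>*\<close>, a sum of two real squares. The
  polynomial \<open>c\<^sup>2 - u\<close> is strictly positive on \<open>K\<^sub>f\<close>, so the Positivstellensatz of Krivine and Stengle
  yields \<open>t\<^sub>1\<close> and \<open>t\<^sub>2\<close> in the preordering with \<open>t\<^sub>2 (c\<^sup>2 - u) = 1 + t\<^sub>1\<close>. For \<open>v = q q\<^sup>*\<close> let \<open>a\<^sub>n = L(u\<^sup>n v)\<close>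
  and \<open>b\<^sub>n = L(t\<^sub>2 u\<^sup>n v)\<close>. Multiplying the identity by \<open>u\<^sup>n v\<close> and applying \<open>L\<close> shows that
  \<open>a\<^sub>n + b\<^sub>n\<^sub>+\<^sub>1 \<le> c\<^sup>2 b\<^sub>n\<close>, hence \<open>a\<^sub>n\<close> grows at most like \<open>c\<^sup>2\<^sup>n\<close>. By the Cauchy-Schwarz inequality
  \<open>a\<^sub>n\<close> is log-convex, and a log-convex sequence with this growth satisfies \<open>a\<^sub>1 \<le> c\<^sup>2 a\<^sub>0\<close>. This says that
  \<open>p q\<close> has norm at most \<open>c\<close> times the norm of \<open>q\<close> (\<open>real_part_bound\<close>, \<open>gns_op_norm_le\<close>). If \<open>K\<^sub>f\<close> is
  empty, every \<open>c > 0\<close> is admissible and the operator is zero.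

  Most of the work is the Positivstellensatz (\<open>positivstellensatz\<close>): if \<open>-1\<close> is not in the preordering,
  then \<open>K\<^sub>f\<close> has a point. A maximal proper preordering above the given one is a prime cone, that is, an
  ordering of the polynomial ring modulo a prime ideal. It is represented by its sign function
  (\<open>sign_ring\<close>), which is nonnegative on all \<open>f\<^sub>i\<close>. By the Artin-Lang property (\<open>real_point_with_signs\<close>)
  there is a real point at which the \<open>f\<^sub>i\<close> have the signs given by the ordering.

  The Artin-Lang property is proved by eliminating one variable after the other. A finite family of
  univariate polynomials that is closed under derivatives and pseudo-remainders has a sign chart that
  can be built up by degree: at a root of an earlier polynomial the sign of a new one is the sign of
  a remainder, and between such roots the new polynomial is monotone, so the signs at the two ends
  decide whether it has a root there. The construction uses only the signs of the coefficients.
  Hence the charts over the given ordered ring and over the real numbers match as soon as the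
  coefficients have the same signs (\<open>two_sign_lines\<close>, \<open>univariate_transfer\<close>).

  For this the intermediate value property and monotonicity are needed over the ordered ring. Roots
  are adjoined as in the theory of Artin and Schreier (\<open>no_certificate_if_sign_change\<close>, \<open>adjoin_root\<close>)
  until the number of roots of the finite family is maximal (\<open>intermediate_value_extension\<close>), which
  takes the place of a real closure. Monotonicity follows from a quadrature formula with
  positive real weights, which writes \<open>f(b) - f(a)\<close> as a positive combination of values of \<open>f'\<close>
  (\<open>positive_quadrature\<close>, \<open>poly_diff_quadrature\<close>).
\<close>

section \<open>Sign functions on commutative rings\<close>

text \<open>
  A sign function is the sign map of an ordered field pulled back along a ring homomorphism. It
  carries the same information as a prime cone, but statements about zeros, quotients and ordered
  extensions become equations between signs. In place of forming the quotient by the support and its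
  field of fractions, two elements count as equal when their difference has sign zero.
\<close>

locale sign_ring =
  fixes s :: "'a::comm_ring_1 \<Rightarrow> real"
  assumes sgn_values: "s a = -1 \<or> s a = 0 \<or> s a = 1"
    and one [simp]: "s 1 = 1"
    and mult: "s (a * b) = s a * s b"
    and minus [simp]: "s (- a) = - s a"
    and add_nonneg: "0 \<le> s a \<Longrightarrow> 0 \<le> s b \<Longrightarrow> 0 \<le> s (a + b)"
begin

lemma zero [simp]: "s 0 = 0"
  using minus[of 0] by simp

lemma pos_iff: "0 < s a \<longleftrightarrow> s a = 1"
  using sgn_values[of a] by auto

lemma add_null: "s b = 0 \<Longrightarrow> s (a + b) = s a"
proof -
  assume b: "s b = 0"
  have *: "0 \<le> s x \<Longrightarrow> s y = 0 \<Longrightarrow> 0 \<le> s (x + y)" for x y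
    by (rule add_nonneg) auto
  have le: "0 \<le> s (a + b) \<longleftrightarrow> 0 \<le> s a"
    using *[of a b] *[of "a + b" "- b"] b by auto
  have ge: "0 \<le> - s (a + b) \<longleftrightarrow> 0 \<le> - s a"
    using *[of "- a" "- b"] *[of "- a - b" b] b minus[of "a + b"] by auto
  show "s (a + b) = s a"
    using le ge sgn_values[of a] sgn_values[of "a + b"] by auto
qed

lemma diff_null: "s b = 0 \<Longrightarrow> s (a - b) = s a"
  using add_null[of "- b" a] by simp

lemma cong_null: "s (a - b) = 0 \<Longrightarrow> s a = s b"
  using add_null[of "a - b" b] by simp

lemma add_pos: "0 < s a \<Longrightarrow> 0 \<le> s b \<Longrightarrow> 0 < s (a + b)"
proof (rule ccontr)
  assume a: "0 < s a" "0 \<le> s b" "\<not> 0 < s (a + b)"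
  have "0 \<le> s (a + b)" using a by (intro add_nonneg) auto
  then have "s (a + b) = 0" using a by simp
  then have "s b = s (- a)" using cong_null[of b "- a"] by (simp add: add.commute)
  then show False using a by simp
qed

lemma power: "s (a ^ n) = s a ^ n"
  by (induction n) (auto simp: mult)

lemma square_nonneg: "0 \<le> s (a\<^sup>2)"
  by (simp add: power)

lemma square_pos: "s a \<noteq> 0 \<Longrightarrow> s (a\<^sup>2) = 1"
  using sgn_values[of a] by (auto simp: power)

lemma sum_pos: "finite I \<Longrightarrow> I \<noteq> {} \<Longrightarrow> (\<And>i. i \<in> I \<Longrightarrow> 0 < s (f i)) \<Longrightarrow> 0 < s (sum f I)"
proof (induction I rule: finite_ne_induct)
  case (insert x F)
  then show ?case using add_pos[of "f x" "sum f F"] by (simp add: less_imp_le)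
qed auto

lemma sum_null: "(\<And>i. i \<in> I \<Longrightarrow> s (f i) = 0) \<Longrightarrow> s (sum f I) = 0"
  by (induction I rule: infinite_finite_induct) (auto simp: add_null)

lemma of_nat_pos: "0 < n \<Longrightarrow> s (of_nat n) = 1"
proof (induction n)
  case (Suc n)
  then show ?case
    using add_pos[of 1 "of_nat n"] by (cases "n = 0") (auto simp: pos_iff)
qed simp

lemma comp_hom:
  fixes h :: "'b::comm_ring_1 \<Rightarrow> 'a"
  assumes "h 1 = 1" "\<And>x y. h (x + y) = h x + h y" "\<And>x y. h (x * y) = h x * h y"
  shows "sign_ring (s \<circ> h)"
proof -
  have "h 0 = 0" using assms(2)[of 0 0] by simp
  then have "h (- x) = - h x" for x using assms(2)[of "-x" x] by (simp add: eq_neg_iff_add_eq_0)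
  then show ?thesis using sgn_values add_nonneg by unfold_locales (auto simp: assms mult)
qed

end

lemma sign_ring_sgn: "sign_ring (sgn :: real \<Rightarrow> real)"
  by unfold_locales (auto simp: sgn_mult sgn_minus, auto simp: sgn_real_def split: if_splits)

section \<open>Preorderings and prime cones\<close>

text \<open>
  The preorderings of a commutative ring. Those containing \<open>-1\<close> are included; the others are called
  proper below.
\<close>

definition precone :: "'a::comm_ring_1 set \<Rightarrow> bool" where
  "precone T \<longleftrightarrow> (\<forall>a\<in>T. \<forall>b\<in>T. a + b \<in> T \<and> a * b \<in> T) \<and> (\<forall>a. a\<^sup>2 \<in> T)"

lemma precone_adjoin:
  assumes "precone T"
  shows "precone {q + r * a | q r. q \<in> T \<and> r \<in> T}"
proof -
  have add: "x + y \<in> T" and mul: "x * y \<in> T" if "x \<in> T" "y \<in> T" for x y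
    using assms that by (auto simp: precone_def)
  have sq: "x\<^sup>2 \<in> T" for x using assms by (auto simp: precone_def)
  have sum: "(q + r * a) + (q' + r' * a) = (q + q') + (r + r') * a"
    and prod: "(q + r * a) * (q' + r' * a) = (q * q' + r * r' * a\<^sup>2) + (q * r' + r * q') * a"
    and square: "b\<^sup>2 = b\<^sup>2 + 0\<^sup>2 * a" for q r q' r' b
    by (simp_all add: algebra_simps power2_eq_square)
  have mem: "q + r * a \<in> {q + r * a | q r. q \<in> T \<and> r \<in> T}" if "q \<in> T" "r \<in> T" for q r
    using that by blast
  show ?thesis
    unfolding precone_def
  proof (intro conjI ballI allI)
    fix x y assume "x \<in> {q + r * a | q r. q \<in> T \<and> r \<in> T}" "y \<in> {q + r * a | q r. q \<in> T \<and> r \<in> T}"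
    then obtain q r q' r' where *: "x = q + r * a" "y = q' + r' * a" "q \<in> T" "r \<in> T" "q' \<in> T" "r' \<in> T"
      by blast
    show "x + y \<in> {q + r * a | q r. q \<in> T \<and> r \<in> T}"
      unfolding * sum by (rule mem) (auto intro: add *)
    show "x * y \<in> {q + r * a | q r. q \<in> T \<and> r \<in> T}"
      unfolding * prod by (rule mem) (auto intro: add mul sq *)
  next
    fix b
    show "b\<^sup>2 \<in> {q + r * a | q r. q \<in> T \<and> r \<in> T}"
      by (subst square) (rule mem[OF sq sq])
  qed
qed

lemma precone_maximal:
  fixes T U :: "'a::comm_ring_1 set"
  assumes T: "precone T" and U: "\<And>u. u \<in> U \<Longrightarrow> - u \<notin> T"
  obtains Q where "precone Q" "T \<subseteq> Q" "\<And>u. u \<in> U \<Longrightarrow> - u \<notin> Q"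
    "\<And>Q'. precone Q' \<Longrightarrow> Q \<subseteq> Q' \<Longrightarrow> (\<And>u. u \<in> U \<Longrightarrow> - u \<notin> Q') \<Longrightarrow> Q' = Q"
proof -
  define A where "A = {Q. precone Q \<and> T \<subseteq> Q \<and> (\<forall>u\<in>U. - u \<notin> Q)}"
  have "\<exists>M\<in>A. \<forall>X\<in>A. M \<subseteq> X \<longrightarrow> X = M"
  proof (rule subset_Zorn_nonempty)
    show "A \<noteq> {}" using T U by (auto simp: A_def)
  next
    fix C assume C: "C \<noteq> {}" "subset.chain A C"
    have "precone (\<Union>C)"
      unfolding precone_def
    proof (intro conjI ballI allI)
      fix a b assume "a \<in> \<Union>C" "b \<in> \<Union>C"
      then obtain X Y where XY: "a \<in> X" "b \<in> Y" "X \<in> C" "Y \<in> C" by auto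
      then have "X \<subseteq> Y \<or> Y \<subseteq> X" using C by (auto simp: subset.chain_def)
      then obtain Z where Z: "a \<in> Z" "b \<in> Z" "Z \<in> C" using XY by auto
      then have "precone Z" using C by (auto simp: subset.chain_def A_def)
      then show "a + b \<in> \<Union>C" "a * b \<in> \<Union>C" using Z by (auto simp: precone_def)
    next
      fix a
      obtain Z where Z: "Z \<in> C" using C by auto
      then have "precone Z" using C by (auto simp: subset.chain_def A_def)
      then show "a\<^sup>2 \<in> \<Union>C" using Z by (auto simp: precone_def)
    qed
    moreover have "C \<subseteq> A" using C by (simp add: subset.chain_def)
    then have "\<forall>u\<in>U. - u \<notin> \<Union>C" by (auto simp: A_def)
    moreover have "T \<subseteq> \<Union>C" using C(1) \<open>C \<subseteq> A\<close> unfolding A_def by blast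
    ultimately show "\<Union>C \<in> A" by (simp add: A_def)
  qed
  then obtain M where "M \<in> A" "\<forall>X\<in>A. M \<subseteq> X \<longrightarrow> X = M" by auto
  then show ?thesis by (intro that[of M]) (auto simp: A_def)
qed

text \<open>
  A preordering that is maximal among those disjoint from \<open>-U\<close> is a prime cone, because it cannot be
  enlarged by any element outside it. The multiplicative set \<open>U\<close> records which elements have to
  remain strictly positive; with \<open>U = {1}\<close> only properness is kept, while in an extension of an
  ordered ring \<open>U\<close> consists of all positive elements of the old ring, so that its order does not
  degenerate.
\<close>

lemma precone_imp_sign_ring:
  fixes T U :: "'a::comm_ring_1 set"
  assumes T: "precone T" and UT: "U \<subseteq> T" and one: "1 \<in> U"
    and Umult: "\<And>u v. u \<in> U \<Longrightarrow> v \<in> U \<Longrightarrow> u * v \<in> U"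
    and disj: "\<And>u. u \<in> U \<Longrightarrow> - u \<notin> T"
  obtains s where "sign_ring s" "\<And>t. t \<in> T \<Longrightarrow> 0 \<le> s t" "\<And>u. u \<in> U \<Longrightarrow> s u = 1"
proof -
  obtain Q where Q: "precone Q" "T \<subseteq> Q" and QU: "\<And>u. u \<in> U \<Longrightarrow> - u \<notin> Q"
    and max: "\<And>Q'. precone Q' \<Longrightarrow> Q \<subseteq> Q' \<Longrightarrow> (\<And>u. u \<in> U \<Longrightarrow> - u \<notin> Q') \<Longrightarrow> Q' = Q"
    using precone_maximal[OF T disj] by metis
  have add: "x + y \<in> Q" and mul: "x * y \<in> Q" if "x \<in> Q" "y \<in> Q" for x y
    using Q that by (auto simp: precone_def)
  have sq: "x\<^sup>2 \<in> Q" for x using Q by (auto simp: precone_def)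
  have UQ: "u \<in> Q" if "u \<in> U" for u using that UT Q by auto
  have one_Q: "1 \<in> Q" and zero_Q: "0 \<in> Q" using sq[of 1] sq[of 0] by auto
  have adj: "\<exists>u\<in>U. \<exists>q\<in>Q. \<exists>r\<in>Q. - u = q + r * a" if a: "a \<notin> Q" for a
  proof (rule ccontr)
    assume neg: "\<not> ?thesis"
    let ?Q = "{q + r * a | q r. q \<in> Q \<and> r \<in> Q}"
    have "?Q = Q"
    proof (rule max)
      show "precone ?Q" by (rule precone_adjoin[OF Q(1)])
      show "Q \<subseteq> ?Q" using zero_Q by force
      show "- u \<notin> ?Q" if "u \<in> U" for u using neg that by auto
    qed
    moreover have "a \<in> ?Q" using zero_Q one_Q by force
    ultimately show False using a by auto
  qed
  have total: "a \<in> Q \<or> - a \<in> Q" for a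
  proof (rule ccontr)
    assume "\<not> ?thesis"
    then obtain u q r u' q' r' where *: "u \<in> U" "q \<in> Q" "r \<in> Q" "- u = q + r * a"
       "u' \<in> U" "q' \<in> Q" "r' \<in> Q" "- u' = q' + r' * (- a)"
      using adj[of a] adj[of "- a"] by blast
    have prod: "(u + q) * (u' + q') = (- (r * a)) * (r' * a)"
    proof -
      have "u = - (q + r * a)" "u' = - (q' + r' * - a)"
        using *(4,8) by (metis minus_minus)+
      then show ?thesis by simp
    qed
    have "- (u * u') = (u * q' + q * u' + q * q') - (u + q) * (u' + q')"
      by (simp add: algebra_simps)
    also have "\<dots> = u * q' + q * u' + q * q' + r * r' * a\<^sup>2"
      unfolding prod by (simp add: algebra_simps power2_eq_square)
    also have "\<dots> \<in> Q" using * UQ sq add mul by auto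
    finally show False using QU Umult * by blast
  qed
  have sum_zero: "b * a \<in> Q" if "a \<in> Q" "- a \<in> Q" for a b
    using total[of b] mul[OF _ that(1), of b] mul[OF _ that(2), of "- b"] by auto
  have prime: "a \<notin> Q \<Longrightarrow> b \<notin> Q \<Longrightarrow> - (a * b) \<notin> Q" for a b
  proof
    assume ab: "a \<notin> Q" "b \<notin> Q" "- (a * b) \<in> Q"
    then obtain u q r u' q' r' where *: "u \<in> U" "q \<in> Q" "r \<in> Q" "- u = q + r * a"
       "u' \<in> U" "q' \<in> Q" "r' \<in> Q" "- u' = q' + r' * b"
      using adj[of a] adj[of b] by blast
    have prod: "(u + q) * (u' + q') = (r * a) * (r' * b)"
    proof -
      have "u = - (q + r * a)" "u' = - (q' + r' * b)"
        using *(4,8) by (metis minus_minus)+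
      then show ?thesis by simp
    qed
    have "- (u * u') = (u * q' + q * u' + q * q') - (u + q) * (u' + q')"
      by (simp add: algebra_simps)
    also have "\<dots> = u * q' + q * u' + q * q' + (r * r') * - (a * b)"
      unfolding prod by (simp add: algebra_simps power2_eq_square)
    also have "\<dots> \<in> Q" using * UQ ab add mul by metis
    finally show False using QU Umult * by blast
  qed
  define s :: "'a \<Rightarrow> real" where "s a = (if a \<in> Q then (if - a \<in> Q then 0 else 1) else -1)" for a
  have "sign_ring s"
  proof
    fix a b
    show "s a = -1 \<or> s a = 0 \<or> s a = 1" by (auto simp: s_def)
    show "s 1 = 1" using QU[OF one] one_Q by (auto simp: s_def)
    show "s (- a) = - s a" using total[of a] by (auto simp: s_def)
    show "0 \<le> s a \<Longrightarrow> 0 \<le> s b \<Longrightarrow> 0 \<le> s (a + b)" using add by (auto simp: s_def split: if_splits)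
    show "s (a * b) = s a * s b"
      using total[of a] total[of b] mul[of a b] mul[of "-a" "-b"] mul[of a "-b"] mul[of "- a" b]
        prime[of a b] prime[of "- a" b] prime[of a "- b"] prime[of "- a" "- b"]
        sum_zero[of a b] sum_zero[of b a] sum_zero[of a "-b"] sum_zero[of b "-a"]
      by (cases "a \<in> Q"; cases "- a \<in> Q"; cases "b \<in> Q"; cases "- b \<in> Q")
         (simp_all add: s_def mult.commute)
  qed
  moreover have "0 \<le> s t" if "t \<in> T" for t using that Q by (auto simp: s_def)
  moreover have "s u = 1" if "u \<in> U" for u using that QU UQ by (auto simp: s_def)
  ultimately show ?thesis using that by blast
qed

section \<open>Univariate polynomials over a ring with a sign function\<close>

lemma degree_less_if_top_zero:
  "degree p \<le> n \<Longrightarrow> coeff p n = 0 \<Longrightarrow> 0 < n \<Longrightarrow> degree p < n"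
  by (metis degree_0 leading_coeff_0_iff le_neq_implies_less)

definition subring_set :: "'a::comm_ring_1 set \<Rightarrow> bool" where
  "subring_set S \<longleftrightarrow> 1 \<in> S \<and> (\<forall>a\<in>S. \<forall>b\<in>S. a - b \<in> S \<and> a * b \<in> S)"

lemma subring_setD:
  assumes "subring_set S"
  shows "1 \<in> S" "0 \<in> S" "a \<in> S \<Longrightarrow> b \<in> S \<Longrightarrow> a - b \<in> S" "a \<in> S \<Longrightarrow> b \<in> S \<Longrightarrow> a * b \<in> S"
    "a \<in> S \<Longrightarrow> b \<in> S \<Longrightarrow> a + b \<in> S" "a \<in> S \<Longrightarrow> - a \<in> S"
proof -
  show 1: "1 \<in> S" and 2: "\<And>a b. a \<in> S \<Longrightarrow> b \<in> S \<Longrightarrow> a - b \<in> S"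
    and "a \<in> S \<Longrightarrow> b \<in> S \<Longrightarrow> a * b \<in> S"
    using assms by (auto simp: subring_set_def)
  show 0: "0 \<in> S" using 2[OF 1 1] by simp
  show 3: "- a \<in> S" if "a \<in> S" for a using 2[OF 0 that] by simp
  show "a \<in> S \<Longrightarrow> b \<in> S \<Longrightarrow> a + b \<in> S" using 2[of a "- b"] 3[of b] by simp
qed

text \<open>
  The remainder is recorded to have coefficients in the same subring: in the elimination of one
  variable, \<open>S\<close> is the polynomial ring in the remaining variables.
\<close>

lemma pseudo_division:
  fixes f g :: "'a::comm_ring_1 poly"
  assumes S: "subring_set S" and g: "1 \<le> degree g" "\<And>i. coeff g i \<in> S"
    and f: "\<And>i. coeff f i \<in> S"
  shows "\<exists>k q r. smult (lead_coeff g ^ k) f = q * g + r \<and> degree r < degree g \<and> (\<forall>i. coeff r i \<in> S)"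
  using f
proof (induction "degree f" arbitrary: f rule: less_induct)
  case less
  note S = subring_setD[OF S]
  show ?case
  proof (cases "degree f < degree g")
    case True
    then have "smult (lead_coeff g ^ 0) f = 0 * g + f" by simp
    then show ?thesis using True less.prems by blast
  next
    case False
    define m where "m = monom (lead_coeff f) (degree f - degree g)"
    define f' where "f' = smult (lead_coeff g) f - m * g"
    have "degree (m * g) \<le> degree f"
      using degree_mult_le[of m g] degree_monom_le[of "lead_coeff f" "degree f - degree g"] False
      by (auto simp: m_def)
    then have "degree f' \<le> degree f"
      unfolding f'_def by (intro degree_diff_le) (auto intro: degree_smult_le)
    moreover have "coeff f' (degree f) = 0"
      using False by (simp add: f'_def m_def coeff_monom_mult)
    ultimately have "degree f' < degree f"
      using False g(1) by (intro degree_less_if_top_zero) auto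
    moreover have "coeff f' i \<in> S" for i
      using S g(2) less.prems by (auto simp: f'_def m_def coeff_monom_mult)
    ultimately obtain k q r where *: "smult (lead_coeff g ^ k) f' = q * g + r"
      "degree r < degree g" "\<forall>i. coeff r i \<in> S"
      using less.hyps by meson
    have "smult (lead_coeff g ^ Suc k) f = smult (lead_coeff g ^ k) f' + smult (lead_coeff g ^ k) (m * g)"
      by (simp add: f'_def smult_diff_right mult.commute)
    also have "\<dots> = (q + smult (lead_coeff g ^ k) m) * g + r"
      by (simp add: * algebra_simps)
    finally show ?thesis using * by blast
  qed
qed

context sign_ring begin

definition null_poly :: "'a poly \<Rightarrow> bool" where
  "null_poly z \<longleftrightarrow> (\<forall>i. s (coeff z i) = 0)"

lemma null_poly_add: "null_poly y \<Longrightarrow> null_poly z \<Longrightarrow> null_poly (y + z)"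
  and null_poly_diff: "null_poly y \<Longrightarrow> null_poly z \<Longrightarrow> null_poly (y - z)"
  and null_poly_minus: "null_poly z \<Longrightarrow> null_poly (- z)"
  and null_poly_0 [simp]: "null_poly 0"
  by (auto simp: null_poly_def add_null diff_null)

lemma null_poly_mult: "null_poly z \<Longrightarrow> null_poly (h * z)"
  by (auto simp: null_poly_def coeff_mult mult intro!: sum_null)

lemma null_poly_smult: "null_poly z \<Longrightarrow> null_poly (smult c z)"
  by (auto simp: null_poly_def mult)

lemma null_poly_eval: "null_poly z \<Longrightarrow> s (poly z x) = 0"
  by (auto simp: null_poly_def poly_altdef mult intro!: sum_null)

text \<open>
  Up to coefficients of sign zero, every polynomial has a leading coefficient of nonzero sign. This
  replaces passing to the residue field.
\<close>

lemma truncation: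
  obtains n where "null_poly (p - poly_cutoff n p)"
    "poly_cutoff n p = 0 \<or> s (lead_coeff (poly_cutoff n p)) \<noteq> 0"
    "degree (poly_cutoff n p) \<le> degree p"
proof -
  define P where "P n \<longleftrightarrow> (\<forall>i\<ge>n. s (coeff p i) = 0)" for n
  define n where "n = (LEAST n. P n)"
  have "P (Suc (degree p))" by (auto simp: P_def coeff_eq_0)
  then have n: "P n" unfolding n_def by (rule LeastI)
  have le: "degree (poly_cutoff n p) \<le> degree p"
    by (rule degree_le) (auto simp: coeff_poly_cutoff coeff_eq_0)
  have "null_poly (p - poly_cutoff n p)"
    using n by (auto simp: null_poly_def coeff_poly_cutoff P_def)
  moreover have "poly_cutoff n p = 0 \<or> s (lead_coeff (poly_cutoff n p)) \<noteq> 0"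
  proof (cases n)
    case 0
    then have "poly_cutoff n p = 0" by (intro poly_eqI) (simp add: coeff_poly_cutoff)
    then show ?thesis ..
  next
    case (Suc k)
    then have "\<not> P k" unfolding n_def using not_less_Least[of k P] by simp
    then have k: "s (coeff p k) \<noteq> 0" using n Suc
      unfolding P_def by (metis le_antisym not_less_eq_eq)
    have "degree (poly_cutoff n p) = k"
    proof (rule antisym)
      show "degree (poly_cutoff n p) \<le> k"
        by (rule degree_le) (auto simp: coeff_poly_cutoff Suc)
      show "k \<le> degree (poly_cutoff n p)"
        using k by (intro le_degree) (auto simp: coeff_poly_cutoff Suc)
    qed
    then show ?thesis using k by (simp add: coeff_poly_cutoff Suc)
  qed
  ultimately show ?thesis using that le by blast
qed

section \<open>Adjoining a root or an infinitely large element\<close>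

text \<open>
  The elements that have to be nonnegative on the interval from \<open>a\<close> to \<open>b\<close>. The weight
  \<open>(X - a) (b - X)\<close> is left out, since it would be of degree two and destroy the degree estimate
  below; up to the positive factor \<open>b - a\<close> it is recovered in \<open>qmodule_mult\<close>. The parameter \<open>D\<close>
  restricts the polynomials that are squared.
\<close>

inductive_set qmodule :: "('a poly \<Rightarrow> bool) \<Rightarrow> 'a \<Rightarrow> 'a \<Rightarrow> 'a poly set"
  for D :: "'a poly \<Rightarrow> bool" and a b :: 'a where
  zero: "0 \<in> qmodule D a b"
| step: "t \<in> qmodule D a b \<Longrightarrow> 0 \<le> s c \<Longrightarrow> D q \<Longrightarrow> w \<in> {1, [:- a, 1:], [:b, - 1:]}
    \<Longrightarrow> smult c (w * q\<^sup>2) + t \<in> qmodule D a b"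

lemma qmodule_add: "t \<in> qmodule D a b \<Longrightarrow> t' \<in> qmodule D a b \<Longrightarrow> t + t' \<in> qmodule D a b"
  by (induction rule: qmodule.induct) (auto simp: add.assoc intro: qmodule.step)

lemma qmodule_smult: "t \<in> qmodule D a b \<Longrightarrow> 0 \<le> s c \<Longrightarrow> smult c t \<in> qmodule D a b"
proof (induction rule: qmodule.induct)
  case (step t c' q w)
  then show ?case
    using qmodule.step[of "smult c t" D a b "c * c'" q w] by (simp add: mult smult_add_right)
qed (auto intro: qmodule.zero)

lemma qmodule_term: "0 \<le> s c \<Longrightarrow> D q \<Longrightarrow> w \<in> {1, [:- a, 1:], [:b, - 1:]}
    \<Longrightarrow> smult c (w * q\<^sup>2) \<in> qmodule D a b"
  using qmodule.step[OF qmodule.zero] by (metis add.right_neutral)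

lemma qmodule_eval:
  assumes "t \<in> qmodule D a b" "0 \<le> s (x - a)" "0 \<le> s (b - x)"
  shows "0 \<le> s (poly t x)"
  using assms(1)
proof (induction rule: qmodule.induct)
  case (step t c q w)
  have "0 \<le> s (poly w x)" using step.hyps(4) assms(2,3) by auto
  then have "0 \<le> s (poly (smult c (w * q\<^sup>2)) x)"
    using step.hyps(2) square_nonneg[of "poly q x"] by (simp add: mult)
  then show ?case using step.IH by (simp add: add_nonneg)
qed simp

lemma qmodule_degree:
  assumes "t \<in> qmodule (\<lambda>q. degree q < n) a b"
  shows "degree t \<le> 2 * n - 1"
  using assms
proof (induction rule: qmodule.induct)
  case (step t c q w)
  have "degree w \<le> 1" using step.hyps(4) by auto
  moreover have "degree (q\<^sup>2) \<le> 2 * degree q"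
    using degree_power_le[of q 2] by (simp add: mult.commute)
  ultimately have "degree (w * q\<^sup>2) \<le> 2 * n - 1"
    using degree_mult_le[of w "q\<^sup>2"] step.hyps(3) by linarith
  then have "degree (smult c (w * q\<^sup>2)) \<le> 2 * n - 1"
    using degree_smult_le[of c "w * q\<^sup>2"] by linarith
  then show ?case using step.IH by (intro degree_add_le)
qed simp

lemma qmodule_reduce:
  assumes "t \<in> qmodule (\<lambda>_. True) a b" "1 \<le> degree p"
  shows "\<exists>k t' h. t' \<in> qmodule (\<lambda>q. degree q < degree p) a b \<and>
    smult (lead_coeff p ^ (2 * k)) t = t' + h * p"
  using assms(1)
proof (induction rule: qmodule.induct)
  case zero
  show ?case by (rule exI[of _ 0], rule exI[of _ 0], rule exI[of _ 0]) (auto intro: qmodule.zero)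
next
  case (step t c q w)
  let ?l = "lead_coeff p"
  obtain k t' h where 1: "t' \<in> qmodule (\<lambda>q. degree q < degree p) a b"
    "smult (?l ^ (2 * k)) t = t' + h * p" using step.IH by blast
  obtain m g r where 2: "smult (?l ^ m) q = g * p + r" "degree r < degree p"
    using pseudo_division[of UNIV p q] assms(2) by (auto simp: subring_set_def)
  have "smult (?l ^ (2 * m)) (q\<^sup>2) = (smult (?l ^ m) q)\<^sup>2"
    by (simp add: power2_eq_square mult_2 power_add)
  also have "\<dots> = r\<^sup>2 + (g * g * p + 2 * g * r) * p"
    unfolding 2 by (simp add: power2_eq_square algebra_simps)
  finally have sq: "smult (?l ^ (2 * m)) (q\<^sup>2) = r\<^sup>2 + (g * g * p + 2 * g * r) * p" .
  have "smult (?l ^ (2 * (k + m))) (smult c (w * q\<^sup>2) + t)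
     = smult (?l ^ (2 * k) * c) (w * smult (?l ^ (2 * m)) (q\<^sup>2)) + smult (?l ^ (2 * m)) (smult (?l ^ (2 * k)) t)"
    by (simp add: smult_add_right power_add ac_simps distrib_left)
  also have "\<dots> = (smult (?l ^ (2 * k) * c) (w * r\<^sup>2) + smult (?l ^ (2 * m)) t')
      + (smult (?l ^ (2 * k) * c) (w * (g * g * p + 2 * g * r)) + smult (?l ^ (2 * m)) h) * p"
    unfolding sq 1(2) by (simp add: smult_add_right distrib_left distrib_right ac_simps)
  finally have "smult (?l ^ (2 * (k + m))) (smult c (w * q\<^sup>2) + t) = \<dots>" .
  moreover have "0 \<le> s (?l ^ (2 * k) * c)" "0 \<le> s (?l ^ (2 * m))"
    using step.hyps(2) by (auto simp: mult power power_mult)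
  then have "smult (?l ^ (2 * k) * c) (w * r\<^sup>2) + smult (?l ^ (2 * m)) t'
      \<in> qmodule (\<lambda>q. degree q < degree p) a b"
    using 1 2 step.hyps(4) by (intro qmodule_add qmodule_smult qmodule_term) auto
  ultimately show ?case by blast
qed

text \<open>
  If \<open>p\<close> changes sign between \<open>a\<close> and \<open>b\<close>, then no multiple of \<open>p\<close> is positive throughout the interval
  for algebraic reasons. The proof is the degree descent of Artin and Schreier: after reduction
  modulo \<open>p\<close> the left-hand side has degree less than \<open>2 deg p\<close>, so the cofactor has smaller degree
  than \<open>p\<close>. Both sides being positive at \<open>a\<close> and at \<open>b\<close>, the cofactor changes sign as well, and the
  same identity is a certificate for it.
\<close>

lemma no_certificate_if_sign_change:
  assumes "0 \<le> s (b - a)" "s (poly p a) * s (poly p b) < 0"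
    "0 < s u" "t \<in> qmodule (\<lambda>_. True) a b" "null_poly z"
    "[:u:] + t = h * p + z"
  shows False
  using assms(2-)
proof (induction "degree p" arbitrary: p u t h z rule: less_induct)
  case less
  obtain n where n: "null_poly (p - poly_cutoff n p)"
    "poly_cutoff n p = 0 \<or> s (lead_coeff (poly_cutoff n p)) \<noteq> 0"
    "degree (poly_cutoff n p) \<le> degree p"
    by (rule truncation)
  define p' where "p' = poly_cutoff n p"
  let ?l = "lead_coeff p'"
  have ev: "s (poly p' x) = s (poly p x)" for x
    using null_poly_eval[OF n(1), of x] cong_null[of "poly p x" "poly p' x"] by (simp add: p'_def)
  have deg: "1 \<le> degree p'"
  proof (rule ccontr)
    assume "\<not> ?thesis"
    then obtain c where "p' = [:c:]" by (metis degree_eq_zeroE less_one not_less)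
    then show False using less.prems(1) ev[of a] ev[of b] by (simp add: not_less[symmetric])
  qed
  then have l: "s ?l \<noteq> 0" using n(2) by (auto simp: p'_def)
  obtain k t' h' where red: "t' \<in> qmodule (\<lambda>q. degree q < degree p') a b"
    "smult (?l ^ (2 * k)) t = t' + h' * p'"
    using qmodule_reduce[OF less.prems(3) deg] by blast
  define u' where "u' = ?l ^ (2 * k) * u"
  have u': "0 < s u'" using less.prems(2) l square_pos[OF l]
    by (simp add: u'_def mult power_mult power)
  define z' where "z' = smult (?l ^ (2 * k)) (h * (p - p') + z)"
  have z': "null_poly z'"
    unfolding z'_def using n(1) less.prems(4)
    by (intro null_poly_smult null_poly_add null_poly_mult) (auto simp: p'_def)
  define g where "g = smult (?l ^ (2 * k)) h - h'"
  have "smult (?l ^ (2 * k)) ([:u:] + t) = smult (?l ^ (2 * k)) (h * p + z)"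
    using less.prems(5) by simp
  then have eq: "[:u':] + t' = g * p' + z'"
    using red(2) by (simp add: u'_def z'_def g_def smult_add_right algebra_simps smult_diff_right)
  obtain m where m: "null_poly (g - poly_cutoff m g)"
    "poly_cutoff m g = 0 \<or> s (lead_coeff (poly_cutoff m g)) \<noteq> 0"
    by (rule truncation)
  define g' where "g' = poly_cutoff m g"
  \<comment> \<open>The truncated part of the cofactor is absorbed into the null polynomial.\<close>
  define z'' where "z'' = (g - g') * p' + z'"
  have z'': "null_poly z''"
    unfolding z''_def using m(1) z' by (subst mult.commute) (intro null_poly_add null_poly_mult, auto simp: g'_def)
  have eq': "[:u':] + t' = p' * g' + z''"
    using eq by (simp add: z''_def algebra_simps)
  have pos: "0 < s (poly g' x) * s (poly p x)" if "0 \<le> s (x - a)" "0 \<le> s (b - x)" for x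
  proof -
    have "0 < s (u' + poly t' x)"
      by (rule add_pos[OF u' qmodule_eval[OF red(1) that]])
    also have "u' + poly t' x = poly ([:u':] + t') x" by simp
    also have "s \<dots> = s (poly g' x * poly p' x)"
      unfolding eq' using null_poly_eval[OF z'', of x] by (simp add: add_null mult.commute)
    finally show ?thesis by (simp add: mult ev)
  qed
  have deg_g: "degree g' < degree p'"
  proof (rule ccontr)
    assume "\<not> ?thesis"
    then have ge: "2 * degree p' - 1 < degree p' + degree g'" using deg by linarith
    have "degree ([:u':] + t') \<le> 2 * degree p' - 1"
      using qmodule_degree[OF red(1)] by (intro degree_add_le) auto
    then have "coeff ([:u':] + t') (degree p' + degree g') = 0"
      using ge by (intro coeff_eq_0) linarith
    then have "s (?l * lead_coeff g' + coeff z'' (degree p' + degree g')) = 0"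
      unfolding eq' by (simp add: coeff_mult_degree_sum)
    then have "s ?l * s (lead_coeff g') = 0"
      using z'' by (simp add: add_null null_poly_def mult)
    then have "g' = 0" using l m(2) by (auto simp: g'_def)
    then show False using pos[of a] assms(1) by simp
  qed
  have "0 < s (poly g' a) * s (poly p a)" "0 < s (poly g' b) * s (poly p b)"
    using pos[of a] pos[of b] assms(1) by auto
  then have "s (poly g' a) * s (poly g' b) < 0"
    using less.prems(1) by (auto simp: zero_less_mult_iff mult_less_0_iff)
  moreover have "degree g' < degree p" using deg_g n(3) by (simp add: p'_def)
  moreover have "t' \<in> qmodule (\<lambda>_. True) a b"
    using red(1) by (induction rule: qmodule.induct) (auto intro: qmodule.intros)
  ultimately show False using less.hyps u' z'' eq' by blast
qed

text \<open>
  Since \<open>(b - a) (X - a) (b - X) = (X - a)\<^sup>2 (b - X) + (b - X)\<^sup>2 (X - a)\<close>, the quadratic module is closed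
  under multiplication once division by \<open>b - a\<close> is allowed.
\<close>

lemma qmodule_mult:
  assumes ab: "0 \<le> s (b - a)"
    and t: "t \<in> qmodule (\<lambda>_. True) a b" and t': "t' \<in> qmodule (\<lambda>_. True) a b"
  shows "smult (b - a) (t * t') \<in> qmodule (\<lambda>_. True) a b"
proof -
  let ?M = "qmodule (\<lambda>_. True) a b"
  have w: "smult (b - a) (w * w' * r\<^sup>2) \<in> ?M"
    if ww: "w \<in> {1, [:- a, 1:], [:b, - 1:]}" "w' \<in> {1, [:- a, 1:], [:b, - 1:]}" for w w' r
  proof -
    have mixed: "smult (b - a) ([:- a, 1:] * [:b, - 1:] * r\<^sup>2)
       = smult 1 ([:b, - 1:] * ([:- a, 1:] * r)\<^sup>2) + smult 1 ([:- a, 1:] * ([:b, - 1:] * r)\<^sup>2)"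
    proof -
      have "[:b - a:] = [:- a, 1:] + [:b, - 1:]" by simp
      then have "smult (b - a) p = ([:- a, 1:] + [:b, - 1:]) * p" for p
        by (metis (no_types) mult.commute mult_smult_right mult_1_right smult_1_left mult_pCons_left add_0_right pCons_0_0 mult_zero_left)
      then show ?thesis by (simp only: power2_eq_square smult_1_left) (simp only: algebra_simps)
    qed
    have m1: "smult (b - a) ([:- a, 1:] * [:b, - 1:] * r\<^sup>2) \<in> ?M"
      unfolding mixed by (intro qmodule_add qmodule_term) auto
    have m2: "smult (b - a) ([:b, - 1:] * [:- a, 1:] * r\<^sup>2) \<in> ?M"
      using m1 by (simp only: mult.commute)
    have sq: "smult (b - a) (w * w * r\<^sup>2) \<in> ?M" for w
      using qmodule_term[of "b - a" "\<lambda>_. True" "w * r" 1 a b] ab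
      by (simp add: power2_eq_square ac_simps)
    have one: "smult (b - a) (w * 1 * r\<^sup>2) \<in> ?M" "smult (b - a) (1 * w * r\<^sup>2) \<in> ?M"
      if "w \<in> {1, [:- a, 1:], [:b, - 1:]}" for w
      using qmodule_term[of "b - a" "\<lambda>_. True" r w a b] ab that by auto
    consider "w = w'" | "w = 1" | "w' = 1" | "w = [:- a, 1:]" "w' = [:b, - 1:]" | "w = [:b, - 1:]" "w' = [:- a, 1:]"
      using ww by blast
    then show ?thesis
      by cases (use ww m1 m2 sq one in \<open>blast+\<close>)
  qed
  have 1: "smult (b - a) (smult c (w * q\<^sup>2) * t') \<in> ?M"
    if cw: "0 \<le> s c" "w \<in> {1, [:- a, 1:], [:b, - 1:]}" for c w q
    using t'
  proof (induction rule: qmodule.induct)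
    case (step t' c' q' w')
    have "smult (b - a) (smult c (w * q\<^sup>2) * (smult c' (w' * q'\<^sup>2) + t'))
      = smult (c * c') (smult (b - a) (w * w' * (q * q')\<^sup>2)) + smult (b - a) (smult c (w * q\<^sup>2) * t')"
      by (simp add: power_mult_distrib distrib_left smult_add_right ac_simps)
    then show ?case
      using qmodule_add[OF qmodule_smult[OF w[OF cw(2) step.hyps(4)], of "c * c'"] step.IH] cw step.hyps
      by (simp add: mult)
  qed (auto intro: qmodule.zero)
  show ?thesis
    using t
  proof (induction rule: qmodule.induct)
    case (step t c q w)
    then show ?case
      using qmodule_add[OF 1[of c w q] step.IH] by (simp add: distrib_right smult_add_right)
  qed (auto intro: qmodule.zero)
qed

text \<open>
  The ordered extension in which \<open>X\<close> is a root of \<open>p\<close> between \<open>a\<close> and \<open>b\<close>. Allowing a positive constant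
  denominator in the preordering makes the module generated by the two endpoint conditions
  multiplicative, and adding null polynomials keeps the elements of sign zero at zero. That this
  preordering contains no negative constant is exactly the absence of a certificate.
\<close>

lemma adjoin_root:
  assumes ab: "0 < s (b - a)" and change: "s (poly p a) * s (poly p b) < 0"
  obtains s' where "sign_ring s'" "\<And>c. s' [:c:] = s c" "s' p = 0"
    "0 \<le> s' [:- a, 1:]" "0 \<le> s' [:b, - 1:]"
proof -
  let ?M = "qmodule (\<lambda>_. True) a b"
  define T where "T = {t. \<exists>u m h z. s u = 1 \<and> m \<in> ?M \<and> null_poly z \<and> smult u t = m + h * p + z}"
  define U where "U = {[:u:] | u. s u = 1}"
  have TI: "t \<in> T" if "s u = 1" "m \<in> ?M" "null_poly z" "smult u t = m + h * p + z" for t u m h z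
    using that unfolding T_def by blast
  have M_in_T: "m \<in> T" if "m \<in> ?M" for m
    by (rule TI[of 1 m 0 _ 0]) (use that in auto)
  have term_in_T: "smult c (w * q\<^sup>2) \<in> T" if "0 \<le> s c" "w \<in> {1, [:- a, 1:], [:b, - 1:]}" for c w q
    using that by (intro M_in_T qmodule_term) auto
  have "precone T"
    unfolding precone_def
  proof (intro conjI ballI allI)
    fix t1 t2 assume "t1 \<in> T" "t2 \<in> T"
    then obtain u1 m1 h1 z1 u2 m2 h2 z2 where
      1: "s u1 = 1" "m1 \<in> ?M" "null_poly z1" "smult u1 t1 = m1 + h1 * p + z1" and
      2: "s u2 = 1" "m2 \<in> ?M" "null_poly z2" "smult u2 t2 = m2 + h2 * p + z2"
      unfolding T_def by blast
    show "t1 + t2 \<in> T"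
    proof (rule TI)
      have "smult (u1 * u2) (t1 + t2) = smult u2 (smult u1 t1) + smult u1 (smult u2 t2)"
        by (simp add: smult_add_right mult.commute)
      then show "smult (u1 * u2) (t1 + t2) = (smult u2 m1 + smult u1 m2) + (smult u2 h1 + smult u1 h2) * p
          + (smult u2 z1 + smult u1 z2)"
        unfolding 1 2 by (simp add: smult_add_right distrib_right)
      show "s (u1 * u2) = 1" using 1 2 by (simp add: mult)
      show "smult u2 m1 + smult u1 m2 \<in> ?M" using 1 2 by (intro qmodule_add qmodule_smult) auto
      show "null_poly (smult u2 z1 + smult u1 z2)" using 1 2 by (intro null_poly_add null_poly_smult)
    qed
    show "t1 * t2 \<in> T"
    proof (rule TI)
      let ?H = "smult (b - a) (m1 * h2 + h1 * (m2 + h2 * p))"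
      let ?Z = "smult (b - a) ((m1 + h1 * p) * z2 + (m2 + h2 * p + z2) * z1)"
      have "smult ((b - a) * (u1 * u2)) (t1 * t2) = smult (b - a) (smult u1 t1 * smult u2 t2)"
        by (simp add: ac_simps)
      also have "\<dots> = smult (b - a) (m1 * m2 + (m1 * h2 + h1 * (m2 + h2 * p)) * p
          + ((m1 + h1 * p) * z2 + (m2 + h2 * p + z2) * z1))"
        unfolding 1 2 by (simp add: algebra_simps)
      also have "\<dots> = smult (b - a) (m1 * m2) + ?H * p + ?Z"
        by (simp only: smult_add_right mult_smult_left distrib_right)
      finally show "smult ((b - a) * (u1 * u2)) (t1 * t2) = smult (b - a) (m1 * m2) + ?H * p + ?Z" .
      show "s ((b - a) * (u1 * u2)) = 1" using 1 2 ab by (simp add: mult pos_iff)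
      show "smult (b - a) (m1 * m2) \<in> ?M" using 1 2 ab by (intro qmodule_mult) auto
      show "null_poly ?Z" using 1 2 by (intro null_poly_smult null_poly_add null_poly_mult)
    qed
  next
    fix q show "q\<^sup>2 \<in> T" using term_in_T[of 1 1 q] by simp
  qed
  moreover have "U \<subseteq> T"
  proof
    fix x assume "x \<in> U"
    then obtain u where u: "x = [:u:]" "s u = 1" by (auto simp: U_def)
    then show "x \<in> T" using term_in_T[of u 1 1] by simp
  qed
  moreover have "1 \<in> U" unfolding U_def by (auto intro!: exI[of _ 1])
  moreover have "x * y \<in> U" if "x \<in> U" "y \<in> U" for x y
    using that by (force simp: U_def mult)
  moreover have "- x \<notin> T" if x: "x \<in> U" for x
  proof
    obtain v where v: "x = [:v:]" "s v = 1" using x by (auto simp: U_def)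
    assume "- x \<in> T"
    then obtain u m h z where *: "s u = 1" "m \<in> ?M" "null_poly z" "smult u (- x) = m + h * p + z"
      unfolding T_def by blast
    have "- [:u * v:] = m + h * p + z" using *(4) unfolding v(1) by simp
    then have "[:u * v:] = - (m + h * p + z)" by (metis minus_minus)
    then have "[:u * v:] + m = (- h) * p + (- z)" by simp
    moreover have "0 < s (u * v)" using * v by (simp add: mult)
    ultimately show False
      using no_certificate_if_sign_change[of b a p "u * v" m "- z" "- h"] ab change *
      by (auto intro: null_poly_minus)
  qed
  ultimately obtain s' where s': "sign_ring s'" "\<And>t. t \<in> T \<Longrightarrow> 0 \<le> s' t" "\<And>u. u \<in> U \<Longrightarrow> s' u = 1"
    using precone_imp_sign_ring[of T U] by metis
  interpret S': sign_ring s' by (rule s')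
  have nonneg: "0 \<le> s' [:c:]" if "0 \<le> s c" for c
    using s'(2) term_in_T[of c 1 1] that by simp
  have const: "s' [:c:] = s c" for c
  proof -
    have "s' [:c:] = 1" if "s c = 1" for c using s'(3) that by (auto simp: U_def)
    from this[of c] this[of "- c"] nonneg[of c] nonneg[of "- c"]
    show ?thesis using sgn_values[of c] S'.minus[of "[:c:]"] by auto
  qed
  have "h * p \<in> T" for h by (rule TI[of 1 0 0 _ h]) (auto intro: qmodule.zero)
  from this[of 1] this[of "-1"] have "0 \<le> s' p" "0 \<le> s' (- p)"
    using s'(2) by (metis mult_1 mult_minus1)+
  then have "s' p = 0" by simp
  moreover have "0 \<le> s' [:- a, 1:]" "0 \<le> s' [:b, - 1:]"
    using s'(2) term_in_T[of 1 _ 1] by auto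
  ultimately show ?thesis using that s'(1) const by blast
qed

end

context sign_ring begin

definition leads :: "'a poly \<Rightarrow> nat \<Rightarrow> bool" where
  "leads p k \<longleftrightarrow> s (coeff p k) \<noteq> 0 \<and> (\<forall>i>k. s (coeff p i) = 0)"

lemma leads_unique: "leads p k \<Longrightarrow> leads p l \<Longrightarrow> k = l"
  unfolding leads_def by (metis linorder_neqE_nat)

text \<open>
  A polynomial evaluated at an infinitely large element has the sign of its highest coefficient of
  nonzero sign; the following lemmas make this a sign function.
\<close>

lemma leads_or_null: "(\<exists>k. leads p k) \<or> null_poly p"
proof -
  obtain n where n: "null_poly (p - poly_cutoff n p)"
    "poly_cutoff n p = 0 \<or> s (lead_coeff (poly_cutoff n p)) \<noteq> 0"
    by (rule truncation)
  let ?q = "poly_cutoff n p"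
  have eq: "s (coeff p i) = s (coeff ?q i)" for i
    using n(1) by (intro cong_null) (auto simp: null_poly_def)
  show ?thesis
  proof (cases "?q = 0")
    case True
    then show ?thesis using eq by (auto simp: null_poly_def)
  next
    case False
    then have "leads p (degree ?q)"
      using n(2) eq by (auto simp: leads_def coeff_eq_0)
    then show ?thesis by blast
  qed
qed

lemma leads_mult: "leads p k \<Longrightarrow> leads q l \<Longrightarrow> leads (p * q) (k + l)"
  and coeff_leads_mult: "leads p k \<Longrightarrow> leads q l \<Longrightarrow>
    s (coeff (p * q) (k + l)) = s (coeff p k) * s (coeff q l)"
proof -
  assume pq: "leads p k" "leads q l"
  have "coeff (p * q) (k + l) = coeff p k * coeff q l + (\<Sum>i\<in>{..k + l} - {k}. coeff p i * coeff q (k + l - i))"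
    by (simp add: coeff_mult sum.remove[of _ k])
  moreover have "s (\<Sum>i\<in>{..k + l} - {k}. coeff p i * coeff q (k + l - i)) = 0"
  proof (rule sum_null)
    fix i assume "i \<in> {..k + l} - {k}"
    then have "k < i \<or> l < k + l - i" by auto
    then show "s (coeff p i * coeff q (k + l - i)) = 0"
      using pq by (auto simp: leads_def mult)
  qed
  ultimately show *: "s (coeff (p * q) (k + l)) = s (coeff p k) * s (coeff q l)"
    by (simp add: add_null mult)
  have "s (coeff (p * q) n) = 0" if "k + l < n" for n
    unfolding coeff_mult
  proof (rule sum_null)
    fix i assume "i \<in> {..n}"
    then have "k < i \<or> l < n - i" using that by auto
    then show "s (coeff p i * coeff q (n - i)) = 0"
      using pq by (auto simp: leads_def mult)
  qed
  then show "leads (p * q) (k + l)"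
    using * pq by (auto simp: leads_def)
qed

lemma adjoin_infinity:
  obtains s' where "sign_ring s'" "\<And>c. s' [:c:] = s c"
    "\<And>p. s (lead_coeff p) \<noteq> 0 \<Longrightarrow> s' p = s (lead_coeff p)"
proof -
  define s' where "s' p = (if null_poly p then 0 else s (coeff p (THE k. leads p k)))" for p
  have s'_null: "s' p = 0" if "null_poly p" for p using that by (simp add: s'_def)
  have s'_leads: "s' p = s (coeff p k)" if "leads p k" for p k
  proof -
    have "\<not> null_poly p" using that by (auto simp: leads_def null_poly_def)
    moreover have "(THE k. leads p k) = k" using that leads_unique by blast
    ultimately show ?thesis by (simp add: s'_def)
  qed
  have const: "s' [:c:] = s c" for c
  proof (cases "s c = 0")
    case True
    then show ?thesis by (intro trans[OF s'_null]) (auto simp: null_poly_def coeff_pCons split: nat.split)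
  next
    case False
    then have "leads [:c:] 0" by (auto simp: leads_def coeff_pCons split: nat.split)
    then show ?thesis using s'_leads by fastforce
  qed
  have "sign_ring s'"
  proof
    fix p q
    show "s' p = -1 \<or> s' p = 0 \<or> s' p = 1" using sgn_values by (auto simp: s'_def)
    show "s' 1 = 1" using const[of 1] by (simp flip: one_pCons)
    show "s' (- p) = - s' p"
    proof (cases "null_poly p")
      case True
      then show ?thesis by (simp add: s'_null null_poly_minus)
    next
      case False
      then obtain k where "leads p k" using leads_or_null by blast
      moreover from this have "leads (- p) k" by (simp add: leads_def)
      ultimately show ?thesis by (simp add: s'_leads)
    qed
    show "s' (p * q) = s' p * s' q"
    proof (cases "null_poly p \<or> null_poly q")
      case True
      then have "null_poly (p * q)" using null_poly_mult[of p q] null_poly_mult[of q p] by (auto simp: mult.commute)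
      then show ?thesis using True by (auto simp: s'_null)
    next
      case False
      then obtain k l where "leads p k" "leads q l" using leads_or_null by blast
      then show ?thesis
        using s'_leads[of p k] s'_leads[of q l] s'_leads[OF leads_mult] coeff_leads_mult[of p k q l] by metis
    qed
    have add_leads: "0 \<le> s' (p + q)" if pq: "0 \<le> s' p" "0 \<le> s' q" "leads q l" "\<And>i. i > l \<Longrightarrow> s (coeff p i) = 0" for p q l
    proof -
      have q: "s (coeff q l) > 0" using pq(2,3) s'_leads[OF pq(3)] by (auto simp: leads_def)
      have p: "0 \<le> s (coeff p l)"
      proof (cases "leads p l")
        case True then show ?thesis using pq s'_leads by auto
      qed (use pq(4) in \<open>auto simp: leads_def\<close>)
      have "0 < s (coeff (p + q) l)"
        using add_pos[OF q p] by (simp add: add.commute)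
      moreover have "leads (p + q) l"
        using pq(3,4) calculation by (auto simp: leads_def add_null)
      ultimately show ?thesis by (simp add: s'_leads)
    qed
    show "0 \<le> s' (p + q)" if pq: "0 \<le> s' p" "0 \<le> s' q"
    proof -
      consider "null_poly p" "null_poly q" | l where "leads q l" "\<And>i. i > l \<Longrightarrow> s (coeff p i) = 0"
        | k where "leads p k" "\<And>i. i > k \<Longrightarrow> s (coeff q i) = 0"
      proof (cases "null_poly p"; cases "null_poly q")
        assume "\<not> null_poly p" "\<not> null_poly q"
        then obtain k l where "leads p k" "leads q l" using leads_or_null by blast
        then show ?thesis using that(2)[of l] that(3)[of k] unfolding leads_def
          by (metis (no_types, lifting) le_less_trans nat_le_linear)
      next
        assume "null_poly p" "\<not> null_poly q"
        then show ?thesis using that(2) leads_or_null[of q] by (auto simp: null_poly_def)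
      next
        assume "\<not> null_poly p" "null_poly q"
        then show ?thesis using that(3) leads_or_null[of p] by (auto simp: null_poly_def)
      qed (rule that(1))
      then show ?thesis
      proof cases
        case 1
        then show ?thesis by (simp add: s'_null null_poly_add)
      next
        case 2
        then show ?thesis using add_leads pq by blast
      next
        case 3
        then show ?thesis using add_leads[of q p k] pq by (simp add: add.commute)
      qed
    qed
  qed
  moreover have "s' p = s (lead_coeff p)" if "s (lead_coeff p) \<noteq> 0" for p
    using that by (intro s'_leads) (auto simp: leads_def coeff_eq_0)
  ultimately show ?thesis using that const by blast
qed

end

section \<open>Universal property of polynomial rings\<close>

definition const_poly :: "real \<Rightarrow> ('v \<Rightarrow>\<^sub>0 nat) \<Rightarrow>\<^sub>0 real" where
  "const_poly r = Poly_Mapping.single 0 r"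

definition var_poly :: "'v \<Rightarrow> ('v \<Rightarrow>\<^sub>0 nat) \<Rightarrow>\<^sub>0 real" where
  "var_poly v = Poly_Mapping.single (Poly_Mapping.single v 1) 1"

lemma sum_single_lookup: "(\<Sum>k\<in>Poly_Mapping.keys p. Poly_Mapping.single k (Poly_Mapping.lookup p k)) = p"
  by (rule poly_mapping_eqI) (simp add: lookup_sum lookup_single when_def sum.If_cases in_keys_iff)

text \<open>
  Real polynomials in arbitrarily many variables are generated by the constants and the variables.
  Every later comparison of two homomorphisms on such a ring rests on this rule.
\<close>

lemma mpoly_induct [case_names const var add mult]:
  fixes p :: "('v \<Rightarrow>\<^sub>0 nat) \<Rightarrow>\<^sub>0 real"
  assumes const: "\<And>r. P (const_poly r)" and var: "\<And>v. P (var_poly v)"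
    and add: "\<And>p q. P p \<Longrightarrow> P q \<Longrightarrow> P (p + q)" and mult: "\<And>p q. P p \<Longrightarrow> P q \<Longrightarrow> P (p * q)"
  shows "P p"
proof -
  have one: "P (Poly_Mapping.single 0 1)" using const[of 1] by (simp add: const_poly_def)
  have power: "P (Poly_Mapping.single (Poly_Mapping.single v k) 1)" for v k
  proof (induction k)
    case (Suc k)
    have "Poly_Mapping.single (Poly_Mapping.single v (Suc k)) (1::real)
      = var_poly v * Poly_Mapping.single (Poly_Mapping.single v k) 1"
      by (simp add: var_poly_def mult_single flip: single_add)
    then show ?case using mult[OF var Suc] by simp
  qed (use one in simp)
  have monom: "P (Poly_Mapping.single (\<Sum>v\<in>F. Poly_Mapping.single v (k v)) 1)" for F :: "'v set" and k
  proof (induction F rule: infinite_finite_induct)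
    case (insert v F)
    have "Poly_Mapping.single (\<Sum>v\<in>insert v F. Poly_Mapping.single v (k v)) (1::real)
      = Poly_Mapping.single (Poly_Mapping.single v (k v)) 1
        * Poly_Mapping.single (\<Sum>v\<in>F. Poly_Mapping.single v (k v)) 1"
      using insert.hyps by (simp add: mult_single)
    then show ?case using mult[OF power insert.IH] by simp
  qed (use one in simp_all)
  have "P (Poly_Mapping.single m r)" for m r
  proof -
    have "P (Poly_Mapping.single m 1)"
      using monom[of "Poly_Mapping.lookup m" "Poly_Mapping.keys m"] by (simp add: sum_single_lookup)
    then have "P (const_poly r * Poly_Mapping.single m 1)" by (rule mult[OF const])
    then show ?thesis by (simp add: const_poly_def mult_single)
  qed
  then have "P (\<Sum>k\<in>K. Poly_Mapping.single k (r k))" for K :: "('v \<Rightarrow>\<^sub>0 nat) set" and r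
    using const[of 0] by (induction K rule: infinite_finite_induct) (auto simp: const_poly_def add)
  from this[of "Poly_Mapping.lookup p" "Poly_Mapping.keys p"] show ?thesis
    by (simp add: sum_single_lookup)
qed

definition ring_hom :: "('a::comm_ring_1 \<Rightarrow> 'b::comm_ring_1) \<Rightarrow> bool" where
  "ring_hom h \<longleftrightarrow> h 1 = 1 \<and> (\<forall>x y. h (x + y) = h x + h y \<and> h (x * y) = h x * h y)"

lemma ring_homD:
  assumes "ring_hom h"
  shows "h 0 = 0" "h 1 = 1" "h (x + y) = h x + h y" "h (x * y) = h x * h y" "h (- x) = - h x"
    "h (x - y) = h x - h y" "h (x ^ n) = h x ^ n" "h (sum f I) = (\<Sum>i\<in>I. h (f i))"
    "h (of_nat n) = of_nat n"
proof -
  show 1: "h 1 = 1" and add: "\<And>x y. h (x + y) = h x + h y" and mult: "\<And>x y. h (x * y) = h x * h y"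
    using assms by (auto simp: ring_hom_def)
  show zero: "h 0 = 0" using add[of 0 0] by simp
  show min: "h (- x) = - h x" for x using add[of "- x" x] zero by (simp add: eq_neg_iff_add_eq_0)
  show "h (x - y) = h x - h y" using add[of x "- y"] min by simp
  show "h (x ^ n) = h x ^ n" by (induction n) (auto simp: 1 mult)
  show "h (sum f I) = (\<Sum>i\<in>I. h (f i))" by (induction I rule: infinite_finite_induct) (auto simp: zero add)
  show "h (of_nat n) = of_nat n" by (induction n) (auto simp: zero 1 add)
qed

lemma ring_hom_comp: "ring_hom g \<Longrightarrow> ring_hom h \<Longrightarrow> ring_hom (g \<circ> h)"
  by (simp add: ring_hom_def)

lemma ring_hom_const_poly: "ring_hom const_poly"
  by (simp add: ring_hom_def const_poly_def single_add mult_single)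

text \<open>
  The homomorphism from the polynomial ring determined by its values \<open>c\<close> on constants and \<open>x\<close> on
  variables.
\<close>

definition subst_poly :: "(real \<Rightarrow> 'r) \<Rightarrow> ('v \<Rightarrow> 'r) \<Rightarrow> (('v \<Rightarrow>\<^sub>0 nat) \<Rightarrow>\<^sub>0 real) \<Rightarrow> 'r::comm_ring_1" where
  "subst_poly c x p = (\<Sum>m\<in>Poly_Mapping.keys p. c (Poly_Mapping.lookup p m) *
     (\<Prod>v\<in>Poly_Mapping.keys m. x v ^ Poly_Mapping.lookup m v))"

context
  fixes c :: "real \<Rightarrow> 'r::comm_ring_1" and x :: "'v \<Rightarrow> 'r"
  assumes c: "ring_hom c"
begin

lemma subst_single:
  "subst_poly c x (Poly_Mapping.single m r) = c r * (\<Prod>v\<in>Poly_Mapping.keys m. x v ^ Poly_Mapping.lookup m v)"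
  by (cases "r = 0") (simp_all add: subst_poly_def ring_homD[OF c])

lemma subst_const: "subst_poly c x (const_poly r) = c r"
  by (simp add: const_poly_def subst_single)

lemma subst_var: "subst_poly c x (var_poly v) = x v"
  by (simp add: var_poly_def subst_single ring_homD[OF c])

lemma subst_superset:
  assumes "finite K" "Poly_Mapping.keys p \<subseteq> K"
  shows "subst_poly c x p = (\<Sum>m\<in>K. c (Poly_Mapping.lookup p m) *
     (\<Prod>v\<in>Poly_Mapping.keys m. x v ^ Poly_Mapping.lookup m v))"
  unfolding subst_poly_def using assms
  by (intro sum.mono_neutral_left) (auto simp: in_keys_iff ring_homD[OF c])

lemma subst_add: "subst_poly c x (p + q) = subst_poly c x p + subst_poly c x q"
proof -
  let ?K = "Poly_Mapping.keys p \<union> Poly_Mapping.keys q"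
  have "Poly_Mapping.keys (p + q) \<subseteq> ?K" by (rule keys_add)
  then show ?thesis
    using subst_superset[of ?K p] subst_superset[of ?K q] subst_superset[of ?K "p + q"]
    by (simp add: lookup_add ring_homD[OF c] distrib_right sum.distrib)
qed

lemma subst_sum: "subst_poly c x (sum f I) = (\<Sum>i\<in>I. subst_poly c x (f i))"
  by (induction I rule: infinite_finite_induct) (auto simp: subst_add subst_poly_def[of _ _ 0])

lemma monom_value_add:
  "(\<Prod>v\<in>Poly_Mapping.keys (m + m'). x v ^ Poly_Mapping.lookup (m + m') v)
   = (\<Prod>v\<in>Poly_Mapping.keys m. x v ^ Poly_Mapping.lookup m v) *
     (\<Prod>v\<in>Poly_Mapping.keys m'. x v ^ Poly_Mapping.lookup m' v)"
proof -
  let ?K = "Poly_Mapping.keys m \<union> Poly_Mapping.keys m'"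
  have *: "(\<Prod>v\<in>Poly_Mapping.keys n. x v ^ Poly_Mapping.lookup n v) = (\<Prod>v\<in>?K. x v ^ Poly_Mapping.lookup n v)"
    if "Poly_Mapping.keys n \<subseteq> ?K" for n
    using that by (intro prod.mono_neutral_left) (auto simp: in_keys_iff)
  show ?thesis
    using *[of m] *[of m'] *[of "m + m'"] keys_add[of m m']
    by (simp add: lookup_add power_add prod.distrib)
qed

lemma subst_mult: "subst_poly c x (p * q) = subst_poly c x p * subst_poly c x q"
proof -
  let ?s = "\<lambda>p k. Poly_Mapping.single k (Poly_Mapping.lookup p k)"
  have single: "subst_poly c x (?s p k * ?s q l) = subst_poly c x (?s p k) * subst_poly c x (?s q l)" for k l
    unfolding mult_single subst_single monom_value_add by (simp add: ring_homD[OF c] ac_simps)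
  have "subst_poly c x ((\<Sum>k\<in>Poly_Mapping.keys p. ?s p k) * (\<Sum>l\<in>Poly_Mapping.keys q. ?s q l))
      = subst_poly c x (\<Sum>k\<in>Poly_Mapping.keys p. ?s p k) * subst_poly c x (\<Sum>l\<in>Poly_Mapping.keys q. ?s q l)"
    by (simp add: sum_product subst_sum single)
  then show ?thesis by (simp add: sum_single_lookup)
qed

lemma ring_hom_subst: "ring_hom (subst_poly c x)"
  using subst_const[of 1] by (simp add: ring_hom_def subst_add subst_mult const_poly_def ring_homD[OF c])

end

lemma ring_hom_eqI:
  fixes g h :: "(('v \<Rightarrow>\<^sub>0 nat) \<Rightarrow>\<^sub>0 real) \<Rightarrow> 'r::comm_ring_1"
  assumes "ring_hom g" "ring_hom h" "\<And>r. g (const_poly r) = h (const_poly r)"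
    "\<And>v. g (var_poly v) = h (var_poly v)"
  shows "g p = h p"
  by (induction p rule: mpoly_induct) (auto simp: assms ring_homD[OF assms(1)] ring_homD[OF assms(2)])

lemma map_poly_hom:
  assumes h: "ring_hom h"
  shows "coeff (map_poly h p) i = h (coeff p i)" "map_poly h [:a:] = [:h a:]"
    "map_poly h (pCons a p) = pCons (h a) (map_poly h p)"
    "map_poly h (p + q) = map_poly h p + map_poly h q"
    "map_poly h (smult a p) = smult (h a) (map_poly h p)"
    "map_poly h (p * q) = map_poly h p * map_poly h q"
    "poly (map_poly h p) (h y) = h (poly p y)"
proof -
  note h = ring_homD[OF h]
  show coeff: "coeff (map_poly h p) i = h (coeff p i)" for p i by (simp add: coeff_map_poly h)
  show "map_poly h [:a:] = [:h a:]"
    by (intro poly_eqI) (auto simp: coeff coeff_pCons h split: nat.split)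
  show pC: "map_poly h (pCons a p) = pCons (h a) (map_poly h p)" for a p
    by (intro poly_eqI) (auto simp: coeff coeff_pCons split: nat.split)
  show "map_poly h (p + q) = map_poly h p + map_poly h q"
    "map_poly h (smult a p) = smult (h a) (map_poly h p)"
    "map_poly h (p * q) = map_poly h p * map_poly h q"
    by (intro poly_eqI; simp add: coeff h coeff_mult)+
  show "poly (map_poly h p) (h y) = h (poly p y)"
    by (induction p) (simp_all add: pC h)
qed

lemma map_poly_hom_pderiv:
  fixes h :: "'a::idom \<Rightarrow> 'b::idom"
  assumes "ring_hom h"
  shows "map_poly h (pderiv p) = pderiv (map_poly h p)"
  by (intro poly_eqI) (simp add: map_poly_hom(1)[OF assms] coeff_pderiv ring_homD[OF assms])

section \<open>Extending a sign function within one polynomial ring\<close>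

type_synonym nat_mpoly = "(nat \<Rightarrow>\<^sub>0 nat) \<Rightarrow>\<^sub>0 real"

text \<open>
  A polynomial ring \<open>A[Y]\<close> over \<open>A = \<real>[x\<^sub>0, x\<^sub>1, \<dots>]\<close> is again isomorphic to \<open>A\<close>: shift the old
  variables by one and let \<open>x\<^sub>0\<close> play the role of \<open>Y\<close>. Hence any number of adjunctions can be
  performed without leaving the type; \<open>shift_vars\<close> embeds the old ring, and \<open>split_var\<close> is the
  isomorphism from \<open>A\<close> to \<open>A[Y]\<close>.
\<close>

definition shift_vars :: "nat_mpoly \<Rightarrow> nat_mpoly" where
  "shift_vars = subst_poly const_poly (\<lambda>i. var_poly (Suc i))"

definition split_var :: "nat_mpoly \<Rightarrow> nat_mpoly poly" where
  "split_var = subst_poly (\<lambda>r. [:const_poly r:]) (\<lambda>i. case i of 0 \<Rightarrow> [:0, 1:] | Suc k \<Rightarrow> [:var_poly k:])"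

lemma ring_hom_const: "ring_hom (\<lambda>a. [:a:])"
  by (simp add: ring_hom_def flip: one_pCons)

lemma ring_hom_const2: "ring_hom (\<lambda>r. [:const_poly r:])"
  using ring_hom_comp[OF ring_hom_const ring_hom_const_poly] by (simp add: comp_def)

lemma ring_hom_shift_vars: "ring_hom shift_vars"
  unfolding shift_vars_def by (rule ring_hom_subst[OF ring_hom_const_poly])

lemma ring_hom_split_var: "ring_hom split_var"
  unfolding split_var_def by (rule ring_hom_subst[OF ring_hom_const2])

lemma split_shift: "split_var (shift_vars m) = [:m:]"
proof -
  have "(split_var \<circ> shift_vars) m = (\<lambda>a. [:a:]) m"
    by (rule ring_hom_eqI[OF ring_hom_comp[OF ring_hom_split_var ring_hom_shift_vars] ring_hom_const])
       (simp_all add: split_var_def shift_vars_def subst_const subst_var ring_hom_const_poly ring_hom_const2)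
  then show ?thesis by simp
qed

lemma split_poly: "split_var (poly (map_poly shift_vars q) (var_poly 0)) = q"
proof (induction q)
  case (pCons a q)
  have "split_var (var_poly 0) = [:0, 1:]"
    by (simp add: split_var_def subst_var ring_hom_const2)
  then show ?case
    using pCons.IH by (simp add: map_poly_hom[OF ring_hom_shift_vars] ring_homD[OF ring_hom_split_var] split_shift)
qed (simp add: ring_homD[OF ring_hom_split_var])

lemma sign_on_split:
  assumes "sign_ring s''" "\<And>c. s'' [:c:] = s c"
  shows "sign_ring (s'' \<circ> split_var)" "(s'' \<circ> split_var) (shift_vars c) = s c"
    "(s'' \<circ> split_var) (poly (map_poly shift_vars q) (var_poly 0)) = s'' q"
proof -
  show "sign_ring (s'' \<circ> split_var)"
    by (rule sign_ring.comp_hom[OF assms(1)]) (rule ring_homD[OF ring_hom_split_var])+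
qed (simp_all only: comp_def split_shift split_poly assms(2))

lemma extend_by_root:
  fixes s :: "nat_mpoly \<Rightarrow> real"
  assumes "sign_ring s" "0 < s (b - a)" "s (poly p a) * s (poly p b) < 0"
  obtains s' y where "sign_ring s'" "\<And>c. s' (shift_vars c) = s c"
    "s' (poly (map_poly shift_vars p) y) = 0" "0 \<le> s' (y - shift_vars a)" "0 \<le> s' (shift_vars b - y)"
proof -
  interpret sign_ring s by fact
  obtain s'' where s'': "sign_ring s''" "\<And>c. s'' [:c:] = s c" "s'' p = 0"
    "0 \<le> s'' [:- a, 1:]" "0 \<le> s'' [:b, - 1:]"
    by (rule adjoin_root[OF assms(2,3)]) blast
  note * = sign_on_split[OF s''(1,2)]
  have "map_poly shift_vars [:- a, 1:] = [:- shift_vars a, 1:]"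
    "map_poly shift_vars [:b, - 1:] = [:shift_vars b, - 1:]"
    by (simp_all only: map_poly_hom(2,3)[OF ring_hom_shift_vars] ring_homD(2,5)[OF ring_hom_shift_vars] map_poly_0)
  then have lin: "var_poly 0 - shift_vars a = poly (map_poly shift_vars [:- a, 1:]) (var_poly 0)"
    "shift_vars b - var_poly 0 = poly (map_poly shift_vars [:b, - 1:]) (var_poly 0)"
    by simp_all
  show ?thesis
  proof (rule that[OF *(1,2)])
    show "(s'' \<circ> split_var) (poly (map_poly shift_vars p) (var_poly 0)) = 0"
      by (simp only: *(3) s''(3))
    show "0 \<le> (s'' \<circ> split_var) (var_poly 0 - shift_vars a)"
      unfolding lin by (simp only: *(3) s''(4))
    show "0 \<le> (s'' \<circ> split_var) (shift_vars b - var_poly 0)"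
      unfolding lin by (simp only: *(3) s''(5))
  qed
qed

lemma reflect_map_poly:
  fixes h :: "'a::comm_ring_1 \<Rightarrow> 'b::comm_ring_1"
  assumes "ring_hom h"
  shows "poly (map_poly h (pcompose p [:0, - 1:])) y = poly (map_poly h p) (- y)"
proof (induction p)
  case (pCons a p)
  have "map_poly h [:0, - 1:] = [:0, - 1:]"
    by (simp only: map_poly_hom(2,3)[OF assms] ring_homD(1,2,5)[OF assms] map_poly_0)
  then have "map_poly h (pcompose (pCons a p) [:0, - 1:])
      = [:h a:] + [:0, - 1:] * map_poly h (pcompose p [:0, - 1:])"
    by (simp only: pcompose_pCons map_poly_hom(2,4,6)[OF assms])
  then show ?case
    by (simp only: map_poly_hom(3)[OF assms]) (simp add: pCons.IH)
qed simp

lemma extend_by_infinity: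
  fixes s :: "nat_mpoly \<Rightarrow> real"
  assumes "sign_ring s"
  obtains s' y where "sign_ring s'" "\<And>c. s' (shift_vars c) = s c"
    "\<And>p. s (lead_coeff p) \<noteq> 0 \<Longrightarrow> s' (poly (map_poly shift_vars p) y) = s (lead_coeff p)"
    "\<And>p. s (lead_coeff p) \<noteq> 0 \<Longrightarrow> s' (poly (map_poly shift_vars p) (- y)) = (- 1) ^ degree p * s (lead_coeff p)"
proof -
  interpret sign_ring s by fact
  obtain s'' where s'': "sign_ring s''" "\<And>c. s'' [:c:] = s c"
    "\<And>p. s (lead_coeff p) \<noteq> 0 \<Longrightarrow> s'' p = s (lead_coeff p)"
    by (rule adjoin_infinity) blast
  note * = sign_on_split[OF s''(1,2)]
  have "(s'' \<circ> split_var) (poly (map_poly shift_vars p) (- var_poly 0)) = (- 1) ^ degree p * s (lead_coeff p)"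
    if "s (lead_coeff p) \<noteq> 0" for p
  proof -
    let ?q = "pcompose p [:0, - 1:]"
    have "lead_coeff ?q = lead_coeff p * lead_coeff [:0, - 1:] ^ degree p"
      by (rule lead_coeff_comp) simp
    then have lead: "s (lead_coeff ?q) = (- 1) ^ degree p * s (lead_coeff p)"
      by (simp add: mult power del: pcompose_pCons)
    have "(s'' \<circ> split_var) (poly (map_poly shift_vars p) (- var_poly 0)) = s'' ?q"
      using *(3)[of ?q] by (simp only: reflect_map_poly[OF ring_hom_shift_vars])
    also have "\<dots> = s (lead_coeff ?q)"
      using that by (intro s''(3)) (simp add: lead)
    finally show ?thesis by (simp only: lead)
  qed
  then show ?thesis
    by (intro that[OF *(1,2), of "var_poly 0"]) (simp_all only: *(3) s''(3) not_False_eq_True)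
qed

section \<open>A quadrature formula with positive weights\<close>

text \<open>
  The nodes are the cosines of \<open>\<theta>\<^sub>k = (2 k + 1) \<pi> / (2 n)\<close>. Multiplying the sum by \<open>2 sin x\<close> makes it
  telescope.
\<close>

lemma sum_cos_nodes:
  fixes n a :: nat
  assumes "0 < a" "a < 2 * n"
  shows "(\<Sum>k<n. cos (real a * (real (2 * k + 1) * pi / (2 * n)))) = 0"
proof -
  define x where "x = real a * pi / (2 * n)"
  have x: "0 < x" "x < pi" using assms by (auto simp: x_def field_simps)
  have "2 * sin x * (\<Sum>k<m. cos (real (2 * k + 1) * x)) = sin (2 * real m * x)" for m :: nat
  proof (induction m)
    case (Suc m)
    have eqs: "x + real (2 * m + 1) * x = 2 * real (Suc m) * x" "x - real (2 * m + 1) * x = - (2 * real m * x)"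
      by (simp_all add: algebra_simps)
    have "2 * sin x * cos (real (2 * m + 1) * x) = sin (2 * real (Suc m) * x) - sin (2 * real m * x)"
      using sin_times_cos[of x "real (2 * m + 1) * x"] unfolding eqs by simp
    then show ?case using Suc by (simp add: distrib_left)
  qed simp
  from this[of n] have "2 * sin x * (\<Sum>k<n. cos (real (2 * k + 1) * x)) = sin (real a * pi)"
    using assms by (simp add: x_def)
  then have "(\<Sum>k<n. cos (real (2 * k + 1) * x)) = 0"
    using x sin_gt_zero[of x] by simp
  then show ?thesis by (simp add: x_def algebra_simps)
qed

lemma has_integral_sin_cos:
  "((\<lambda>t. cos (real i * t) * sin t) has_integral (if even i then 2 / (1 - (real i)\<^sup>2) else 0)) {0..pi}"
proof (cases "i = 1")
  case True
  have "((\<lambda>t. cos t * sin t) has_integral ((sin pi)\<^sup>2 / 2 - (sin 0)\<^sup>2 / 2)) {0..pi}"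
    by (rule fundamental_theorem_of_calculus)
       (auto intro!: derivative_eq_intros simp flip: has_real_derivative_iff_has_vector_derivative)
  then show ?thesis using True by simp
next
  case False
  let ?F = "\<lambda>t. cos ((real i - 1) * t) / (2 * (real i - 1)) - cos ((real i + 1) * t) / (2 * (real i + 1))"
  have ne: "real i - 1 \<noteq> 0" "real i + 1 \<noteq> 0" using False by auto
  have deriv_cos: "((\<lambda>t. cos (a * t) / (2 * a)) has_real_derivative - sin (a * t) / 2) (at t within S)"
    if "a \<noteq> 0" for a t S
    using that by (auto intro!: derivative_eq_intros simp: field_simps)
  have deriv: "(?F has_vector_derivative cos (real i * t) * sin t) (at t within {0..pi})" for t
    unfolding has_real_derivative_iff_has_vector_derivative[symmetric]
  proof -
    have eqs: "t + real i * t = (real i + 1) * t" "t - real i * t = - ((real i - 1) * t)"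
      by (simp_all add: algebra_simps)
    have "cos (real i * t) * sin t = (sin ((real i + 1) * t) - sin ((real i - 1) * t)) / 2"
      using sin_times_cos[of t "real i * t"] unfolding eqs by (simp add: mult.commute mult.left_commute)
    then show "(?F has_real_derivative cos (real i * t) * sin t) (at t within {0..pi})"
      using DERIV_diff[OF deriv_cos[OF ne(1)] deriv_cos[OF ne(2)], of t "{0..pi}"] by (simp add: diff_divide_distrib)
  qed
  have int: "((\<lambda>t. cos (real i * t) * sin t) has_integral (?F pi - ?F 0)) {0..pi}"
    by (rule fundamental_theorem_of_calculus) (use deriv in auto)
  have cos_ends: "cos ((real i - 1) * pi) = - ((- 1) ^ i)" "cos ((real i + 1) * pi) = - ((- 1) ^ i)"
    by (simp_all add: distrib_right left_diff_distrib cos_add cos_diff)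
  have "?F pi - ?F 0 = (if even i then 2 / (1 - (real i)\<^sup>2) else 0)"
  proof -
    have "(real i - 1) * (real i + 1) = - (1 - (real i)\<^sup>2)"
      by (simp add: power2_eq_square algebra_simps)
    moreover have "1 / b - 1 / a = (a - b) / (a * b)" if "a \<noteq> 0" "b \<noteq> 0" for a b :: real
      using that by (simp add: field_simps)
    from this[OF ne] have "1 / (real i + 1) - 1 / (real i - 1) = - 2 / ((real i - 1) * (real i + 1))" by simp
    moreover have "2 / (1 - (real i)\<^sup>2) = - (2 / ((real i)\<^sup>2 - 1))"
      by (simp add: minus_divide_right)
    moreover have "?F pi - ?F 0 = (if even i then 1 / (real i + 1) - 1 / (real i - 1) else 0)"
      using ne by (auto simp: cos_ends divide_simps, auto simp: algebra_simps)
    ultimately show ?thesis by simp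
  qed
  with int show ?thesis by simp
qed

lemma has_integral_sin_cos_power:
  "((\<lambda>t. cos t ^ j * sin t) has_integral ((1 - (- 1) ^ Suc j) / real (Suc j))) {0..pi}"
proof -
  have deriv: "((\<lambda>t. - 1 / real (Suc j) * cos t ^ Suc j) has_vector_derivative cos t ^ j * sin t) (at t within {0..pi})" for t
  proof -
    have "((\<lambda>t. cos t ^ Suc j) has_real_derivative real (Suc j) * (cos t ^ j * - sin t)) (at t within {0..pi})"
      using DERIV_power_Suc[OF has_field_derivative_at_within[OF DERIV_cos[of t], of "{0..pi}"], of j]
      by (simp only: of_nat_Suc add.commute mult.commute)
    from DERIV_cmult[OF this, of "- 1 / real (Suc j)"] show ?thesis
      by (simp flip: has_real_derivative_iff_has_vector_derivative del: of_nat_Suc power_Suc)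
  qed
  have "((\<lambda>t. cos t ^ j * sin t) has_integral
      (- 1 / real (Suc j) * cos pi ^ Suc j - - 1 / real (Suc j) * cos 0 ^ Suc j)) {0..pi}"
    by (rule fundamental_theorem_of_calculus) (use deriv in auto)
  then show ?thesis by (simp add: add_divide_distrib diff_divide_distrib add.commute)
qed

text \<open>
  Fejer's first rule, which integrates polynomials of degree less than \<open>n\<close> over \<open>[-1, 1]\<close> exactly. The
  weights are, up to the factor \<open>\<pi> / n\<close>, values of a partial sum of the cosine series of the sine
  function at the angles \<open>\<theta>\<^sub>k\<close>; they are positive since \<open>\<Sum> 2 / (4 m\<^sup>2 - 1)\<close> telescopes to a value below \<open>1\<close>. Exactness holds for
  \<open>cos (i \<theta>)\<close> by the orthogonality of the cosines at the nodes, and it carries over to the powers of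
  \<open>cos \<theta>\<close> by the product formula. What matters below is only that all weights are positive and
  all nodes lie strictly inside the interval.
\<close>

lemma positive_quadrature:
  fixes n :: nat
  assumes "1 \<le> n"
  obtains w \<xi> :: "nat \<Rightarrow> real" where "\<And>k. k < n \<Longrightarrow> 0 < w k" "\<And>k. k < n \<Longrightarrow> - 1 < \<xi> k \<and> \<xi> k < 1"
    "\<And>j. j < n \<Longrightarrow> (\<Sum>k<n. w k * \<xi> k ^ j) = (1 - (- 1) ^ Suc j) / real (Suc j)"
proof -
  define \<theta> where "\<theta> k = real (2 * k + 1) * pi / (2 * n)" for k
  \<comment> \<open>The even indices 2 m with 0 < m and 2 m < n are those with m at most M.\<close>
  define M where "M = (n - 1) div 2"
  define w where "w k = 2 / n * (1 - (\<Sum>m=1..M. 2 / (4 * (real m)\<^sup>2 - 1) * cos (real (2 * m) * \<theta> k)))" for k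
  have D: "(\<Sum>k<n. cos (real a * \<theta> k)) = (if a = 0 then n else 0)" if "a < 2 * n" for a
    using sum_cos_nodes[of a n] that by (auto simp: \<theta>_def)
  have telescope: "(\<Sum>m=1..N. 2 / (4 * (real m)\<^sup>2 - 1)) = 1 - 1 / (2 * real N + 1)" for N
  proof (induction N)
    case (Suc N)
    have "4 * (real (Suc N))\<^sup>2 - 1 = (2 * real N + 1) * (2 * real N + 3)"
      by (simp add: power2_eq_square algebra_simps)
    moreover have "2 * real N + 1 \<noteq> 0" "2 * real N + 3 \<noteq> 0" by linarith+
    moreover have "2 / ((2 * real N + 1) * (2 * real N + 3)) = 1 / (2 * real N + 1) - 1 / (2 * real N + 3)"
      using calculation(2,3) by (simp add: field_simps)
    ultimately show ?case using Suc by (simp add: add.commute)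
  qed simp
  have w_pos: "0 < w k" for k
  proof -
    have "(\<Sum>m=1..M. 2 / (4 * (real m)\<^sup>2 - 1) * cos (real (2 * m) * \<theta> k))
        \<le> (\<Sum>m=1..M. 2 / (4 * (real m)\<^sup>2 - 1) * 1)"
    proof (intro sum_mono mult_left_mono)
      fix m assume "m \<in> {1..M}"
      then have "1 \<le> (real m)\<^sup>2" by (simp add: one_le_power)
      then show "0 \<le> 2 / (4 * (real m)\<^sup>2 - 1)" by simp
    qed simp
    also have "\<dots> < 1" using telescope[of M] by simp
    finally show ?thesis using assms by (simp add: w_def)
  qed
  have \<theta>: "0 < \<theta> k" "\<theta> k < pi" if "k < n" for k
  proof -
    show "0 < \<theta> k" using that unfolding \<theta>_def by (intro divide_pos_pos mult_pos_pos pi_gt_zero) auto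
    have "real (2 * k + 1) * pi < real (2 * n) * pi"
      using that by (intro mult_strict_right_mono pi_gt_zero) linarith
    then show "\<theta> k < pi" using that by (simp add: \<theta>_def divide_less_eq mult.commute)
  qed
  have nodes: "- 1 < cos (\<theta> k) \<and> cos (\<theta> k) < 1" if "k < n" for k
    using \<theta>[OF that] cos_monotone_0_pi[of 0 "\<theta> k"] cos_monotone_0_pi[of "\<theta> k" pi] by simp
  \<comment> \<open>J is the quadrature sum and K the integral; they satisfy the same recursion in the power of the cosine.\<close>
  define J where "J j i = (\<Sum>k<n. w k * (cos (\<theta> k) ^ j * cos (real i * \<theta> k)))" for j i
  define K where "K j i = integral {0..pi} (\<lambda>t. cos t ^ j * cos (real i * t) * sin t)" for j i
  have J0: "J 0 i = (if even i then 2 / (1 - (real i)\<^sup>2) else 0)" if i: "i < n" for i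
  proof -
    have prod: "(\<Sum>k<n. cos (real (2 * m) * \<theta> k) * cos (real i * \<theta> k)) = (if 2 * m = i then n / 2 else 0)"
      if m: "m \<in> {1..M}" for m
    proof -
      define d where "d = (if i \<le> 2 * m then 2 * m - i else i - 2 * m)"
      have "cos (real (2 * m) * x) * cos (real i * x) = (cos (real (2 * m + i) * x) + cos (real d * x)) / 2" for x
      proof -
        have "cos (real d * x) = cos (real (2 * m) * x - real i * x)"
        proof (cases "i \<le> 2 * m")
          case True
          then show ?thesis by (simp add: d_def of_nat_diff algebra_simps)
        next
          case False
          then have "real d * x = - (real (2 * m) * x - real i * x)"
            by (simp add: d_def of_nat_diff algebra_simps)
          then show ?thesis by (metis cos_minus)
        qed
        moreover have "real (2 * m + i) * x = real (2 * m) * x + real i * x"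
          by (simp only: of_nat_add distrib_right)
        ultimately show ?thesis
          using cos_times_cos[of "real (2 * m) * x" "real i * x"] by (simp only: add.commute)
      qed
      then have "(\<Sum>k<n. cos (real (2 * m) * \<theta> k) * cos (real i * \<theta> k))
         = ((\<Sum>k<n. cos (real (2 * m + i) * \<theta> k)) + (\<Sum>k<n. cos (real d * \<theta> k))) / 2"
        by (simp only: sum.distrib flip: sum_divide_distrib)
      also have "(\<Sum>k<n. cos (real (2 * m + i) * \<theta> k)) = 0"
        using m i by (subst D) (auto simp: M_def)
      also have "(\<Sum>k<n. cos (real d * \<theta> k)) = (if d = 0 then n else 0)"
        using m i by (subst D) (auto simp: M_def d_def)
      finally have "(\<Sum>k<n. cos (real (2 * m) * \<theta> k) * cos (real i * \<theta> k)) = (if d = 0 then n else 0) / 2"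
        by simp
      moreover have "d = 0 \<longleftrightarrow> 2 * m = i" by (auto simp: d_def)
      ultimately show ?thesis by (cases "2 * m = i") simp_all
    qed
    have "J 0 i = 2 / n * ((\<Sum>k<n. cos (real i * \<theta> k)) -
       (\<Sum>k<n. \<Sum>m=1..M. 2 / (4 * (real m)\<^sup>2 - 1) * (cos (real (2 * m) * \<theta> k) * cos (real i * \<theta> k))))"
      by (simp add: J_def w_def left_diff_distrib right_diff_distrib sum_subtractf sum_distrib_left
            sum_distrib_right mult.assoc)
    also have "(\<Sum>k<n. \<Sum>m=1..M. 2 / (4 * (real m)\<^sup>2 - 1) * (cos (real (2 * m) * \<theta> k) * cos (real i * \<theta> k)))
       = (\<Sum>m=1..M. 2 / (4 * (real m)\<^sup>2 - 1) * (\<Sum>k<n. cos (real (2 * m) * \<theta> k) * cos (real i * \<theta> k)))"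
      by (subst sum.swap) (simp add: sum_distrib_left)
    also have "\<dots> = (\<Sum>m=1..M. if 2 * m = i then 2 / (4 * (real m)\<^sup>2 - 1) * (n / 2) else 0)"
    proof (intro sum.cong refl)
      fix m assume m: "m \<in> {1..M}"
      show "2 / (4 * (real m)\<^sup>2 - 1) * (\<Sum>k<n. cos (real (2 * m) * \<theta> k) * cos (real i * \<theta> k))
        = (if 2 * m = i then 2 / (4 * (real m)\<^sup>2 - 1) * (n / 2) else 0)"
        unfolding prod[OF m] by (cases "2 * m = i") (simp_all only: if_True if_False mult_zero_right simp_thms)
    qed
    finally have J: "J 0 i = 2 / n * ((if i = 0 then n else 0) -
        (\<Sum>m=1..M. if 2 * m = i then 2 / (4 * (real m)\<^sup>2 - 1) * (n / 2) else 0))"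
      using i by (simp add: D)
    show ?thesis
    proof (cases "even i \<and> i \<noteq> 0")
      case True
      then obtain m where m: "i = 2 * m" "m \<in> {1..M}" using i by (auto simp: M_def elim!: evenE)
      have "(\<Sum>m'=1..M. if 2 * m' = i then 2 / (4 * (real m')\<^sup>2 - 1) * (n / 2) else 0)
        = (\<Sum>m'=1..M. if m' = m then 2 / (4 * (real m')\<^sup>2 - 1) * (n / 2) else 0)"
        by (intro sum.cong) (auto simp: m)
      also have "\<dots> = 2 / (4 * (real m)\<^sup>2 - 1) * (n / 2)" using m by (simp add: sum.delta)
      finally have "J 0 i = 2 / n * (0 - 2 / (4 * (real m)\<^sup>2 - 1) * (n / 2))"
        using J True by (simp only: simp_thms if_False of_nat_0)
      moreover have "2 / n * (0 - e * (n / 2)) = - e" for e :: real using assms by simp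
      ultimately have "J 0 i = - (2 / (4 * (real m)\<^sup>2 - 1))" by metis
      also have "\<dots> = 2 / (1 - (real i)\<^sup>2)"
        by (simp add: m power_mult_distrib minus_divide_right)
      finally show ?thesis using True by simp
    next
      case False
      then have "(\<Sum>m=1..M. if 2 * m = i then 2 / (4 * (real m)\<^sup>2 - 1) * (n / 2) else 0) = 0"
        by (intro sum.neutral) auto
      then show ?thesis using J False assms by auto
    qed
  qed
  have int: "(\<lambda>t. cos t ^ j * cos (real i * t) * sin t) integrable_on {0..pi}" for j i
    by (intro integrable_continuous_real continuous_intros)
  \<comment> \<open>The lower index in the product formula; for i = 0 it is -1, and the cosine is even.\<close>
  define pr where "pr i = (if i = 0 then 1 else i - 1)" for i :: nat
  have cos_step: "cos x * cos (real i * x) = (cos (real (Suc i) * x) + cos (real (pr i) * x)) / 2" for x i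
  proof (cases i)
    case (Suc l)
    then show ?thesis by (simp add: pr_def cos_times_cos algebra_simps)
  qed (simp add: pr_def)
  have J_step: "J (Suc j) i = (J j (Suc i) + J j (pr i)) / 2" for j i
  proof -
    have split: "cos x ^ Suc j * cos (real i * x) = (cos x ^ j * cos (real (Suc i) * x) + cos x ^ j * cos (real (pr i) * x)) / 2" for x
    proof -
      have "cos x ^ Suc j * cos (real i * x) = cos x ^ j * (cos x * cos (real i * x))" by simp
      then show ?thesis unfolding cos_step by (simp add: distrib_left)
    qed
    have "J (Suc j) i = (\<Sum>k<n. (w k * (cos (\<theta> k) ^ j * cos (real (Suc i) * \<theta> k))
        + w k * (cos (\<theta> k) ^ j * cos (real (pr i) * \<theta> k))) / 2)"
      unfolding J_def split by (intro sum.cong refl) (simp add: distrib_left)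
    then show ?thesis by (simp only: J_def sum.distrib flip: sum_divide_distrib)
  qed
  have K_step: "K (Suc j) i = (K j (Suc i) + K j (pr i)) / 2" for j i
  proof -
    have "cos x ^ Suc j * cos (real i * x) * sin x
       = (cos x ^ j * cos (real (Suc i) * x) * sin x + cos x ^ j * cos (real (pr i) * x) * sin x) / 2" for x
    proof -
      have "cos x ^ Suc j * cos (real i * x) * sin x = cos x ^ j * (cos x * cos (real i * x)) * sin x" by simp
      then show ?thesis unfolding cos_step by (simp add: distrib_left distrib_right)
    qed
    then have "K (Suc j) i = integral {0..pi} (\<lambda>x. (cos x ^ j * cos (real (Suc i) * x) * sin x
        + cos x ^ j * cos (real (pr i) * x) * sin x) / 2)"
      by (simp only: K_def)
    also have "\<dots> = (K j (Suc i) + K j (pr i)) / 2"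
      unfolding K_def integral_divide by (subst integral_add[OF int int]) simp
    finally show ?thesis .
  qed
  have K0: "K 0 i = (if even i then 2 / (1 - (real i)\<^sup>2) else 0)" for i
    using has_integral_sin_cos[of i] by (simp add: K_def integral_unique)
  have JK: "J j i = K j i" if "i + j < n" for i j
    using that
  proof (induction j arbitrary: i)
    case (Suc j)
    have "Suc i + j < n" "pr i + j < n" using Suc.prems by (auto simp: pr_def)
    then show ?case using Suc.IH[of "Suc i"] Suc.IH[of "pr i"] by (simp only: J_step K_step)
  qed (simp add: J0 K0)
  have "(\<Sum>k<n. w k * cos (\<theta> k) ^ j) = (1 - (- 1) ^ Suc j) / real (Suc j)" if "j < n" for j
  proof -
    have "J j 0 = (\<Sum>k<n. w k * cos (\<theta> k) ^ j)" by (simp add: J_def)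
    moreover have "K j 0 = (1 - (- 1) ^ Suc j) / real (Suc j)"
      using integral_unique[OF has_integral_sin_cos_power[of j]] by (simp add: K_def)
    ultimately show ?thesis using JK[of 0 j] that by simp
  qed
  then show ?thesis
    using that[of w "\<lambda>k. cos (\<theta> k)"] w_pos nodes by simp
qed

text \<open>
  The quadrature formula applied to \<open>f'\<close>, as a polynomial identity. It holds over every integral
  domain that contains the real numbers, where integrals make no sense. With positive weights it
  takes the place of the mean value theorem, since an increment of \<open>f\<close> is then a positive combination
  of values of \<open>f'\<close>.
\<close>

lemma poly_diff_quadrature:
  fixes c :: "real \<Rightarrow> 'a::idom" and f :: "'a poly"
  assumes c: "ring_hom c" and n: "degree f \<le> n"
    and moments: "\<And>j. j < n \<Longrightarrow> (\<Sum>k<n. w k * \<xi> k ^ j) = (1 - (- 1) ^ Suc j) / real (Suc j)"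
  shows "poly f (m + h) - poly f (m - h) = h * (\<Sum>k<n. c (w k) * poly (pderiv f) (m + c (\<xi> k) * h))"
proof -
  note ch = ring_homD[OF c]
  have power: "(m + h) ^ j - (m - h) ^ j = h * (\<Sum>k<n. c (w k) * (of_nat j * (m + c (\<xi> k) * h) ^ (j - 1)))"
    if j: "j \<le> n" for j
  proof (cases j)
    case (Suc l)
    have bin: "(m + x) ^ N = (\<Sum>i\<le>N. of_nat (N choose i) * x ^ i * m ^ (N - i))" for x N
      using binomial_ring[of x m N] by (simp add: add.commute)
    have coef: "(\<Sum>k<n. of_nat j * of_nat (l choose i) * c (w k * \<xi> k ^ i)) = of_nat (j choose Suc i) * (1 - (- 1) ^ Suc i)"
      if "i \<le> l" for i
    proof -
      have "(\<Sum>k<n. of_nat j * of_nat (l choose i) * c (w k * \<xi> k ^ i))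
        = of_nat (Suc l * (l choose i)) * c ((1 - (- 1) ^ Suc i) / real (Suc i))"
      proof -
        have "(\<Sum>k<n. of_nat j * of_nat (l choose i) * c (w k * \<xi> k ^ i))
          = of_nat j * of_nat (l choose i) * c (\<Sum>k<n. w k * \<xi> k ^ i)"
          by (simp only: ch(8) sum_distrib_left)
        moreover have "(\<Sum>k<n. w k * \<xi> k ^ i) = (1 - (- 1) ^ Suc i) / real (Suc i)"
          using moments[of i] that j Suc by linarith
        ultimately show ?thesis unfolding Suc by (simp only: of_nat_mult)
      qed
      also have "Suc l * (l choose i) = (j choose Suc i) * Suc i"
        using Suc_times_binomial_eq[of l i] Suc by (simp add: mult.commute)
      also have "of_nat ((j choose Suc i) * Suc i) * c ((1 - (- 1) ^ Suc i) / real (Suc i))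
        = of_nat (j choose Suc i) * c (of_nat (Suc i) * ((1 - (- 1) ^ Suc i) / real (Suc i)))"
        by (simp only: of_nat_mult ch mult.assoc)
      also have "of_nat (Suc i) * ((1 - (- 1) ^ Suc i) / real (Suc i)) = 1 - (- 1) ^ Suc i"
        by simp
      finally show ?thesis by (simp add: ch)
    qed
    have "(m + h) ^ j - (m + (- h)) ^ j = (\<Sum>i\<le>j. of_nat (j choose i) * (h ^ i - (- h) ^ i) * m ^ (j - i))"
      unfolding bin by (simp add: sum_subtractf[symmetric] algebra_simps)
    also have "\<dots> = (\<Sum>i\<le>l. of_nat (j choose Suc i) * (h ^ Suc i - (- h) ^ Suc i) * m ^ (l - i))"
      unfolding Suc by (subst sum.atMost_Suc_shift) simp
    also have "\<dots> = (\<Sum>i\<le>l. (of_nat (j choose Suc i) * (1 - (- 1) ^ Suc i)) * (h ^ Suc i * m ^ (l - i)))"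
    proof (intro sum.cong refl)
      fix i
      have "h ^ Suc i - (- h) ^ Suc i = (1 - (- 1) ^ Suc i) * h ^ Suc i"
        by (simp add: power_minus[of h i] algebra_simps)
      then show "of_nat (j choose Suc i) * (h ^ Suc i - (- h) ^ Suc i) * m ^ (l - i)
        = (of_nat (j choose Suc i) * (1 - (- 1) ^ Suc i)) * (h ^ Suc i * m ^ (l - i))"
        by (simp only: mult.assoc)
    qed
    also have "\<dots> = (\<Sum>i\<le>l. \<Sum>k<n. of_nat j * of_nat (l choose i) * c (w k * \<xi> k ^ i) * (h ^ Suc i * m ^ (l - i)))"
      by (intro sum.cong refl) (simp only: atMost_iff coef sum_distrib_right[symmetric])
    also have "\<dots> = (\<Sum>k<n. \<Sum>i\<le>l. of_nat j * of_nat (l choose i) * c (w k * \<xi> k ^ i) * (h ^ Suc i * m ^ (l - i)))"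
      by (rule sum.swap)
    also have "\<dots> = (\<Sum>k<n. h * (c (w k) * (of_nat j * (m + c (\<xi> k) * h) ^ l)))"
      unfolding bin by (intro sum.cong refl) (simp add: sum_distrib_left ch power_mult_distrib ac_simps)
    finally show ?thesis by (simp add: Suc sum_distrib_left)
  qed simp
  let ?R = "\<lambda>f. h * (\<Sum>k<n. c (w k) * poly (pderiv f) (m + c (\<xi> k) * h))"
  have monom: "poly (monom a j) (m + h) - poly (monom a j) (m - h) = ?R (monom a j)" if "j \<le> n" for a j
  proof -
    have "poly (monom a j) (m + h) - poly (monom a j) (m - h) = a * ((m + h) ^ j - (m - h) ^ j)"
      by (simp add: poly_monom right_diff_distrib)
    also have "\<dots> = ?R (monom a j)"
      unfolding power[OF that] by (simp add: pderiv_monom poly_monom sum_distrib_left ac_simps)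
    finally show ?thesis .
  qed
  have R_add: "?R (p + q) = ?R p + ?R q" for p q
    by (simp add: pderiv_add distrib_left sum.distrib)
  have "poly (\<Sum>j\<le>N. monom (coeff f j) j) (m + h) - poly (\<Sum>j\<le>N. monom (coeff f j) j) (m - h)
      = ?R (\<Sum>j\<le>N. monom (coeff f j) j)" if "N \<le> n" for N
    using that
  proof (induction N)
    case 0
    then show ?case using monom[of 0 "coeff f 0"] by simp
  next
    case (Suc N)
    let ?S = "\<Sum>j\<le>N. monom (coeff f j) j"
    have "poly (?S + monom (coeff f (Suc N)) (Suc N)) (m + h) - poly (?S + monom (coeff f (Suc N)) (Suc N)) (m - h)
       = (poly ?S (m + h) - poly ?S (m - h)) + (poly (monom (coeff f (Suc N)) (Suc N)) (m + h)
           - poly (monom (coeff f (Suc N)) (Suc N)) (m - h))"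
      by simp
    also have "\<dots> = ?R ?S + ?R (monom (coeff f (Suc N)) (Suc N))"
      using Suc monom[of "Suc N" "coeff f (Suc N)"] by simp
    finally show ?case by (simp only: R_add sum.atMost_Suc)
  qed
  from this[OF n] show ?thesis by (simp only: poly_as_sum_of_monoms)
qed

section \<open>Sign charts of two families on two ordered lines\<close>

text \<open>
  All that the elimination of a variable uses about the line on which the members \<open>f\<close> of a family \<open>C\<close>
  of polynomials take the signs \<open>v f x\<close>: a dense weak order, the intermediate value property for the
  members of \<open>C\<close>, and strict monotonicity where the derivative has constant nonzero sign. The points
  \<open>lo\<close> and \<open>hi\<close> bound the part of the line under consideration. The order is only weak because points
  that differ by an element of sign zero are not identified.
\<close>

locale sign_line =
  fixes lt :: "'p \<Rightarrow> 'p \<Rightarrow> bool" and v :: "'f \<Rightarrow> 'p \<Rightarrow> real" and lo hi :: 'p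
    and C :: "'f set" and der :: "'f \<Rightarrow> 'f" and deg :: "'f \<Rightarrow> nat"
  assumes irrefl: "\<not> lt x x"
    and trans: "lt x y \<Longrightarrow> lt y z \<Longrightarrow> lt x z"
    and negtrans: "lt x z \<Longrightarrow> lt x y \<or> lt y z"
    and lo_hi: "lt lo hi"
    and dense: "lt x y \<Longrightarrow> \<exists>z. lt x z \<and> lt z y"
    and sgn_vals: "v f x = -1 \<or> v f x = 0 \<or> v f x = 1"
    and cong: "f \<in> C \<Longrightarrow> \<not> lt x y \<Longrightarrow> \<not> lt y x \<Longrightarrow> v f x = v f y"
    and ivt: "f \<in> C \<Longrightarrow> lt x y \<Longrightarrow> v f x * v f y < 0 \<Longrightarrow> \<exists>z. lt x z \<and> lt z y \<and> v f z = 0"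
    and mono: "f \<in> C \<Longrightarrow> 0 < deg f \<Longrightarrow> lt x y \<Longrightarrow> d \<noteq> 0 \<Longrightarrow> (\<And>z. lt x z \<Longrightarrow> lt z y \<Longrightarrow> v (der f) z = d)
      \<Longrightarrow> (0 \<le> d * v f x \<longrightarrow> 0 < d * v f y) \<and> (d * v f y \<le> 0 \<longrightarrow> d * v f x < 0)"
begin

definition dom :: "'p set" where "dom = {x. \<not> lt x lo \<and> \<not> lt hi x}"

lemma ex_max: "finite A \<Longrightarrow> A \<noteq> {} \<Longrightarrow> \<exists>m\<in>A. \<forall>p\<in>A. \<not> lt m p"
proof (induction A rule: finite_ne_induct)
  case (insert x A)
  then obtain m where "m \<in> A" "\<forall>p\<in>A. \<not> lt m p" by blast
  then show ?case using trans irrefl by (cases "lt m x") (metis insert_iff)+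
qed (use irrefl in auto)

lemma ex_min: "finite A \<Longrightarrow> A \<noteq> {} \<Longrightarrow> \<exists>m\<in>A. \<forall>p\<in>A. \<not> lt p m"
proof (induction A rule: finite_ne_induct)
  case (insert x A)
  then obtain m where "m \<in> A" "\<forall>p\<in>A. \<not> lt p m" by blast
  then show ?case using trans irrefl by (cases "lt x m") (metis insert_iff)+
qed (use irrefl in auto)

end

text \<open>
  The same formal family on two lines: the signs of constants agree, the signs at the end points
  agree, and pseudo-division by a member of the family is the same on both sides. The aim is that
  both lines realise the same sign vectors.
\<close>

locale two_sign_lines =
  S1: sign_line lt1 v1 lo1 hi1 C der deg + S2: sign_line lt2 v2 lo2 hi2 C der deg
  for lt1 :: "'p \<Rightarrow> 'p \<Rightarrow> bool" and v1 :: "'f \<Rightarrow> 'p \<Rightarrow> real" and lo1 hi1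
    and lt2 :: "'q \<Rightarrow> 'q \<Rightarrow> bool" and v2 :: "'f \<Rightarrow> 'q \<Rightarrow> real" and lo2 hi2
    and C :: "'f set" and der :: "'f \<Rightarrow> 'f" and deg :: "'f \<Rightarrow> nat" +
  assumes const: "f \<in> C \<Longrightarrow> deg f = 0 \<Longrightarrow> v1 f x = v2 f y"
    and der: "f \<in> C \<Longrightarrow> 0 < deg f \<Longrightarrow> der f \<in> C \<and> deg (der f) < deg f"
    and der_const: "f \<in> C \<Longrightarrow> 0 < deg f \<Longrightarrow> deg (der f) = 0 \<Longrightarrow> v1 (der f) x \<noteq> 0"
    and rem: "f \<in> C \<Longrightarrow> g \<in> C \<Longrightarrow> 0 < deg g \<Longrightarrow> deg g \<le> deg f \<Longrightarrow>
      \<exists>r\<in>C. deg r < deg g \<and> (\<exists>k. k \<noteq> 0 \<and> (\<forall>x. v1 g x = 0 \<longrightarrow> v1 f x * k = v1 r x) \<and>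
        (\<forall>y. v2 g y = 0 \<longrightarrow> v2 f y * k = v2 r y))"
    and ends: "f \<in> C \<Longrightarrow> v1 f lo1 = v2 f lo2" "f \<in> C \<Longrightarrow> v1 f hi1 = v2 f hi2"
begin

text \<open>
  A finite set \<open>Z\<close> of matched points cuts both lines into cells, namely the points of \<open>Z\<close> and the open
  gaps between them. The points \<open>x\<close> and \<open>y\<close> lie in corresponding cells if they compare in the same way
  with all matched points. In particular the matching is monotone if each matched pair lies in
  corresponding cells, which is the last condition of a skeleton.
\<close>

definition same_cell :: "('p \<times> 'q) set \<Rightarrow> 'p \<Rightarrow> 'q \<Rightarrow> bool" where
  "same_cell Z x y \<longleftrightarrow> (\<forall>a b. (a, b) \<in> Z \<longrightarrow> (lt1 x a \<longleftrightarrow> lt2 y b) \<and> (lt1 a x \<longleftrightarrow> lt2 b y))"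

definition skeleton :: "('p \<times> 'q) set \<Rightarrow> bool" where
  "skeleton Z \<longleftrightarrow> finite Z \<and> (lo1, lo2) \<in> Z \<and> (hi1, hi2) \<in> Z \<and>
     (\<forall>a b. (a, b) \<in> Z \<longrightarrow> a \<in> S1.dom \<and> b \<in> S2.dom \<and> same_cell Z a b)"

definition agree :: "('p \<times> 'q) set \<Rightarrow> 'f set \<Rightarrow> bool" where
  "agree Z F \<longleftrightarrow> (\<forall>x\<in>S1.dom. \<forall>y\<in>S2.dom. same_cell Z x y \<longrightarrow> (\<forall>f\<in>F. v1 f x = v2 f y))"

definition complete1 :: "('p \<times> 'q) set \<Rightarrow> 'f set \<Rightarrow> bool" where
  "complete1 Z F \<longleftrightarrow> (\<forall>f\<in>F. 0 < deg f \<longrightarrow> (\<forall>x\<in>S1.dom. v1 f x = 0 \<longrightarrow>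
     (\<exists>a b. (a, b) \<in> Z \<and> \<not> lt1 x a \<and> \<not> lt1 a x)))"

definition complete2 :: "('p \<times> 'q) set \<Rightarrow> 'f set \<Rightarrow> bool" where
  "complete2 Z F \<longleftrightarrow> (\<forall>f\<in>F. 0 < deg f \<longrightarrow> (\<forall>y\<in>S2.dom. v2 f y = 0 \<longrightarrow>
     (\<exists>a b. (a, b) \<in> Z \<and> \<not> lt2 y b \<and> \<not> lt2 b y)))"

definition gap :: "('p \<times> 'q) set \<Rightarrow> 'p \<Rightarrow> 'q \<Rightarrow> 'p \<Rightarrow> 'q \<Rightarrow> bool" where
  "gap Z a b a' b' \<longleftrightarrow> (a, b) \<in> Z \<and> (a', b') \<in> Z \<and> lt1 a a' \<and> lt2 b b' \<and>
     (\<forall>p q. (p, q) \<in> Z \<longrightarrow> (\<not> lt1 a p \<and> \<not> lt2 b q) \<or> (\<not> lt1 p a' \<and> \<not> lt2 q b'))"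

lemma skeletonD:
  assumes "skeleton Z"
  shows "finite Z" "(lo1, lo2) \<in> Z" "(hi1, hi2) \<in> Z" "(a, b) \<in> Z \<Longrightarrow> a \<in> S1.dom"
    "(a, b) \<in> Z \<Longrightarrow> b \<in> S2.dom" "(a, b) \<in> Z \<Longrightarrow> same_cell Z a b"
    "(a, b) \<in> Z \<Longrightarrow> (a', b') \<in> Z \<Longrightarrow> lt1 a a' \<longleftrightarrow> lt2 b b'"
  using assms by (auto simp: skeleton_def same_cell_def)

lemma gap_same_cell:
  assumes "gap Z a b a' b'" "lt1 a t" "lt1 t a'" "lt2 b u" "lt2 u b'"
  shows "same_cell Z t u"
  unfolding same_cell_def
proof (intro allI impI)
  fix p q assume "(p, q) \<in> Z"
  then consider "\<not> lt1 a p" "\<not> lt2 b q" | "\<not> lt1 p a'" "\<not> lt2 q b'"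
    using assms(1) by (auto simp: gap_def)
  then show "(lt1 t p \<longleftrightarrow> lt2 u q) \<and> (lt1 p t \<longleftrightarrow> lt2 q u)"
  proof cases
    case 1
    then have "lt1 p t" "lt2 q u" using S1.negtrans[of a t p] S2.negtrans[of b u q] assms by auto
    then show ?thesis using S1.trans S1.irrefl S2.trans S2.irrefl by blast
  next
    case 2
    then have "lt1 t p" "lt2 u q" using S1.negtrans[of t a' p] S2.negtrans[of u b' q] assms by auto
    then show ?thesis using S1.trans S1.irrefl S2.trans S2.irrefl by blast
  qed
qed

lemma gap_dom:
  assumes "skeleton Z" "gap Z a b a' b'"
  shows "lt1 a t \<Longrightarrow> lt1 t a' \<Longrightarrow> t \<in> S1.dom" "lt2 b u \<Longrightarrow> lt2 u b' \<Longrightarrow> u \<in> S2.dom"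
proof -
  have "a \<in> S1.dom" "a' \<in> S1.dom" "b \<in> S2.dom" "b' \<in> S2.dom"
    using assms skeletonD by (auto simp: gap_def)
  then show "lt1 a t \<Longrightarrow> lt1 t a' \<Longrightarrow> t \<in> S1.dom" "lt2 b u \<Longrightarrow> lt2 u b' \<Longrightarrow> u \<in> S2.dom"
    using S1.trans S2.trans unfolding S1.dom_def S2.dom_def by blast+
qed

lemma gap_no_point:
  assumes "gap Z a b a' b'" "(p, q) \<in> Z"
  shows "lt1 a t \<Longrightarrow> lt1 t a' \<Longrightarrow> lt1 t p \<or> lt1 p t" "lt2 b u \<Longrightarrow> lt2 u b' \<Longrightarrow> lt2 u q \<or> lt2 q u"
proof -
  have *: "(\<not> lt1 a p \<and> \<not> lt2 b q) \<or> (\<not> lt1 p a' \<and> \<not> lt2 q b')"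
    using assms by (auto simp: gap_def)
  then show "lt1 a t \<Longrightarrow> lt1 t a' \<Longrightarrow> lt1 t p \<or> lt1 p t"
    using S1.negtrans[of a t p] S1.negtrans[of t a' p] by blast
  show "lt2 b u \<Longrightarrow> lt2 u b' \<Longrightarrow> lt2 u q \<or> lt2 q u"
    using * S2.negtrans[of b u q] S2.negtrans[of u b' q] by blast
qed

lemma find_gap1:
  assumes Z: "skeleton Z" and x: "x \<in> S1.dom" and new: "\<And>a b. (a, b) \<in> Z \<Longrightarrow> lt1 x a \<or> lt1 a x"
  obtains a b a' b' where "gap Z a b a' b'" "lt1 a x" "lt1 x a'"
proof -
  note Zd = skeletonD[OF Z]
  let ?L = "{a \<in> fst ` Z. lt1 a x}" and ?R = "{a \<in> fst ` Z. lt1 x a}"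
  have "lo1 \<in> ?L" "hi1 \<in> ?R"
    using Zd(2,3) new[OF Zd(2)] new[OF Zd(3)] x by (force simp: S1.dom_def)+
  then have "?L \<noteq> {}" "?R \<noteq> {}" by blast+
  moreover have "finite ?L" "finite ?R" using Zd(1) by auto
  ultimately have ex: "\<exists>m\<in>?L. \<forall>p\<in>?L. \<not> lt1 m p" "\<exists>m\<in>?R. \<forall>p\<in>?R. \<not> lt1 p m"
    by (simp_all only: S1.ex_max S1.ex_min simp_thms)
  obtain a where "a \<in> ?L" "\<forall>p\<in>?L. \<not> lt1 a p" using ex(1) by (elim bexE)
  moreover obtain a' where "a' \<in> ?R" "\<forall>p\<in>?R. \<not> lt1 p a'" using ex(2) by (elim bexE)
  moreover note a = calculation
  obtain b b' where b: "(a, b) \<in> Z" "(a', b') \<in> Z" using a by auto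
  have ax: "lt1 a x" "lt1 x a'" using a by auto
  have aa': "lt1 a a'" using S1.trans ax by blast
  have "\<not> lt1 a p \<or> \<not> lt1 p a'" if "(p, q) \<in> Z" for p q
  proof -
    have "p \<in> ?L \<or> p \<in> ?R" using new[OF that] that by force
    then show ?thesis using a by blast
  qed
  then have "gap Z a b a' b'"
    unfolding gap_def using b aa' Zd(7)[OF b] Zd(7)[OF b(1)] Zd(7)[OF _ b(2)] by auto
  then show ?thesis using that ax by blast
qed

text \<open>
  All roots of the derivative are among the matched points, so it has no root in a gap; its sign
  there is constant, and it is the same on both lines because a gap is a single cell.
\<close>

lemma gap_derivative_sign:
  assumes Z: "skeleton Z" "agree Z F" "complete1 Z F" and f: "f \<in> C" "0 < deg f" "der f \<in> F"
    and gap: "gap Z a b a' b'"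
  obtains d where "d \<noteq> 0" "\<And>t. lt1 a t \<Longrightarrow> lt1 t a' \<Longrightarrow> v1 (der f) t = d"
    "\<And>u. lt2 b u \<Longrightarrow> lt2 u b' \<Longrightarrow> v2 (der f) u = d"
proof -
  have "lt1 a a'" "lt2 b b'" using gap by (auto simp: gap_def)
  then obtain x y where x: "lt1 a x" "lt1 x a'" and y: "lt2 b y" "lt2 y b'"
    using S1.dense S2.dense by metis
  have eq: "v1 (der f) t = v2 (der f) u"
    if "lt1 a t" "lt1 t a'" "lt2 b u" "lt2 u b'" for t u
    using Z(2) gap_dom[OF Z(1) gap] gap_same_cell[OF gap that] that f(3) unfolding agree_def by blast
  have "v1 (der f) x \<noteq> 0"
  proof (cases "deg (der f) = 0")
    case True
    then show ?thesis using der_const f by blast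
  next
    case False
    show ?thesis
    proof
      assume "v1 (der f) x = 0"
      then obtain p q where "(p, q) \<in> Z" "\<not> lt1 x p" "\<not> lt1 p x"
        using Z(3) False f(3) gap_dom(1)[OF Z(1) gap x] unfolding complete1_def by blast
      then show False using gap_no_point(1)[OF gap _ x] by blast
    qed
  qed
  then show ?thesis using that[of "v1 (der f) x"] eq x y by metis
qed

text \<open>
  A root inside a gap forces opposite signs at the two ends of the gap by monotonicity. These signs
  are the same on the other line, where the intermediate value property then yields a root.
\<close>

lemma root_in_gap:
  assumes Z: "skeleton Z" "agree Z F" "complete1 Z F" and f: "f \<in> C" "0 < deg f" "der f \<in> F"
    and vals: "\<And>a b. (a, b) \<in> Z \<Longrightarrow> v1 f a = v2 f b"
    and gap: "gap Z a b a' b'" and x: "lt1 a x" "lt1 x a'" "v1 f x = 0"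
  obtains y where "lt2 b y" "lt2 y b'" "v2 f y = 0"
proof -
  obtain d where d: "d \<noteq> 0" "\<And>t. lt1 a t \<Longrightarrow> lt1 t a' \<Longrightarrow> v1 (der f) t = d"
    "\<And>u. lt2 b u \<Longrightarrow> lt2 u b' \<Longrightarrow> v2 (der f) u = d"
    by (rule gap_derivative_sign[OF Z f gap]) blast
  have "d * v1 f a < 0"
    using S1.mono[OF f(1,2) x(1) d(1)] d(2) S1.trans x by (metis mult_zero_right order_refl)
  moreover have "0 < d * v1 f a'"
    using S1.mono[OF f(1,2) x(2) d(1)] d(2) S1.trans x by (metis mult_zero_right order_refl)
  moreover have "v1 f a = v2 f b" "v1 f a' = v2 f b'" "lt2 b b'" using gap vals by (auto simp: gap_def)
  ultimately have "v2 f b * v2 f b' < 0" by (auto simp: mult_less_0_iff zero_less_mult_iff)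
  then show ?thesis using S2.ivt[OF f(1)] \<open>lt2 b b'\<close> that by blast
qed

end

text \<open>
  The situation is symmetric, so facts about roots on the first line carry over to the second.
\<close>

sublocale two_sign_lines \<subseteq> swap: two_sign_lines lt2 v2 lo2 hi2 lt1 v1 lo1 hi1 C der deg
proof unfold_locales
  show "v2 (der f) x \<noteq> 0" if "f \<in> C" "0 < deg f" "deg (der f) = 0" for f x
    using der[of f] der_const[of f] const[of "der f"] that by metis
qed (use const der rem ends in \<open>metis+\<close>)

context two_sign_lines begin

lemma swap_defs:
  "swap.same_cell (prod.swap ` Z) y x = same_cell Z x y"
  "swap.skeleton (prod.swap ` Z) = skeleton Z"
  "swap.agree (prod.swap ` Z) F = agree Z F"
  "swap.complete1 (prod.swap ` Z) F = complete2 Z F"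
  "swap.complete2 (prod.swap ` Z) F = complete1 Z F"
  "swap.gap (prod.swap ` Z) b a b' a' = gap Z a b a' b'"
proof -
  have sw: "(p, q) \<in> prod.swap ` Z \<longleftrightarrow> (q, p) \<in> Z" for p q by force
  show 1: "swap.same_cell (prod.swap ` Z) y x = same_cell Z x y" for x y
    unfolding swap.same_cell_def same_cell_def sw by blast
  have fin: "finite (prod.swap ` Z) = finite Z" by (rule finite_image_iff[OF inj_swap])
  show "swap.skeleton (prod.swap ` Z) = skeleton Z"
    unfolding swap.skeleton_def skeleton_def sw 1 fin by blast
  show "swap.agree (prod.swap ` Z) F = agree Z F"
    unfolding swap.agree_def agree_def 1 by metis
  show "swap.complete1 (prod.swap ` Z) F = complete2 Z F"
    "swap.complete2 (prod.swap ` Z) F = complete1 Z F"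
    unfolding swap.complete1_def swap.complete2_def complete1_def complete2_def sw by blast+
  show "swap.gap (prod.swap ` Z) b a b' a' = gap Z a b a' b'"
    unfolding swap.gap_def gap_def sw by blast
qed

text \<open>
  Each inner matched point is a root of some member of the family; the sign of a further polynomial
  at that point is then found by pseudo-division.
\<close>

definition rooted :: "('p \<times> 'q) set \<Rightarrow> 'f set \<Rightarrow> bool" where
  "rooted Z F \<longleftrightarrow> (\<forall>a b. (a, b) \<in> Z \<longrightarrow> (a, b) = (lo1, lo2) \<or> (a, b) = (hi1, hi2) \<or>
     (\<exists>g\<in>F. 0 < deg g \<and> v1 g a = 0 \<and> v2 g b = 0))"

definition chart :: "('p \<times> 'q) set \<Rightarrow> 'f set \<Rightarrow> bool" where
  "chart Z F \<longleftrightarrow> skeleton Z \<and> agree Z F \<and> complete1 Z F \<and> complete2 Z F \<and> rooted Z F"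

lemma find_gap2:
  assumes "skeleton Z" "y \<in> S2.dom" "\<And>a b. (a, b) \<in> Z \<Longrightarrow> lt2 y b \<or> lt2 b y"
  obtains a b a' b' where "gap Z a b a' b'" "lt2 b y" "lt2 y b'"
proof -
  have "swap.skeleton (prod.swap ` Z)" using assms(1) by (simp add: swap_defs)
  moreover have "\<And>b a. (b, a) \<in> prod.swap ` Z \<Longrightarrow> lt2 y b \<or> lt2 b y" using assms(3) by force
  ultimately obtain b a b' a' where "swap.gap (prod.swap ` Z) b a b' a'" "lt2 b y" "lt2 y b'"
    using swap.find_gap1[of "prod.swap ` Z" y] assms(2) by metis
  then show ?thesis using that by (simp add: swap_defs)
qed

lemma root_in_gap2:
  assumes Z: "skeleton Z" "agree Z F" "complete2 Z F" and f: "f \<in> C" "0 < deg f" "der f \<in> F"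
    and vals: "\<And>a b. (a, b) \<in> Z \<Longrightarrow> v1 f a = v2 f b"
    and gap: "gap Z a b a' b'" and y: "lt2 b y" "lt2 y b'" "v2 f y = 0"
  obtains x where "lt1 a x" "lt1 x a'" "v1 f x = 0"
proof -
  have vals': "\<And>b a. (b, a) \<in> prod.swap ` Z \<Longrightarrow> v2 f b = v1 f a" using vals by force
  have *: "swap.skeleton (prod.swap ` Z)" "swap.agree (prod.swap ` Z) F" "swap.complete1 (prod.swap ` Z) F"
    using Z by (simp_all only: swap_defs)
  have gap': "swap.gap (prod.swap ` Z) b a b' a'" using gap by (simp only: swap_defs)
  show ?thesis
    by (rule swap.root_in_gap[OF * f vals' gap' y]) (assumption | rule that)+
qed

text \<open>
  Roots of \<open>f\<close> on the second line that are not yet matched are matched one after the other with roots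
  in the corresponding gaps of the first line. There are only finitely many of them.
\<close>

lemma extend_by_roots:
  assumes f: "f \<in> C" "0 < deg f" "der f \<in> F" and fin: "finite {y. v2 f y = 0}"
    and "skeleton Z" "agree Z F" "complete1 Z F" "complete2 Z F" "rooted Z (insert f F)"
    and "\<And>a b. (a, b) \<in> Z \<Longrightarrow> v1 f a = v2 f b"
  shows "\<exists>Z'. skeleton Z' \<and> agree Z' F \<and> complete1 Z' F \<and> complete2 Z' F \<and> rooted Z' (insert f F)
    \<and> (\<forall>a b. (a, b) \<in> Z' \<longrightarrow> v1 f a = v2 f b) \<and> complete2 Z' {f}"
  using assms(5-)
proof (induction "card ({y. v2 f y = 0} - snd ` Z)" arbitrary: Z rule: less_induct)
  case less
  show ?case
  proof (cases "complete2 Z {f}")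
    case True
    then show ?thesis using less.prems by blast
  next
    case False
    then obtain y where y: "y \<in> S2.dom" "v2 f y = 0" "\<And>a b. (a, b) \<in> Z \<Longrightarrow> lt2 y b \<or> lt2 b y"
      unfolding complete2_def by blast
    obtain a b a' b' where gap: "gap Z a b a' b'" "lt2 b y" "lt2 y b'"
      using find_gap2[OF less.prems(1) y(1)] y(3) by metis
    obtain x where x: "lt1 a x" "lt1 x a'" "v1 f x = 0"
      using root_in_gap2[OF less.prems(1,2,4) f less.prems(6) gap(1) gap(2,3) y(2)] by blast
    define Z' where "Z' = insert (x, y) Z"
    note Zd = skeletonD[OF less.prems(1)]
    have cell: "same_cell Z x y" using gap_same_cell[OF gap(1) x(1,2) gap(2,3)] .
    have finer: "same_cell Z s t" if "same_cell Z' s t" for s t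
      using that by (auto simp: same_cell_def Z'_def)
    have "y \<notin> snd ` Z" using y(3) S2.irrefl by force
    then have "{y. v2 f y = 0} - snd ` Z' \<subset> {y. v2 f y = 0} - snd ` Z"
      using y(2) by (auto simp: Z'_def)
    then have "card ({y. v2 f y = 0} - snd ` Z') < card ({y. v2 f y = 0} - snd ` Z)"
      using fin by (intro psubset_card_mono) auto
    moreover have "skeleton Z'"
      unfolding skeleton_def
    proof (intro conjI allI impI)
      fix s t assume "(s, t) \<in> Z'"
      then consider "s = x" "t = y" | "(s, t) \<in> Z" by (auto simp: Z'_def)
      then have "s \<in> S1.dom \<and> t \<in> S2.dom \<and> same_cell Z' s t"
      proof cases
        case 1
        then show ?thesis
          using gap_dom[OF less.prems(1) gap(1)] x gap y(1) cell S1.irrefl S2.irrefl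
          by (auto simp: same_cell_def Z'_def)
      next
        case 2
        then show ?thesis
          using Zd(4-6) cell by (auto simp: same_cell_def Z'_def)
      qed
      then show "s \<in> S1.dom" "t \<in> S2.dom" "same_cell Z' s t" by blast+
    qed (use Zd(1-3) in \<open>auto simp: Z'_def\<close>)
    moreover have "agree Z' F" using less.prems(2) finer unfolding agree_def by blast
    moreover have "complete1 Z' F" "complete2 Z' F"
      using less.prems(3,4) unfolding complete1_def complete2_def Z'_def by blast+
    moreover have "rooted Z' (insert f F)"
      using less.prems(5) x(3) y(2) f(2) unfolding rooted_def Z'_def by blast
    moreover have "v1 f s = v2 f t" if "(s, t) \<in> Z'" for s t
      using that less.prems(6) x(3) y(2) by (auto simp: Z'_def)
    ultimately show ?thesis by (rule less.hyps)
  qed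
qed

lemma agree_at_point:
  assumes "skeleton Z" "f \<in> C" "\<And>a b. (a, b) \<in> Z \<Longrightarrow> v1 f a = v2 f b"
    "same_cell Z x y" "(a, b) \<in> Z" "\<not> lt1 x a" "\<not> lt1 a x"
  shows "v1 f x = v2 f y"
proof -
  have "\<not> lt2 y b" "\<not> lt2 b y" using assms by (auto simp: same_cell_def)
  then show ?thesis using S1.cong[of f x a] S2.cong[of f y b] assms by simp
qed

text \<open>
  All roots are matched, so a gap contains none; by the intermediate value property a nonzero sign at
  its left end persists throughout.
\<close>

lemma sign_left_nonzero:
  assumes Z: "skeleton Z" "complete1 Z {f}" and f: "f \<in> C" "0 < deg f"
    and gap: "gap Z a b a' b'" "lt1 a x" "lt1 x a'" and nz: "v1 f a \<noteq> 0"
  shows "v1 f x = v1 f a"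
proof (rule ccontr)
  assume ne: "v1 f x \<noteq> v1 f a"
  have noroot: "v1 f t \<noteq> 0" if t: "lt1 a t" "lt1 t a'" for t
  proof
    assume "v1 f t = 0"
    then obtain p q where "(p, q) \<in> Z" "\<not> lt1 t p" "\<not> lt1 p t"
      using Z(2) f(2) gap_dom(1)[OF Z(1) gap(1) t] unfolding complete1_def by blast
    then show False using gap_no_point(1)[OF gap(1) _ t] by blast
  qed
  have "v1 f a * v1 f x < 0"
    using S1.sgn_vals[of f a] S1.sgn_vals[of f x] noroot[OF gap(2,3)] nz ne by auto
  then obtain z where "lt1 a z" "lt1 z x" "v1 f z = 0" using S1.ivt[OF f(1) gap(2)] by blast
  then show False using noroot[of z] S1.trans[of z x a'] gap(3) by blast
qed

end

context two_sign_lines begin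

text \<open>
  One step of the elimination algorithm of Cohen and Hoermander: a polynomial \<open>f\<close> joins a family
  that contains all members of smaller degree. At the matched points its signs agree on both lines
  by pseudo-division. Its roots can then be matched, and inside a gap of the refined matching its
  sign equals the sign at the left end or, if that is zero, the sign of the derivative.
\<close>

lemma chart_extend:
  assumes Z: "chart Z F" and f: "f \<in> C" "0 < deg f" and fin: "finite {y. v2 f y = 0}"
    and F: "F \<subseteq> C" "\<And>g. g \<in> F \<Longrightarrow> deg g \<le> deg f" "\<And>r. r \<in> C \<Longrightarrow> deg r < deg f \<Longrightarrow> r \<in> F"
  shows "\<exists>Z'. chart Z' (insert f F)"
proof -
  have Zc: "skeleton Z" "agree Z F" "complete1 Z F" "complete2 Z F" "rooted Z F"
    using Z by (auto simp: chart_def)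
  have derF: "der f \<in> F" using der[OF f] F(3) by blast
  have vals: "v1 f a = v2 f b" if ab: "(a, b) \<in> Z" for a b
  proof -
    consider "(a, b) = (lo1, lo2)" | "(a, b) = (hi1, hi2)"
      | g where "g \<in> F" "0 < deg g" "v1 g a = 0" "v2 g b = 0"
      using Zc(5) ab unfolding rooted_def by blast
    then show ?thesis
    proof cases
      case 3
      then obtain r k where r: "r \<in> C" "deg r < deg g" "k \<noteq> 0"
        "v1 f a * k = v1 r a" "v2 f b * k = v2 r b"
        using rem[OF f(1), of g] F(1,2) by blast
      then have "r \<in> F" using F(2)[OF 3(1)] F(3) by simp
      then have "v1 r a = v2 r b"
        using Zc(2) skeletonD(4-6)[OF Zc(1) ab] unfolding agree_def by blast
      then show ?thesis using r by (metis mult_right_cancel)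
    qed (use ends f in auto)
  qed
  have "rooted Z (insert f F)" using Zc(5) unfolding rooted_def by blast
  then obtain Z' where Z': "skeleton Z'" "agree Z' F" "complete1 Z' F" "complete2 Z' F"
    "rooted Z' (insert f F)" "\<And>a b. (a, b) \<in> Z' \<Longrightarrow> v1 f a = v2 f b" "complete2 Z' {f}"
    using extend_by_roots[OF f derF fin Zc(1-4) _ vals] by blast
  have compl1: "complete1 Z' {f}"
    unfolding complete1_def
  proof (clarify, rule ccontr)
    fix x assume x: "x \<in> S1.dom" "v1 f x = 0" "\<nexists>a b. (a, b) \<in> Z' \<and> \<not> lt1 x a \<and> \<not> lt1 a x"
    then obtain a b a' b' where gap: "gap Z' a b a' b'" "lt1 a x" "lt1 x a'"
      using find_gap1[OF Z'(1) x(1)] by metis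
    obtain y where y: "lt2 b y" "lt2 y b'" "v2 f y = 0"
      using root_in_gap[OF Z'(1-3) f derF Z'(6) gap x(2)] by blast
    then obtain p q where "(p, q) \<in> Z'" "\<not> lt2 y q" "\<not> lt2 q y"
      using Z'(7) f(2) gap_dom(2)[OF Z'(1) gap(1)] unfolding complete2_def by blast
    then show False using gap_no_point(2)[OF gap(1) _ y(1,2)] by blast
  qed
  have agree: "v1 f x = v2 f y" if xy: "x \<in> S1.dom" "y \<in> S2.dom" "same_cell Z' x y" for x y
  proof (cases "\<exists>a b. (a, b) \<in> Z' \<and> \<not> lt1 x a \<and> \<not> lt1 a x")
    case True
    then show ?thesis using agree_at_point[OF Z'(1) f(1) Z'(6) xy(3)] by blast
  next
    case False
    then obtain a b a' b' where gap: "gap Z' a b a' b'" "lt1 a x" "lt1 x a'"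
      using find_gap1[OF Z'(1) xy(1)] by metis
    then have ab: "(a, b) \<in> Z'" "(a', b') \<in> Z'" by (auto simp: gap_def)
    have y: "lt2 b y" "lt2 y b'" using gap(2,3) xy(3) ab by (auto simp: same_cell_def)
    have eq: "v1 f a = v2 f b" by (rule Z'(6)[OF ab(1)])
    show ?thesis
    proof (cases "v1 f a = 0")
      case False
      have "v1 f x = v1 f a" by (rule sign_left_nonzero[OF Z'(1) compl1 f gap False])
      moreover have "v2 f y = v2 f b"
        by (rule swap.sign_left_nonzero[of "prod.swap ` Z'" f b a b' a'])
           (use Z' f gap y False eq in \<open>auto simp: swap_defs\<close>)
      ultimately show ?thesis using eq by simp
    next
      case True
      obtain d where d: "d \<noteq> 0" "\<And>t. lt1 a t \<Longrightarrow> lt1 t a' \<Longrightarrow> v1 (der f) t = d"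
        "\<And>u. lt2 b u \<Longrightarrow> lt2 u b' \<Longrightarrow> v2 (der f) u = d"
        by (rule gap_derivative_sign[OF Z'(1-3) f derF gap(1)]) blast
      have "0 < d * v1 f x"
        using S1.mono[OF f gap(2) d(1)] d(2) S1.trans gap(3) True by (metis mult_zero_right order_refl)
      moreover have "0 < d * v2 f y"
        using S2.mono[OF f y(1) d(1)] d(3) S2.trans y(2) True eq by (metis mult_zero_right order_refl)
      ultimately show ?thesis
        using S1.sgn_vals[of f x] S2.sgn_vals[of f y] by (auto simp: zero_less_mult_iff)
    qed
  qed
  have "agree Z' (insert f F)" using Z'(2) agree unfolding agree_def by blast
  moreover have "complete1 Z' (insert f F)" "complete2 Z' (insert f F)"
    using Z'(3,4,7) compl1 unfolding complete1_def complete2_def by blast+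
  ultimately show ?thesis using Z'(1,5) unfolding chart_def by blast
qed

text \<open>
  The members join in the order of their degrees; the constants need only the two end points.
\<close>

lemma chart_exists:
  assumes fin: "\<And>f. f \<in> C \<Longrightarrow> 0 < deg f \<Longrightarrow> finite {y. v2 f y = 0}"
    and "finite F" "F \<subseteq> C" "\<And>f r. f \<in> F \<Longrightarrow> r \<in> C \<Longrightarrow> deg r < deg f \<Longrightarrow> r \<in> F"
  shows "\<exists>Z. chart Z F"
  using assms(2-)
proof (induction "card F" arbitrary: F rule: less_induct)
  case less
  show ?case
  proof (cases "\<exists>f\<in>F. 0 < deg f")
    case False
    let ?Z = "{(lo1, lo2), (hi1, hi2)}"
    have "\<not> lt1 hi1 lo1" "\<not> lt2 hi2 lo2"
      using S1.lo_hi S1.trans S1.irrefl S2.lo_hi S2.trans S2.irrefl by blast+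
    then have "skeleton ?Z"
      using S1.irrefl S2.irrefl S1.lo_hi S2.lo_hi
      by (auto simp: skeleton_def same_cell_def S1.dom_def S2.dom_def)
    moreover have "agree ?Z F" using const False less.prems(2) unfolding agree_def by blast
    moreover have "complete1 ?Z F" "complete2 ?Z F"
      using False unfolding complete1_def complete2_def by blast+
    moreover have "rooted ?Z F" unfolding rooted_def by blast
    ultimately show ?thesis unfolding chart_def by blast
  next
    case True
    then have ne: "F \<noteq> {}" by blast
    have "Max (deg ` F) \<in> deg ` F" using less.prems(1) ne by (intro Max_in) auto
    then obtain f where fF: "f \<in> F" and "Max (deg ` F) = deg f" by auto
    then have max: "deg g \<le> deg f" if "g \<in> F" for g
      using less.prems(1) that by (metis Max_ge finite_imageI imageI)
    have pos: "0 < deg f" using True max by fastforce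
    define F' where "F' = F - {f}"
    have F: "F = insert f F'" "card F' < card F" "finite F'"
      using fF less.prems(1) card_Diff1_less[OF less.prems(1) fF] by (auto simp: F'_def)
    have fC: "f \<in> C" using fF less.prems(2) by blast
    have "\<exists>Z. chart Z F'"
    proof (rule less.hyps[OF F(2,3)])
      show "F' \<subseteq> C" using less.prems(2) by (auto simp: F'_def)
      show "r \<in> F'" if "g \<in> F'" "r \<in> C" "deg r < deg g" for g r
        using that less.prems(3)[of g r] max[of g] by (auto simp: F'_def)
    qed
    then obtain Z where "chart Z F'" by blast
    then show ?thesis
      unfolding F(1)
      using chart_extend[of Z F' f] fC pos fin max less.prems(2) less.prems(3)[OF fF]
      by (metis (no_types, lifting) DiffD1 DiffI F'_def nat_less_le singletonD subset_iff)
  qed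
qed

theorem sign_vectors_transfer:
  assumes "finite C" and fin: "\<And>f. f \<in> C \<Longrightarrow> 0 < deg f \<Longrightarrow> finite {y. v2 f y = 0}"
    and x: "x \<in> S1.dom"
  shows "\<exists>y. \<forall>f\<in>C. v1 f x = v2 f y"
proof -
  obtain Z where Z: "chart Z C" using chart_exists[OF fin assms(1)] by blast
  then have sk: "skeleton Z" and ag: "agree Z C" by (auto simp: chart_def)
  show ?thesis
  proof (cases "\<exists>a b. (a, b) \<in> Z \<and> \<not> lt1 x a \<and> \<not> lt1 a x")
    case True
    then obtain a b where ab: "(a, b) \<in> Z" "\<not> lt1 x a" "\<not> lt1 a x" by blast
    then have "v1 f x = v2 f b" if "f \<in> C" for f
      using S1.cong[OF that ab(2,3)] ag skeletonD(4-6)[OF sk ab(1)] that unfolding agree_def by metis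
    then show ?thesis by blast
  next
    case False
    then obtain a b a' b' where gap: "gap Z a b a' b'" "lt1 a x" "lt1 x a'"
      using find_gap1[OF sk x] by metis
    then obtain y where y: "lt2 b y" "lt2 y b'" using S2.dense by (metis gap_def)
    have "v1 f x = v2 f y" if "f \<in> C" for f
      using ag that x gap_dom(2)[OF sk gap(1) y] gap_same_cell[OF gap y] unfolding agree_def by blast
    then show ?thesis by blast
  qed
qed

end

context sign_ring begin

text \<open>
  Splitting off linear factors works although the ring is not a field: a second root with
  difference of nonzero sign remains a root of the quotient.
\<close>

lemma root_count:
  assumes "s (lead_coeff p) \<noteq> 0" "finite W" "\<And>w. w \<in> W \<Longrightarrow> s (poly p w) = 0"
    "\<And>w w'. w \<in> W \<Longrightarrow> w' \<in> W \<Longrightarrow> w \<noteq> w' \<Longrightarrow> s (w - w') \<noteq> 0"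
  shows "card W \<le> degree p"
  using assms
proof (induction "degree p" arbitrary: p W)
  case 0
  then obtain a where "p = [:a:]" by (metis degree_eq_zeroE)
  then have "W = {}" using 0 by auto
  then show ?case by simp
next
  case (Suc n)
  show ?case
  proof (cases "W = {}")
    case False
    then obtain w where w: "w \<in> W" by blast
    define q where "q = synthetic_div p w"
    have p: "p = [:- w, 1:] * q + [:poly p w:]"
      using synthetic_div_correct'[of w p] by (simp add: q_def)
    have deg: "degree q = n" using Suc.hyps(2) by (simp add: q_def degree_synthetic_div)
    have "coeff p (Suc n) = coeff q n"
      by (subst p) (simp add: coeff_eq_0 deg)
    then have "s (lead_coeff q) \<noteq> 0" using Suc.prems(1) Suc.hyps(2) deg by simp
    moreover have "s (poly q v) = 0" if v: "v \<in> W - {w}" for v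
    proof -
      have "poly p v = (v - w) * poly q v + poly p w" by (subst p) (simp add: algebra_simps)
      then have "s (poly p v) = s (v - w) * s (poly q v)"
        using Suc.prems(3)[OF w] by (simp add: add_null mult)
      then show ?thesis using Suc.prems(3,4) v w by simp
    qed
    ultimately have "card (W - {w}) \<le> degree q"
      using Suc.prems by (intro Suc.hyps(1)) (auto simp: deg)
    then show ?thesis using deg Suc.hyps(2) w Suc.prems(2) by (simp add: card_Diff_singleton)
  qed simp
qed

lemma poly_cong: "s (x - y) = 0 \<Longrightarrow> s (poly p x) = s (poly p y)"
proof (rule cong_null)
  assume "s (x - y) = 0"
  have "poly p x = poly ([:- y, 1:] * synthetic_div p y + [:poly p y:]) x"
    by (simp only: synthetic_div_correct')
  then have "poly p x - poly p y = (x - y) * poly (synthetic_div p y) x"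
    by (simp add: algebra_simps)
  then show "s (poly p x - poly p y) = 0" using \<open>s (x - y) = 0\<close> by (simp add: mult)
qed

lemma real_constant_sign:
  assumes c: "ring_hom (c :: real \<Rightarrow> 'a)"
  shows "s (c r) = sgn r"
proof -
  have pos: "s (c r) = 1" if r: "0 < r" for r
  proof -
    have "s (c r) * s (c (1 / r)) = 1"
      using r by (simp add: ring_homD(2)[OF c] flip: mult ring_homD(4)[OF c])
    moreover have "c r = (c (sqrt r))\<^sup>2"
      using r by (simp flip: ring_homD(7)[OF c])
    then have "0 \<le> s (c r)" using square_nonneg by simp
    ultimately show ?thesis using sgn_values[of "c r"] by auto
  qed
  then show ?thesis
    using pos[of r] pos[of "- r"] ring_homD(1)[OF c] ring_homD(5)[OF c, of r]
    by (cases "0 < r"; cases "r < 0") auto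
qed

end

section \<open>From sign rings to sign charts\<close>

text \<open>
  In a sign ring that contains the real numbers and has the intermediate value property for the
  family, all conditions of a sign line hold; monotonicity comes from the quadrature formula.
\<close>

lemma sign_line_of_sign_ring:
  fixes s :: "'b::idom \<Rightarrow> real" and \<phi> :: "'a::idom \<Rightarrow> 'b" and c :: "real \<Rightarrow> 'b"
  assumes s: "sign_ring s" and c: "ring_hom c" and \<phi>: "ring_hom \<phi>" and ends: "0 < s (hi - lo)"
    and ivt: "\<And>f x y. f \<in> C \<Longrightarrow> 0 < s (y - x) \<Longrightarrow> s (poly (map_poly \<phi> f) x) * s (poly (map_poly \<phi> f) y) < 0
      \<Longrightarrow> \<exists>z. 0 < s (z - x) \<and> 0 < s (y - z) \<and> s (poly (map_poly \<phi> f) z) = 0"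
  shows "sign_line (\<lambda>x y. 0 < s (y - x)) (\<lambda>f x. s (poly (map_poly \<phi> f) x)) lo hi C pderiv degree"
proof -
  interpret sign_ring s by fact
  have sc: "s (c r) = sgn r" for r by (rule real_constant_sign[OF c])
  have half: "c (1 / 2) * (2 * a) = a" for a
  proof -
    have "c (1 / 2) * 2 = c (1 / 2 + 1 / 2)" by (simp only: ring_homD(3)[OF c]) simp
    then have "c (1 / 2) * 2 = 1" by (simp add: ring_homD(2)[OF c])
    then show ?thesis by (metis mult.assoc mult_1)
  qed
  have tr: "0 < s (z - x)" if "0 < s (y - x)" "0 < s (z - y)" for x y z
    using add_pos[of "y - x" "z - y"] that by simp
  show ?thesis
  proof
    fix x y z :: 'b and f
    show "\<not> 0 < s (x - x)" by simp
    show "0 < s (y - x) \<Longrightarrow> 0 < s (z - y) \<Longrightarrow> 0 < s (z - x)" by (rule tr)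
    show "0 < s (y - x) \<or> 0 < s (z - y)" if "0 < s (z - x)"
    proof (rule ccontr)
      assume *: "\<not> ?thesis"
      then have "0 \<le> s (x - y)" "0 \<le> s (y - z)" using minus[of "x - y"] minus[of "y - z"] by simp_all
      then have "0 \<le> s (x - z)" using add_nonneg[of "x - y" "y - z"] by simp
      then show False using that minus[of "x - z"] by simp
    qed
    show "0 < s (hi - lo)" by (rule ends)
    show "\<exists>z. 0 < s (z - x) \<and> 0 < s (y - z)" if "0 < s (y - x)"
    proof -
      let ?m = "c (1 / 2) * (x + y)"
      have "?m - x = c (1 / 2) * (y - x)" "y - ?m = c (1 / 2) * (y - x)"
        using half[of x] half[of y] by (simp_all add: algebra_simps)
      then show ?thesis using that by (intro exI[of _ ?m]) (simp add: mult sc)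
    qed
    show "s (poly (map_poly \<phi> f) x) = -1 \<or> s (poly (map_poly \<phi> f) x) = 0 \<or> s (poly (map_poly \<phi> f) x) = 1"
      by (rule sgn_values)
    show "s (poly (map_poly \<phi> f) x) = s (poly (map_poly \<phi> f) y)"
      if "\<not> 0 < s (y - x)" "\<not> 0 < s (x - y)"
      using that minus[of "x - y"] by (intro poly_cong) simp
    show "\<exists>z. 0 < s (z - x) \<and> 0 < s (y - z) \<and> s (poly (map_poly \<phi> f) z) = 0"
      if "f \<in> C" "0 < s (y - x)" "s (poly (map_poly \<phi> f) x) * s (poly (map_poly \<phi> f) y) < 0"
      using ivt that .
    show "(0 \<le> d * s (poly (map_poly \<phi> f) x) \<longrightarrow> 0 < d * s (poly (map_poly \<phi> f) y)) \<and>
        (d * s (poly (map_poly \<phi> f) y) \<le> 0 \<longrightarrow> d * s (poly (map_poly \<phi> f) x) < 0)"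
      if xy: "0 < s (y - x)" and d: "d \<noteq> 0"
        and der: "\<And>z. 0 < s (z - x) \<Longrightarrow> 0 < s (y - z) \<Longrightarrow> s (poly (map_poly \<phi> (pderiv f)) z) = d" for d
    proof -
      define p where "p = map_poly \<phi> f"
      have pd: "map_poly \<phi> (pderiv f) = pderiv p" unfolding p_def by (rule map_poly_hom_pderiv[OF \<phi>])
      define n where "n = Suc (degree p)"
      obtain w \<xi> :: "nat \<Rightarrow> real" where w: "\<And>k. k < n \<Longrightarrow> 0 < w k"
        and \<xi>: "\<And>k. k < n \<Longrightarrow> - 1 < \<xi> k \<and> \<xi> k < 1"
        and mom: "\<And>j. j < n \<Longrightarrow> (\<Sum>k<n. w k * \<xi> k ^ j) = (1 - (- 1) ^ Suc j) / real (Suc j)"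
        using positive_quadrature[of n] unfolding n_def by auto
      define m where "m = c (1 / 2) * (x + y)"
      define h where "h = c (1 / 2) * (y - x)"
      have mh: "m + h = y" "m - h = x" using half[of x] half[of y] by (simp_all add: m_def h_def algebra_simps)
      have h: "s h = 1" using xy by (simp add: h_def mult sc pos_iff)
      define z where "z k = m + c (\<xi> k) * h" for k
      have zx: "s (z k - x) = 1" and yz: "s (y - z k) = 1" if "k < n" for k
      proof -
        have "z k - x = c (1 + \<xi> k) * h" "y - z k = c (1 - \<xi> k) * h"
          by (simp_all add: z_def ring_homD[OF c] algebra_simps flip: mh)
        then show "s (z k - x) = 1" "s (y - z k) = 1" using \<xi>[OF that] h by (simp_all add: mult sc)
      qed
      have vals: "s (poly (pderiv p) (z k)) = d" if "k < n" for k
        using der[of "z k"] zx[OF that] yz[OF that] by (simp add: pd)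
      have quad: "poly p y - poly p x = h * (\<Sum>k<n. c (w k) * poly (pderiv p) (z k))"
        using poly_diff_quadrature[OF c, of p n w \<xi> m h] mom by (simp add: mh z_def n_def)
      have d1: "d = 1 \<or> d = -1" using vals[of 0] d sgn_values[of "poly (pderiv p) (z 0)"] by (auto simp: n_def)
      \<comment> \<open>Multiplication by e turns the sign d of the derivative into 1, so that both cases are treated at once.\<close>
      define e :: 'b where "e = (if d = 1 then 1 else - 1)"
      have se: "s (e * t) = d * s t" for t using d1 by (auto simp: e_def mult)
      have "e * (poly p y - poly p x) = h * (\<Sum>k<n. e * (c (w k) * poly (pderiv p) (z k)))"
        unfolding quad by (simp add: sum_distrib_left ac_simps)
      moreover have "0 < s (\<Sum>k<n. e * (c (w k) * poly (pderiv p) (z k)))"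
      proof (rule sum_pos)
        show "0 < s (e * (c (w k) * poly (pderiv p) (z k)))" if "k \<in> {..<n}" for k
        proof -
          have "s (e * (c (w k) * poly (pderiv p) (z k))) = d * d"
            using that w[of k] vals[of k] by (subst se) (simp add: mult sc)
          then show ?thesis using d1 by auto
        qed
      qed (auto simp: n_def)
      ultimately have diff: "0 < s (e * (poly p y - poly p x))" using h by (simp add: mult)
      have "0 < s (e * poly p y)" if "0 \<le> s (e * poly p x)"
        using add_pos[OF diff that] by (simp add: algebra_simps)
      moreover have "s (e * poly p x) < 0" if "s (e * poly p y) \<le> 0"
        using add_pos[OF diff, of "- (e * poly p y)"] that minus[of "e * poly p x"]
        by (simp add: algebra_simps)
      ultimately show ?thesis unfolding se p_def by blast
    qed
  qed
qed

context sign_ring begin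

text \<open>
  The leading coefficient, if there is one, does not vanish under the sign function; then the degree
  is the true degree also on the real side, where coefficients of sign zero become zero.
\<close>

definition tight :: "'a poly \<Rightarrow> bool" where
  "tight f \<longleftrightarrow> f = 0 \<or> s (lead_coeff f) \<noteq> 0"

lemma tight_remainder:
  assumes S: "subring_set S" and f: "\<And>i. coeff f i \<in> S" and g: "\<And>i. coeff g i \<in> S" "0 < degree g"
  shows "\<exists>r z. (\<forall>i. coeff r i \<in> S) \<and> tight r \<and> degree r < degree g \<and> (\<forall>i. coeff z i \<in> S) \<and> null_poly z \<and>
    (\<exists>k q. smult (lead_coeff g ^ k) f = q * g + r + z)"
proof -
  obtain k q r where *: "smult (lead_coeff g ^ k) f = q * g + r" "degree r < degree g" "\<forall>i. coeff r i \<in> S"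
    using pseudo_division[OF S _ g(1) f] g(2) by fastforce
  obtain n where n: "null_poly (r - poly_cutoff n r)"
    "poly_cutoff n r = 0 \<or> s (lead_coeff (poly_cutoff n r)) \<noteq> 0"
    "degree (poly_cutoff n r) \<le> degree r"
    by (rule truncation)
  have "smult (lead_coeff g ^ k) f = q * g + poly_cutoff n r + (r - poly_cutoff n r)"
    using *(1) by simp
  moreover have "coeff (poly_cutoff n r) i \<in> S" "coeff (r - poly_cutoff n r) i \<in> S" for i
    using *(3) subring_setD[OF S] by (auto simp: coeff_poly_cutoff)
  ultimately show ?thesis using n * unfolding tight_def by (meson le_less_trans)
qed

end

lemma tight_pderiv:
  fixes s :: "'a::idom \<Rightarrow> real"
  assumes s: "sign_ring s" and S: "subring_set S"
    and f: "sign_ring.tight s f" "0 < degree f" "\<And>i. coeff f i \<in> S"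
  shows "sign_ring.tight s (pderiv f)" "degree (pderiv f) < degree f" "coeff (pderiv f) i \<in> S"
    "s (lead_coeff (pderiv f)) \<noteq> 0"
proof -
  interpret sign_ring s by fact
  have lc: "coeff (pderiv f) (degree f - 1) = of_nat (degree f) * lead_coeff f"
    using f(2) by (simp add: coeff_pderiv)
  have nz: "s (coeff (pderiv f) (degree f - 1)) \<noteq> 0"
  proof -
    have "s (coeff (pderiv f) (degree f - 1)) = s (lead_coeff f)"
      by (simp only: lc mult of_nat_pos[OF f(2)] mult_1)
    then show ?thesis using f(1,2) by (auto simp: tight_def)
  qed
  have le: "degree (pderiv f) \<le> degree f - 1"
    by (rule degree_le) (auto simp: coeff_pderiv coeff_eq_0)
  moreover have "degree f - 1 \<le> degree (pderiv f)"
    using nz by (intro le_degree) auto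
  ultimately have deg: "degree (pderiv f) = degree f - 1" by simp
  show "degree (pderiv f) < degree f" using deg f(2) by simp
  show "s (lead_coeff (pderiv f)) \<noteq> 0" using nz deg by simp
  then show "tight (pderiv f)" by (simp add: tight_def)
  have "of_nat n \<in> S" for n by (induction n) (auto intro: subring_setD[OF S])
  then show "coeff (pderiv f) i \<in> S"
    using f(3) subring_setD(4)[OF S] unfolding coeff_pderiv by blast
qed

text \<open>
  Closure under derivatives and pseudo-remainders as far as it concerns polynomials of degree less
  than \<open>k\<close>. Remainders are truncated, and the truncated parts are collected in \<open>N\<close>: the real point
  constructed later has to make them vanish, so their coefficients must be known in advance.
\<close>

definition closed_family :: "('a::idom \<Rightarrow> real) \<Rightarrow> 'a set \<Rightarrow> 'a poly set \<Rightarrow> 'a poly set \<Rightarrow> nat \<Rightarrow> bool" where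
  "closed_family s S C N k \<longleftrightarrow> finite C \<and> finite N \<and>
    (\<forall>f\<in>C. sign_ring.tight s f \<and> (\<forall>i. coeff f i \<in> S)) \<and>
    (\<forall>z\<in>N. sign_ring.null_poly s z \<and> (\<forall>i. coeff z i \<in> S)) \<and>
    (\<forall>f\<in>C. 0 < degree f \<longrightarrow> degree f < k \<longrightarrow> pderiv f \<in> C) \<and>
    (\<forall>f\<in>C. \<forall>g\<in>C. 0 < degree g \<longrightarrow> degree g < k \<longrightarrow> degree g \<le> degree f \<longrightarrow>
      (\<exists>r\<in>C. degree r < degree g \<and> (\<exists>z\<in>N. \<exists>m q. smult (lead_coeff g ^ m) f = q * g + r + z)))"

text \<open>
  Remainders and derivatives at level \<open>k\<close> have degree less than \<open>k\<close>, and no later step adds polynomials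
  of degree \<open>k\<close> or more. So treating the levels in decreasing order terminates.
\<close>

lemma closed_family_exists:
  fixes s :: "'a::idom \<Rightarrow> real"
  assumes s: "sign_ring s" and S: "subring_set S"
    and A: "finite A" "\<And>f. f \<in> A \<Longrightarrow> sign_ring.tight s f" "\<And>f i. f \<in> A \<Longrightarrow> coeff f i \<in> S"
  shows "\<exists>C N. closed_family s S C N k \<and> A \<subseteq> C \<and> (\<forall>f\<in>C - A. degree f < k)"
  using A
proof (induction k arbitrary: A)
  case 0
  then have "closed_family s S A {} 0" by (auto simp: closed_family_def)
  then show ?case by blast
next
  case (Suc k)
  interpret sign_ring s by fact
  define ok where "ok f \<longleftrightarrow> tight f \<and> (\<forall>i. coeff f i \<in> S)" for f
  have "\<forall>f g. ok f \<and> ok g \<and> 0 < degree g \<longrightarrow> (\<exists>r z. ok r \<and> degree r < degree g \<and>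
      (\<forall>i. coeff z i \<in> S) \<and> null_poly z \<and> (\<exists>m q. smult (lead_coeff g ^ m) f = q * g + r + z))"
    using tight_remainder[OF S] unfolding ok_def by meson
  then obtain R Z where RZ: "\<And>f g. ok f \<Longrightarrow> ok g \<Longrightarrow> 0 < degree g \<Longrightarrow> ok (R f g) \<and> degree (R f g) < degree g \<and>
      (\<forall>i. coeff (Z f g) i \<in> S) \<and> null_poly (Z f g) \<and>
      (\<exists>m q. smult (lead_coeff g ^ m) f = q * g + R f g + Z f g)"
    by metis
  have okA: "ok f" if "f \<in> A" for f using Suc.prems that by (simp add: ok_def)
  define P where "P = {(f, g) \<in> A \<times> A. 0 < degree g \<and> degree g = k}"
  define A' where "A' = A \<union> (\<lambda>(f, g). R f g) ` P \<union> pderiv ` {f \<in> A. 0 < degree f \<and> degree f = k}"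
  have finP: "finite P" using Suc.prems(1) by (auto simp: P_def)
  have new: "degree f < k" if "f \<in> A' - A" for f
    using that RZ okA tight_pderiv(2)[OF s S] by (auto simp: A'_def P_def ok_def)
  have okA': "ok f" if "f \<in> A'" for f
    using that RZ okA tight_pderiv(1,3)[OF s S] by (auto simp: A'_def P_def ok_def)
  have "\<exists>C N. closed_family s S C N k \<and> A' \<subseteq> C \<and> (\<forall>f\<in>C - A'. degree f < k)"
    using okA' finP Suc.prems(1) by (intro Suc.IH) (auto simp: ok_def A'_def)
  then obtain C N where CN: "closed_family s S C N k" "A' \<subseteq> C" "\<And>f. f \<in> C - A' \<Longrightarrow> degree f < k"
    by blast
  have old: "f \<in> A" if "f \<in> C" "k \<le> degree f" for f
    using CN(3)[of f] new[of f] that by fastforce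
  define N' where "N' = N \<union> (\<lambda>(f, g). Z f g) ` P"
  have "closed_family s S C N' (Suc k)"
    unfolding closed_family_def
  proof (intro conjI ballI impI)
    show "finite C" "finite N'" using CN(1) finP by (auto simp: closed_family_def N'_def)
    show "tight f" "\<forall>i. coeff f i \<in> S" if "f \<in> C" for f using CN(1) that by (auto simp: closed_family_def)
    show "null_poly z" "\<forall>i. coeff z i \<in> S" if "z \<in> N'" for z
      using CN(1) that RZ okA by (auto simp: closed_family_def N'_def P_def)
    show "pderiv f \<in> C" if f: "f \<in> C" "0 < degree f" "degree f < Suc k" for f
    proof (cases "degree f < k")
      case True
      then show ?thesis using CN(1) f by (auto simp: closed_family_def)
    next
      case False
      then have "pderiv f \<in> A'" using f old[of f] by (auto simp: A'_def)
      then show ?thesis using CN(2) by blast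
    qed
    show "\<exists>r\<in>C. degree r < degree g \<and> (\<exists>z\<in>N'. \<exists>m q. smult (lead_coeff g ^ m) f = q * g + r + z)"
      if fg: "f \<in> C" "g \<in> C" "0 < degree g" "degree g < Suc k" "degree g \<le> degree f" for f g
    proof (cases "degree g < k")
      case True
      then have "\<exists>r\<in>C. degree r < degree g \<and> (\<exists>z\<in>N. \<exists>m q. smult (lead_coeff g ^ m) f = q * g + r + z)"
        using CN(1) fg by (simp add: closed_family_def)
      then show ?thesis unfolding N'_def by blast
    next
      case False
      then have *: "f \<in> A" "g \<in> A" "(f, g) \<in> P" using fg old by (auto simp: P_def)
      then have "R f g \<in> C" "Z f g \<in> N'" using CN(2) by (force simp: A'_def N'_def)+
      then show ?thesis using RZ[OF okA[OF *(1)] okA[OF *(2)] fg(3)] by blast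
    qed
  qed
  moreover have "A \<subseteq> C" using CN(2) by (auto simp: A'_def)
  moreover have "degree f < Suc k" if "f \<in> C - A" for f
    using CN(3)[of f] new[of f] that by (cases "f \<in> A'") (auto simp: less_Suc_eq)
  ultimately show ?case by blast
qed

lemma real_sign_at_infinity:
  fixes p :: "real poly"
  assumes "p \<noteq> 0"
  shows "\<exists>n. \<forall>x\<ge>n. sgn (poly p x) = sgn (lead_coeff p)"
proof (cases "0 < lead_coeff p")
  case True
  obtain n where "\<forall>x\<ge>n. lead_coeff p \<le> poly p x" using poly_pinfty_gt_lc[OF True] by blast
  then show ?thesis using True by (intro exI[of _ n]) (auto simp: sgn_if)
next
  case False
  then have neg: "0 < lead_coeff (- p)" using assms by (simp add: not_less less_le)
  obtain n where "\<forall>x\<ge>n. lead_coeff (- p) \<le> poly (- p) x" using poly_pinfty_gt_lc[OF neg] by blast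
  then show ?thesis using neg by (intro exI[of _ n]) (fastforce simp: sgn_if)
qed

lemma real_bound:
  fixes Q :: "real poly set"
  assumes "finite Q" "0 \<notin> Q"
  obtains b where "0 < b" "\<And>p. p \<in> Q \<Longrightarrow> sgn (poly p b) = sgn (lead_coeff p)"
    "\<And>p. p \<in> Q \<Longrightarrow> sgn (poly p (- b)) = (- 1) ^ degree p * sgn (lead_coeff p)"
proof -
  have "\<exists>b>0. \<forall>p\<in>Q. \<forall>x\<ge>b. sgn (poly p x) = sgn (lead_coeff p) \<and>
      sgn (poly p (- x)) = (- 1) ^ degree p * sgn (lead_coeff p)"
    using assms
  proof (induction Q rule: finite_induct)
    case empty
    then show ?case by (intro exI[of _ 1]) auto
  next
    case (insert p Q)
    then obtain b where b: "0 < b" "\<forall>p\<in>Q. \<forall>x\<ge>b. sgn (poly p x) = sgn (lead_coeff p) \<and>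
      sgn (poly p (- x)) = (- 1) ^ degree p * sgn (lead_coeff p)" by auto
    have p: "p \<noteq> 0" using insert.prems by auto
    obtain n where n: "\<forall>x\<ge>n. sgn (poly p x) = sgn (lead_coeff p)" using real_sign_at_infinity[OF p] by blast
    let ?q = "pcompose p [:0, - 1:]"
    have lq: "lead_coeff ?q = lead_coeff p * (- 1) ^ degree p"
      using lead_coeff_comp[of "[:0, - 1:]" p] by simp
    have "?q \<noteq> 0" using lq p by (metis leading_coeff_0_iff mult_eq_0_iff power_not_zero zero_neq_neg_one)
    then obtain m where m: "\<forall>x\<ge>m. sgn (poly ?q x) = sgn (lead_coeff ?q)" using real_sign_at_infinity by blast
    have "sgn (poly p (- x)) = (- 1) ^ degree p * sgn (lead_coeff p)" if "x \<ge> m" for x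
    proof -
      have "poly ?q x = poly p (- x)" by (simp add: poly_pcompose)
      moreover have "sgn ((- 1 :: real) ^ degree p) = (- 1) ^ degree p" by (cases "even (degree p)") auto
      ultimately show ?thesis using m that lq by (metis sgn_mult mult.commute)
    qed
    then show ?case using n b by (intro exI[of _ "max b (max n m)"]) auto
  qed
  then show ?thesis using that by blast
qed

text \<open>
  The univariate heart of the argument. Every sign vector that the family \<open>C\<close> takes at a point of an
  ordered extension \<open>\<phi>\<close> of the coefficient ring is also taken at a real point, after the coefficients
  have been specialised to real numbers by a homomorphism \<open>\<psi>\<close> that respects the signs of the finitely
  many coefficients involved. At \<open>\<omega>\<close> and \<open>- \<omega>\<close> the members of \<open>C\<close> have the signs that they have at
  infinity; on the real side a common bound \<open>b\<close> for all roots plays this part.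
\<close>

theorem univariate_transfer:
  fixes \<sigma> :: "'a::idom \<Rightarrow> real" and \<phi> :: "'a \<Rightarrow> 'b::idom" and s :: "'b \<Rightarrow> real" and \<psi> :: "'a \<Rightarrow> real"
  assumes \<sigma>: "sign_ring \<sigma>" and CN: "closed_family \<sigma> S C N k" "\<And>f. f \<in> C \<Longrightarrow> degree f < k"
    and s: "sign_ring s" and c: "ring_hom (c :: real \<Rightarrow> 'b)" and \<phi>: "ring_hom \<phi>" and s\<phi>: "\<And>a. s (\<phi> a) = \<sigma> a"
    and ivt: "\<And>f x y. f \<in> C \<Longrightarrow> 0 < s (y - x) \<Longrightarrow> s (poly (map_poly \<phi> f) x) * s (poly (map_poly \<phi> f) y) < 0
      \<Longrightarrow> \<exists>z. 0 < s (z - x) \<and> 0 < s (y - z) \<and> s (poly (map_poly \<phi> f) z) = 0"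
    and \<omega>: "\<And>f. f \<in> C \<Longrightarrow> f \<noteq> 0 \<Longrightarrow> s (poly (map_poly \<phi> f) \<omega>) = \<sigma> (lead_coeff f)"
      "\<And>f. f \<in> C \<Longrightarrow> f \<noteq> 0 \<Longrightarrow> s (poly (map_poly \<phi> f) (- \<omega>)) = (- 1) ^ degree f * \<sigma> (lead_coeff f)"
    and \<omega>_pos: "0 < s (\<omega> - - \<omega>)"
    and x: "0 \<le> s (x - - \<omega>)" "0 \<le> s (\<omega> - x)"
    and \<psi>: "ring_hom \<psi>" "\<And>f i. f \<in> C \<union> N \<Longrightarrow> sgn (\<psi> (coeff f i)) = \<sigma> (coeff f i)"
  shows "\<exists>y. \<forall>f\<in>C. s (poly (map_poly \<phi> f) x) = sgn (poly (map_poly \<psi> f) y)"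
proof -
  interpret \<sigma>: sign_ring \<sigma> by fact
  interpret s: sign_ring s by fact
  have S: "subring_set (UNIV :: 'a set)" by (simp add: subring_set_def)
  have fin: "finite C" using CN(1) by (simp add: closed_family_def)
  have tight: "\<sigma>.tight f" if "f \<in> C" for f using CN(1) that by (auto simp: closed_family_def)
  have deg: "degree (map_poly \<psi> f) = degree f" and lead: "sgn (lead_coeff (map_poly \<psi> f)) = \<sigma> (lead_coeff f)"
    if f: "f \<in> C" "f \<noteq> 0" for f
  proof -
    have "\<psi> (lead_coeff f) \<noteq> 0" using \<psi>(2)[of f "degree f"] f tight[OF f(1)] by (auto simp: \<sigma>.tight_def)
    then show "degree (map_poly \<psi> f) = degree f"
      by (rule map_poly_degree_eq)
    then show "sgn (lead_coeff (map_poly \<psi> f)) = \<sigma> (lead_coeff f)"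
      using \<psi>(2)[of f "degree f"] f by (simp add: map_poly_hom(1)[OF \<psi>(1)])
  qed
  have nz: "map_poly \<psi> f \<noteq> 0" if f: "f \<in> C" "f \<noteq> 0" for f
    using lead[OF f] tight[OF f(1)] f(2) by (auto simp: \<sigma>.tight_def)
  let ?Q = "map_poly \<psi> ` (C - {0})"
  have "finite ?Q" using fin by auto
  moreover have "0 \<notin> ?Q"
  proof
    assume "0 \<in> ?Q"
    then obtain f where "f \<in> C" "f \<noteq> 0" "map_poly \<psi> f = 0" by force
    then show False using nz by blast
  qed
  ultimately obtain b where b: "0 < b" "\<And>p. p \<in> ?Q \<Longrightarrow> sgn (poly p b) = sgn (lead_coeff p)"
    "\<And>p. p \<in> ?Q \<Longrightarrow> sgn (poly p (- b)) = (- 1) ^ degree p * sgn (lead_coeff p)"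
    by (rule real_bound) blast
  have lift_rem: "t (poly (map_poly h f) u) * \<sigma> (lead_coeff g) ^ m = t (poly (map_poly h r) u)"
    if t: "sign_ring t" and h: "ring_hom h" and th: "\<And>f i. f \<in> C \<union> N \<Longrightarrow> t (h (coeff f i)) = \<sigma> (coeff f i)"
      and fg: "f \<in> C" "g \<in> C" "z \<in> N" "smult (lead_coeff g ^ m) f = q * g + r + z"
      and u: "t (poly (map_poly h g) u) = 0"
    for t :: "'c::idom \<Rightarrow> real" and h :: "'a \<Rightarrow> 'c" and f g r z q m u
  proof -
    interpret t: sign_ring t by fact
    have "\<sigma>.null_poly z" using CN(1) fg(3) by (auto simp: closed_family_def)
    then have "t.null_poly (map_poly h z)"
      using th[of z] fg(3) by (simp add: \<sigma>.null_poly_def t.null_poly_def map_poly_hom(1)[OF h])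
    then have z0: "t (poly (map_poly h z) u) = 0" by (rule t.null_poly_eval)
    have "map_poly h (smult (lead_coeff g ^ m) f) = map_poly h (q * g + r + z)" by (simp only: fg(4))
    then have "smult (h (lead_coeff g) ^ m) (map_poly h f) = map_poly h q * map_poly h g + map_poly h r + map_poly h z"
      by (simp only: map_poly_hom(4,5,6)[OF h] ring_homD(7)[OF h])
    from arg_cong[OF this, of "\<lambda>p. t (poly p u)"]
    have "t (h (lead_coeff g)) ^ m * t (poly (map_poly h f) u)
      = t (poly (map_poly h q) u * poly (map_poly h g) u + poly (map_poly h r) u)"
      by (simp add: t.mult t.power t.add_null[OF z0])
    also have "\<dots> = t (poly (map_poly h r) u)"
      using u t.add_null[of "poly (map_poly h q) u * poly (map_poly h g) u" "poly (map_poly h r) u"]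
      by (simp add: t.mult add.commute)
    finally show ?thesis using th[of g "degree g"] fg(2) by (simp add: mult.commute)
  qed
  have const: "t (poly (map_poly h f) u) = \<sigma> (coeff f 0)"
    if h: "ring_hom h" "\<And>i. t (h (coeff f i)) = \<sigma> (coeff f i)" "degree f = 0"
    for t :: "'c::idom \<Rightarrow> real" and h :: "'a \<Rightarrow> 'c" and f u
  proof -
    obtain a where "f = [:a:]" using h(3) by (metis degree_eq_zeroE)
    then show ?thesis using h(2)[of 0] by (simp add: map_poly_hom(2)[OF h(1)])
  qed
  have hom_real: "ring_hom (\<lambda>r::real. r)" by (simp add: ring_hom_def)
  interpret L1: sign_line "\<lambda>x y. 0 < s (y - x)" "\<lambda>f x. s (poly (map_poly \<phi> f) x)" "- \<omega>" \<omega> C pderiv degree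
    by (rule sign_line_of_sign_ring[OF s c \<phi> \<omega>_pos ivt])
  interpret L2: sign_line "\<lambda>x y. 0 < sgn (y - x)" "\<lambda>f x. sgn (poly (map_poly \<psi> f) x)" "- b" b C pderiv degree
  proof (rule sign_line_of_sign_ring[OF sign_ring_sgn hom_real \<psi>(1)])
    show "0 < sgn (b - - b)" using b(1) by simp
    show "\<exists>z. 0 < sgn (z - x) \<and> 0 < sgn (y - z) \<and> sgn (poly (map_poly \<psi> f) z) = 0"
      if "0 < sgn (y - x)" "sgn (poly (map_poly \<psi> f) x) * sgn (poly (map_poly \<psi> f) y) < 0" for f x y
      using poly_IVT[of x y "map_poly \<psi> f"] that by (force simp: sgn_mult[symmetric])
  qed
  interpret two_sign_lines "\<lambda>x y. 0 < s (y - x)" "\<lambda>f x. s (poly (map_poly \<phi> f) x)" "- \<omega>" \<omega>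
    "\<lambda>x y. 0 < sgn (y - x)" "\<lambda>f x. sgn (poly (map_poly \<psi> f) x)" "- b" b C pderiv degree
  proof
    fix f assume f: "f \<in> C"
    note \<psi>f = \<psi>(2)[of f]
    show "s (poly (map_poly \<phi> f) u) = sgn (poly (map_poly \<psi> f) v)" if "degree f = 0" for u v
      using const[OF \<phi>, of s f u] const[OF \<psi>(1), of sgn f v] that f \<psi>f s\<phi> by simp
    show "pderiv f \<in> C \<and> degree (pderiv f) < degree f" if "0 < degree f"
      using CN f that tight_pderiv(2)[OF \<sigma> S tight[OF f] that] by (auto simp: closed_family_def)
    show "s (poly (map_poly \<phi> (pderiv f)) u) \<noteq> 0" if "0 < degree f" "degree (pderiv f) = 0" for u
      using const[OF \<phi>, of s "pderiv f" u] that s\<phi> tight_pderiv(4)[OF \<sigma> S tight[OF f] that(1)] by simp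
    show "\<exists>r\<in>C. degree r < degree g \<and> (\<exists>k. k \<noteq> 0 \<and>
         (\<forall>x. s (poly (map_poly \<phi> g) x) = 0 \<longrightarrow> s (poly (map_poly \<phi> f) x) * k = s (poly (map_poly \<phi> r) x)) \<and>
         (\<forall>y. sgn (poly (map_poly \<psi> g) y) = 0 \<longrightarrow> sgn (poly (map_poly \<psi> f) y) * k = sgn (poly (map_poly \<psi> r) y)))"
      if g: "g \<in> C" "0 < degree g" "degree g \<le> degree f" for g
    proof -
      obtain r z m q where r: "r \<in> C" "degree r < degree g" "z \<in> N" "smult (lead_coeff g ^ m) f = q * g + r + z"
        using CN g f unfolding closed_family_def by metis
      have "\<sigma> (lead_coeff g) ^ m \<noteq> 0" using tight[OF g(1)] g(2) by (auto simp: \<sigma>.tight_def)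
      then show ?thesis
        using r lift_rem[OF s \<phi> s\<phi> f g(1) r(3,4)] lift_rem[OF sign_ring_sgn \<psi>(1) \<psi>(2) f g(1) r(3,4)]
        by (intro bexI[of _ r] conjI exI[of _ "\<sigma> (lead_coeff g) ^ m"]) auto
    qed
    show "s (poly (map_poly \<phi> f) (- \<omega>)) = sgn (poly (map_poly \<psi> f) (- b))"
      using \<omega>(2)[OF f] b(3)[of "map_poly \<psi> f"] f lead[OF f] deg[OF f] by (cases "f = 0") auto
    show "s (poly (map_poly \<phi> f) \<omega>) = sgn (poly (map_poly \<psi> f) b)"
      using \<omega>(1)[OF f] b(2)[of "map_poly \<psi> f"] f lead[OF f] by (cases "f = 0") auto
  qed
  have "s (- \<omega> - x) = - s (x - - \<omega>)" "s (x - \<omega>) = - s (\<omega> - x)"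
    using s.minus[of "x - - \<omega>"] s.minus[of "\<omega> - x"] by (simp_all only: minus_diff_eq)
  then have "x \<in> L1.dom"
    using x by (simp add: L1.dom_def not_less)
  moreover have "finite {y. sgn (poly (map_poly \<psi> f) y) = 0}" if "f \<in> C" "0 < degree f" for f
    using poly_roots_finite[OF nz[OF that(1)]] that by (cases "f = 0") (auto simp: sgn_zero_iff)
  ultimately show ?thesis using sign_vectors_transfer fin by blast
qed

section \<open>Real points with prescribed signs\<close>

text \<open>
  The element \<open>\<omega>\<close> exceeds everything in the image of \<open>\<phi>\<close>, expressed by the signs of polynomials at \<open>\<omega>\<close>
  and \<open>- \<omega>\<close>.
\<close>

definition end_point :: "(nat_mpoly \<Rightarrow> real) \<Rightarrow> (nat_mpoly \<Rightarrow> nat_mpoly) \<Rightarrow> (nat_mpoly \<Rightarrow> real) \<Rightarrow> nat_mpoly \<Rightarrow> bool" where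
  "end_point \<sigma> \<phi> s \<omega> \<longleftrightarrow> (\<forall>f. \<sigma> (lead_coeff f) \<noteq> 0 \<longrightarrow>
     s (poly (map_poly \<phi> f) \<omega>) = \<sigma> (lead_coeff f) \<and>
     s (poly (map_poly \<phi> f) (- \<omega>)) = (- 1) ^ degree f * \<sigma> (lead_coeff f))"

definition extension :: "(nat_mpoly \<Rightarrow> real) \<Rightarrow> (nat_mpoly \<Rightarrow> nat_mpoly) \<Rightarrow> (nat_mpoly \<Rightarrow> real) \<Rightarrow> nat_mpoly \<Rightarrow> bool" where
  "extension \<sigma> \<phi> s \<omega> \<longleftrightarrow> ring_hom \<phi> \<and> sign_ring s \<and> (\<forall>a. s (\<phi> a) = \<sigma> a) \<and> end_point \<sigma> \<phi> s \<omega>"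

definition root_set :: "(nat_mpoly \<Rightarrow> real) \<Rightarrow> nat_mpoly poly \<Rightarrow> nat_mpoly set \<Rightarrow> bool" where
  "root_set s p W \<longleftrightarrow> finite W \<and> (\<forall>w\<in>W. s (poly p w) = 0) \<and> (\<forall>w\<in>W. \<forall>w'\<in>W. w \<noteq> w' \<longrightarrow> s (w - w') \<noteq> 0)"

lemma map_poly_comp_hom:
  assumes "ring_hom g" "ring_hom h"
  shows "map_poly (g \<circ> h) p = map_poly g (map_poly h p)"
  by (intro poly_eqI) (simp add: map_poly_hom(1)[OF assms(1)] map_poly_hom(1)[OF assms(2)]
      map_poly_hom(1)[OF ring_hom_comp[OF assms]])

lemma extension_comp:
  assumes "extension \<sigma> \<phi> s \<omega>" "ring_hom j" "sign_ring s'" "\<And>a. s' (j a) = s a"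
  shows "extension \<sigma> (j \<circ> \<phi>) s' (j \<omega>)"
proof -
  have \<phi>: "ring_hom \<phi>" using assms(1) by (simp add: extension_def)
  have "s' (poly (map_poly (j \<circ> \<phi>) f) (j a)) = s (poly (map_poly \<phi> f) a)" for f a
    by (simp only: map_poly_comp_hom[OF assms(2) \<phi>] map_poly_hom(7)[OF assms(2)] assms(4))
  from this this[of _ "- \<omega>"] show ?thesis
    using assms by (simp add: extension_def end_point_def ring_hom_comp ring_homD(5)[OF assms(2)])
qed

lemma extension_initial:
  assumes "sign_ring \<sigma>"
  obtains \<phi> s \<omega> where "extension \<sigma> \<phi> s \<omega>"
proof -
  obtain s' y where "sign_ring s'" "\<And>c. s' (shift_vars c) = \<sigma> c"
    "\<And>p. \<sigma> (lead_coeff p) \<noteq> 0 \<Longrightarrow> s' (poly (map_poly shift_vars p) y) = \<sigma> (lead_coeff p)"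
    "\<And>p. \<sigma> (lead_coeff p) \<noteq> 0 \<Longrightarrow> s' (poly (map_poly shift_vars p) (- y)) = (- 1) ^ degree p * \<sigma> (lead_coeff p)"
    using extend_by_infinity[OF assms] by metis
  then have "extension \<sigma> shift_vars s' y"
    by (auto simp: extension_def end_point_def ring_hom_shift_vars)
  then show ?thesis using that by blast
qed

text \<open>
  If a polynomial changes sign without having a root in between, an extension has one more of its
  roots: old roots stay distinct, and the new root differs from them because it lies where there was
  none.
\<close>

lemma extension_new_root:
  assumes ext: "extension \<sigma> \<phi> s \<omega>" and xy: "0 < s (y - x)"
    and change: "s (poly (map_poly \<phi> f) x) * s (poly (map_poly \<phi> f) y) < 0"
    and none: "\<And>z. 0 < s (z - x) \<Longrightarrow> 0 < s (y - z) \<Longrightarrow> s (poly (map_poly \<phi> f) z) \<noteq> 0"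
  obtains \<phi>' s' \<omega>' j z where "extension \<sigma> \<phi>' s' \<omega>'"
    "\<And>g W. root_set s (map_poly \<phi> g) W \<Longrightarrow> root_set s' (map_poly \<phi>' g) (j ` W) \<and> card (j ` W) = card W"
    "\<And>W. root_set s (map_poly \<phi> f) W \<Longrightarrow> root_set s' (map_poly \<phi>' f) (insert z (j ` W)) \<and>
       card (insert z (j ` W)) = Suc (card W)"
proof -
  have \<phi>: "ring_hom \<phi>" and s: "sign_ring s" using ext by (auto simp: extension_def)
  interpret s: sign_ring s by fact
  obtain s' z where s': "sign_ring s'" "\<And>c. s' (shift_vars c) = s c"
    "s' (poly (map_poly shift_vars (map_poly \<phi> f)) z) = 0" "0 \<le> s' (z - shift_vars x)" "0 \<le> s' (shift_vars y - z)"
    by (rule extend_by_root[OF s xy change]) blast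
  interpret s': sign_ring s' by fact
  let ?j = shift_vars
  note j = ring_hom_shift_vars
  have diff: "s' (?j a - ?j b) = s (a - b)" for a b
    using s'(2)[of "a - b"] by (simp add: ring_homD(6)[OF j])
  have ev: "s' (poly (map_poly (?j \<circ> \<phi>) g) (?j a)) = s (poly (map_poly \<phi> g) a)" for g a
    by (simp only: map_poly_comp_hom[OF j \<phi>] map_poly_hom(7)[OF j] s'(2))
  have z: "s' (poly (map_poly (?j \<circ> \<phi>) f) z) = 0"
    using s'(3) by (simp only: map_poly_comp_hom[OF j \<phi>])
  have ne: "s' (z - ?j a) \<noteq> 0" if "s (poly (map_poly \<phi> f) a) \<noteq> 0" for a
    using s'.poly_cong[of z "?j a" "map_poly (?j \<circ> \<phi>) f"] z ev[of f a] that by auto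
  have zx: "0 < s' (z - ?j x)" using s'(4) ne[of x] change by force
  have yz: "0 < s' (?j y - z)"
    using s'(5) ne[of y] change s'.minus[of "z - ?j y"] by force
  have new: "s' (z - ?j w) \<noteq> 0" if w: "s (poly (map_poly \<phi> f) w) = 0" for w
  proof
    assume 0: "s' (z - ?j w) = 0"
    have "s' (?j w - ?j x) = s' (z - ?j x)"
      using s'.diff_null[OF 0, of "z - ?j x"] by simp
    moreover have "s' (?j y - ?j w) = s' (?j y - z)"
      using s'.add_null[OF 0, of "?j y - z"] by simp
    ultimately show False using none[of w] w zx yz by (simp add: diff)
  qed
  have inj: "inj_on ?j W" if "root_set s (map_poly \<phi> g) W" for g W
  proof (rule inj_onI)
    fix w w' assume "w \<in> W" "w' \<in> W" "?j w = ?j w'"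
    then show "w = w'" using that diff[of w w'] by (auto simp: root_set_def)
  qed
  have keep: "root_set s' (map_poly (?j \<circ> \<phi>) g) (?j ` W) \<and> card (?j ` W) = card W"
    if W: "root_set s (map_poly \<phi> g) W" for g W
    using W card_image[OF inj[OF W]] by (auto simp: root_set_def ev diff)
  have add: "root_set s' (map_poly (?j \<circ> \<phi>) f) (insert z (?j ` W)) \<and> card (insert z (?j ` W)) = Suc (card W)"
    if W: "root_set s (map_poly \<phi> f) W" for W
  proof -
    have *: "s' (z - ?j w) \<noteq> 0" "s' (?j w - z) \<noteq> 0" if "w \<in> W" for w
      using new[of w] W that s'.minus[of "z - ?j w"] by (auto simp: root_set_def)
    have "z \<notin> ?j ` W" using *(1) by force
    then show ?thesis
      using keep[OF W] * z W by (auto simp: root_set_def)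
  qed
  show ?thesis
    using that[OF extension_comp[OF ext j s'(1,2)], of ?j z] keep add by blast
qed

text \<open>
  The finite substitute for a real closure. The number of distinct roots of the members of \<open>C\<close> in an
  ordered extension is bounded by their degrees; an extension in which it is maximal has the
  intermediate value property for \<open>C\<close>, since a missing root could be adjoined.
\<close>

lemma intermediate_value_extension:
  assumes \<sigma>: "sign_ring \<sigma>" and C: "finite C" "\<And>f. f \<in> C \<Longrightarrow> sign_ring.tight \<sigma> f"
  obtains \<phi> s \<omega> where "extension \<sigma> \<phi> s \<omega>"
    "\<And>f x y. f \<in> C \<Longrightarrow> 0 < s (y - x) \<Longrightarrow> s (poly (map_poly \<phi> f) x) * s (poly (map_poly \<phi> f) y) < 0
      \<Longrightarrow> \<exists>z. 0 < s (z - x) \<and> 0 < s (y - z) \<and> s (poly (map_poly \<phi> f) z) = 0"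
proof -
  interpret \<sigma>: sign_ring \<sigma> by fact
  let ?C = "C - {0}"
  \<comment> \<open>A configuration is an extension together with pairwise distinct roots of each nonzero member of C.\<close>
  define conf where "conf = (\<lambda>(\<phi>, s, \<omega>, W). extension \<sigma> \<phi> s \<omega> \<and> (\<forall>f\<in>?C. root_set s (map_poly \<phi> f) (W f)))"
  define count where "count = (\<lambda>(\<phi> :: nat_mpoly \<Rightarrow> nat_mpoly, s :: nat_mpoly \<Rightarrow> real, \<omega> :: nat_mpoly,
      W :: nat_mpoly poly \<Rightarrow> nat_mpoly set). \<Sum>f\<in>?C. card (W f))"
  obtain \<phi>0 s0 \<omega>0 where "extension \<sigma> \<phi>0 s0 \<omega>0" using extension_initial[OF \<sigma>] .
  then have init: "conf (\<phi>0, s0, \<omega>0, \<lambda>_. {})" by (simp add: conf_def root_set_def)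
  have bound: "count c \<le> (\<Sum>f\<in>?C. degree f)" if "conf c" for c
  proof -
    obtain \<phi> s \<omega> W where c: "c = (\<phi>, s, \<omega>, W)" by (cases c)
    then have ext: "extension \<sigma> \<phi> s \<omega>" and W: "\<And>f. f \<in> ?C \<Longrightarrow> root_set s (map_poly \<phi> f) (W f)"
      using that by (auto simp: conf_def)
    interpret s: sign_ring s using ext by (simp add: extension_def)
    have \<phi>: "ring_hom \<phi>" and s\<phi>: "s (\<phi> a) = \<sigma> a" for a using ext by (auto simp: extension_def)
    have "card (W f) \<le> degree f" if f: "f \<in> ?C" for f
    proof -
      have "s (\<phi> (lead_coeff f)) \<noteq> 0" using C(2)[of f] f by (auto simp: s\<phi> \<sigma>.tight_def)
      then have deg: "degree (map_poly \<phi> f) = degree f"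
        by (intro map_poly_degree_eq) auto
      then have "s (lead_coeff (map_poly \<phi> f)) \<noteq> 0"
        using \<open>s (\<phi> (lead_coeff f)) \<noteq> 0\<close> by (simp add: map_poly_hom(1)[OF \<phi>])
      then show ?thesis
        using s.root_count[of "map_poly \<phi> f" "W f"] W[OF f] deg by (auto simp: root_set_def)
    qed
    then show ?thesis by (auto simp: count_def c intro: sum_mono)
  qed
  then obtain c where c: "conf c" "\<And>c'. conf c' \<Longrightarrow> count c' \<le> count c"
    using ex_has_greatest_nat[of conf _ count "Suc (\<Sum>f\<in>?C. degree f)"] init by (metis le_SucI less_Suc_eq_le)
  obtain \<phi> s \<omega> W where cc: "c = (\<phi>, s, \<omega>, W)" by (cases c)
  have ext: "extension \<sigma> \<phi> s \<omega>" and W: "\<And>f. f \<in> ?C \<Longrightarrow> root_set s (map_poly \<phi> f) (W f)"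
    using c(1) by (auto simp: conf_def cc)
  show ?thesis
  proof (rule that[OF ext], rule ccontr)
    fix f x y assume f: "f \<in> C" "0 < s (y - x)" "s (poly (map_poly \<phi> f) x) * s (poly (map_poly \<phi> f) y) < 0"
      and none: "\<nexists>z. 0 < s (z - x) \<and> 0 < s (y - z) \<and> s (poly (map_poly \<phi> f) z) = 0"
    interpret s: sign_ring s using ext by (simp add: extension_def)
    have fC: "f \<in> ?C" using f by auto
    obtain \<phi>' s' \<omega>' j z where new: "extension \<sigma> \<phi>' s' \<omega>'"
      "\<And>g W. root_set s (map_poly \<phi> g) W \<Longrightarrow> root_set s' (map_poly \<phi>' g) (j ` W) \<and> card (j ` W) = card W"
      "\<And>W. root_set s (map_poly \<phi> f) W \<Longrightarrow> root_set s' (map_poly \<phi>' f) (insert z (j ` W)) \<and>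
         card (insert z (j ` W)) = Suc (card W)"
      using extension_new_root[OF ext f(2,3)] none by metis
    define W' where "W' g = (if g = f then insert z (j ` W g) else j ` W g)" for g
    have "conf (\<phi>', s', \<omega>', W')"
      using new W fC by (auto simp: conf_def W'_def)
    then have "(\<Sum>g\<in>?C. card (W' g)) \<le> (\<Sum>g\<in>?C. card (W g))"
      using c(2) by (force simp: count_def cc)
    moreover have "(\<Sum>g\<in>?C. card (W g)) < (\<Sum>g\<in>?C. card (W' g))"
    proof -
      have "card (W' f) = Suc (card (W f))" using new(3)[OF W[OF fC]] by (simp add: W'_def)
      moreover have "card (W' g) = card (W g)" if "g \<in> ?C - {f}" for g
        using new(2)[OF W, of g] that by (simp add: W'_def)
      ultimately show ?thesis
        using C(1) fC by (simp add: sum.remove[of ?C f])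
    qed
    ultimately show False by simp
  qed
qed

text \<open>
  The polynomials in the first \<open>d\<close> variables, defined as a generated set so that the induction over \<open>d\<close>
  stays within one type.
\<close>

inductive_set polys_in :: "nat \<Rightarrow> nat_mpoly set" for d where
  const: "const_poly r \<in> polys_in d"
| var: "i < d \<Longrightarrow> var_poly i \<in> polys_in d"
| add: "p \<in> polys_in d \<Longrightarrow> q \<in> polys_in d \<Longrightarrow> p + q \<in> polys_in d"
| mult: "p \<in> polys_in d \<Longrightarrow> q \<in> polys_in d \<Longrightarrow> p * q \<in> polys_in d"

lemma subring_polys_in: "subring_set (polys_in d)"
proof -
  note c = ring_homD[OF ring_hom_const_poly]
  have "1 \<in> polys_in d" using polys_in.const[of 1 d] by (simp add: c)
  moreover have "a - b \<in> polys_in d" if "a \<in> polys_in d" "b \<in> polys_in d" for a b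
  proof -
    have "a + const_poly (- 1) * b \<in> polys_in d" using that by (intro polys_in.intros)
    then show ?thesis by (simp add: c)
  qed
  ultimately show ?thesis using polys_in.mult by (auto simp: subring_set_def)
qed

definition eval_real :: "(nat \<Rightarrow> real) \<Rightarrow> nat_mpoly \<Rightarrow> real" where
  "eval_real = subst_poly (\<lambda>r. r)"

lemma ring_hom_real: "ring_hom (\<lambda>r::real. r)" by (simp add: ring_hom_def)

lemma ring_hom_eval_real: "ring_hom (eval_real a)"
  unfolding eval_real_def by (rule ring_hom_subst[OF ring_hom_real])

lemma eval_real_const: "eval_real a (const_poly r) = r" and eval_real_var: "eval_real a (var_poly i) = a i"
  by (simp_all add: eval_real_def subst_const subst_var ring_hom_real)

lemma eval_real_cong:
  assumes "p \<in> polys_in d" "\<And>i. i < d \<Longrightarrow> a i = b i"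
  shows "eval_real a p = eval_real b p"
  using assms(1) by induction
    (auto simp: eval_real_const eval_real_var assms(2) ring_homD[OF ring_hom_eval_real])

lemma polys_in_Suc:
  assumes "p \<in> polys_in (Suc d)"
  shows "\<exists>q. (\<forall>i. coeff q i \<in> polys_in d) \<and> poly q (var_poly d) = p"
  using assms
proof induction
  note S = subring_setD[OF subring_polys_in]
  case (const r)
  show ?case
    by (rule exI[of _ "[:const_poly r:]"]) (auto simp: coeff_pCons S polys_in.const split: nat.split)
next
  note S = subring_setD[OF subring_polys_in]
  case (var i)
  show ?case
  proof (cases "i = d")
    case True
    then show ?thesis
      by (intro exI[of _ "[:0, 1:]"]) (auto simp: coeff_pCons S split: nat.split)
  next
    case False
    then have "var_poly i \<in> polys_in d" using var by (intro polys_in.var) simp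
    then show ?thesis
      by (intro exI[of _ "[:var_poly i:]"]) (auto simp: coeff_pCons S split: nat.split)
  qed
next
  note S = subring_setD[OF subring_polys_in]
  case (add p q)
  then obtain p' q' where "\<forall>i. coeff p' i \<in> polys_in d" "poly p' (var_poly d) = p"
    "\<forall>i. coeff q' i \<in> polys_in d" "poly q' (var_poly d) = q" by blast
  then show ?case by (intro exI[of _ "p' + q'"]) (auto intro: S)
next
  note S = subring_setD[OF subring_polys_in]
  case (mult p q)
  then obtain p' q' where *: "\<forall>i. coeff p' i \<in> polys_in d" "poly p' (var_poly d) = p"
    "\<forall>i. coeff q' i \<in> polys_in d" "poly q' (var_poly d) = q" by blast
  have sum_in: "sum f I \<in> polys_in d" if "\<And>i. i \<in> I \<Longrightarrow> f i \<in> polys_in d" for f and I :: "nat set"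
    using that by (induction I rule: infinite_finite_induct) (auto intro: S)
  have "coeff (p' * q') i \<in> polys_in d" for i
    unfolding coeff_mult using * by (intro sum_in S(4)) auto
  then show ?case using * by (intro exI[of _ "p' * q'"]) auto
qed

text \<open>
  The Artin-Lang property of the real numbers: the signs that an ordering gives to finitely many real
  polynomials are taken at a real point. By induction on the number of variables, the polynomials
  are regarded as univariate in the last variable, enlarged to a closed family, and transferred from
  an ordered extension, in which the last variable itself is the point \<open>x\<close>. The induction hypothesis
  provides values for the first \<open>d\<close> variables that respect the signs of all coefficients.
\<close>

theorem real_point_with_signs:
  assumes \<sigma>: "sign_ring \<sigma>" and F: "finite F" "F \<subseteq> polys_in d"
  shows "\<exists>a. \<forall>f\<in>F. sgn (eval_real a f) = \<sigma> f"
  using F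
proof (induction d arbitrary: F)
  case 0
  interpret \<sigma>: sign_ring \<sigma> by fact
  have "\<exists>r. f = const_poly r" if "f \<in> polys_in 0" for f
    using that
  proof induction
    case (add p q)
    then show ?case by (metis ring_homD(3)[OF ring_hom_const_poly])
  next
    case (mult p q)
    then show ?case by (metis ring_homD(4)[OF ring_hom_const_poly])
  qed auto
  then have "sgn (eval_real (\<lambda>_. 0) f) = \<sigma> f" if "f \<in> F" for f
    using 0 that by (metis subsetD eval_real_const \<sigma>.real_constant_sign[OF ring_hom_const_poly])
  then show ?case by blast
next
  case (Suc d)
  interpret \<sigma>: sign_ring \<sigma> by fact
  note S = subring_setD[OF subring_polys_in[of d]]
  let ?v = "var_poly d"
  have "\<forall>f\<in>F. \<exists>q. (\<forall>i. coeff q i \<in> polys_in d) \<and> poly q ?v = f"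
    using polys_in_Suc Suc.prems(2) by blast
  then obtain q where q: "\<And>f i. f \<in> F \<Longrightarrow> coeff (q f) i \<in> polys_in d" "\<And>f. f \<in> F \<Longrightarrow> poly (q f) ?v = f"
    by metis
  have "\<exists>t. \<sigma>.null_poly (q f - t) \<and> \<sigma>.tight t \<and> (\<forall>i. coeff t i \<in> polys_in d)" if "f \<in> F" for f
  proof -
    obtain n where "\<sigma>.null_poly (q f - poly_cutoff n (q f))"
      "poly_cutoff n (q f) = 0 \<or> \<sigma> (lead_coeff (poly_cutoff n (q f))) \<noteq> 0"
      by (rule \<sigma>.truncation)
    then show ?thesis
      by (intro exI[of _ "poly_cutoff n (q f)"]) (auto simp: \<sigma>.tight_def coeff_poly_cutoff q[OF that] S)
  qed
  then obtain t where t: "\<And>f. f \<in> F \<Longrightarrow> \<sigma>.null_poly (q f - t f)" "\<And>f. f \<in> F \<Longrightarrow> \<sigma>.tight (t f)"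
    "\<And>f i. f \<in> F \<Longrightarrow> coeff (t f) i \<in> polys_in d" by metis
  \<comment> \<open>Any number above all degrees would do.\<close>
  define k where "k = Suc (\<Sum>f\<in>F. degree (t f))"
  have tk: "degree (t f) < k" if "f \<in> F" for f
    unfolding k_def less_Suc_eq_le using Suc.prems(1) that by (intro member_le_sum) auto
  have "\<exists>C N. closed_family \<sigma> (polys_in d) C N k \<and> t ` F \<subseteq> C \<and> (\<forall>f\<in>C - t ` F. degree f < k)"
    by (rule closed_family_exists[OF \<sigma> subring_polys_in]) (use Suc.prems(1) t(2,3) in auto)
  then obtain C N where CN: "closed_family \<sigma> (polys_in d) C N k" "t ` F \<subseteq> C" "\<And>f. f \<in> C - t ` F \<Longrightarrow> degree f < k"
    by (elim exE conjE) (rule that, auto)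
  have degC: "degree f < k" if "f \<in> C" for f
    using CN(3)[of f] tk that by (cases "f \<in> t ` F") auto
  have finC: "finite C" "finite N" and tightC: "\<And>f. f \<in> C \<Longrightarrow> \<sigma>.tight f"
    and inC: "\<And>f i. f \<in> C \<union> N \<Longrightarrow> coeff f i \<in> polys_in d"
    using CN(1) by (auto simp: closed_family_def)
  obtain \<phi> s \<omega> where ext: "extension \<sigma> \<phi> s \<omega>"
    and ivt: "\<And>f x y. f \<in> C \<Longrightarrow> 0 < s (y - x) \<Longrightarrow> s (poly (map_poly \<phi> f) x) * s (poly (map_poly \<phi> f) y) < 0
      \<Longrightarrow> \<exists>z. 0 < s (z - x) \<and> 0 < s (y - z) \<and> s (poly (map_poly \<phi> f) z) = 0"
    using intermediate_value_extension[OF \<sigma> finC(1) tightC] by blast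
  have \<phi>: "ring_hom \<phi>" and s: "sign_ring s" and s\<phi>: "\<And>a. s (\<phi> a) = \<sigma> a" and ends: "end_point \<sigma> \<phi> s \<omega>"
    using ext by (auto simp: extension_def)
  interpret s: sign_ring s by fact
  let ?D = "C \<union> N \<union> (\<lambda>f. q f - t f) ` F"
  let ?G = "\<Union>p\<in>?D. coeff p ` {..degree p}"
  have finG: "finite ?G" using finC Suc.prems(1) by auto
  have coeffs_D: "coeff p i \<in> polys_in d" if "p \<in> ?D" for p i
    using that inC q(1) t(3) S by auto
  then have "?G \<subseteq> polys_in d" by blast
  then have "\<exists>a. \<forall>g\<in>?G. sgn (eval_real a g) = \<sigma> g" by (rule Suc.IH[OF finG])
  then obtain a where a: "\<forall>g\<in>?G. sgn (eval_real a g) = \<sigma> g" ..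
  note \<psi> = ring_hom_eval_real[of a]
  \<comment> \<open>The coefficients of the truncated parts are included, so they vanish at the real point.\<close>
  have sgn_D: "sgn (eval_real a (coeff p i)) = \<sigma> (coeff p i)" if p: "p \<in> ?D" for p i
  proof (cases "coeff p i = 0")
    case True
    then show ?thesis by (simp add: ring_homD(1)[OF \<psi>])
  next
    case False
    then have "coeff p i \<in> coeff p ` {..degree p}" using le_degree by blast
    then show ?thesis using a p by blast
  qed
  have ends1: "s (poly (map_poly \<phi> f) \<omega>) = 1 \<and> s (poly (map_poly \<phi> f) (- \<omega>)) = (- 1) ^ degree f"
    if "lead_coeff f = 1" for f
    using ends that unfolding end_point_def by simp
  have monic: "lead_coeff [:- ?v, 1:] = 1" "lead_coeff [:0, 1 :: nat_mpoly:] = 1" "degree [:- ?v, 1:] = 1"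
    by simp_all
  have lin: "s (poly (map_poly \<phi> [:- ?v, 1:]) \<omega>) = 1" "s (poly (map_poly \<phi> [:- ?v, 1:]) (- \<omega>)) = - 1"
    "s (poly (map_poly \<phi> [:0, 1:]) \<omega>) = 1"
    using ends1[OF monic(1)] ends1[OF monic(2)] unfolding monic(3) power_one_right by blast+
  have maps: "map_poly \<phi> [:- ?v, 1:] = [:- \<phi> ?v, 1:]" "map_poly \<phi> [:0, 1:] = [:0, 1:]"
    by (simp_all only: map_poly_hom(2,3)[OF \<phi>] ring_homD(1,2,5)[OF \<phi>] map_poly_0)
  have \<omega>: "s (\<omega> - \<phi> ?v) = 1" "s (- \<phi> ?v - \<omega>) = - 1" "s \<omega> = 1"
    using lin unfolding maps by simp_all
  have \<omega>': "s (\<phi> ?v - - \<omega>) = 1"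
    using \<omega>(2) s.minus[of "\<phi> ?v + \<omega>"] by simp
  have \<omega>2: "0 < s (\<omega> - - \<omega>)" using s.add_pos[of \<omega> \<omega>] \<omega>(3) by simp
  have "\<exists>y. \<forall>f\<in>C. s (poly (map_poly \<phi> f) (\<phi> ?v)) = sgn (poly (map_poly (eval_real a) f) y)"
  proof (rule univariate_transfer[OF \<sigma> CN(1) degC s ring_hom_const_poly \<phi> s\<phi> ivt _ _ \<omega>2 _ _ \<psi>])
    show "s (poly (map_poly \<phi> f) \<omega>) = \<sigma> (lead_coeff f)"
      "s (poly (map_poly \<phi> f) (- \<omega>)) = (- 1) ^ degree f * \<sigma> (lead_coeff f)" if "f \<in> C" "f \<noteq> 0" for f
      using ends tightC[OF that(1)] that(2) by (auto simp: end_point_def \<sigma>.tight_def)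
    show "0 \<le> s (\<phi> ?v - - \<omega>)" "0 \<le> s (\<omega> - \<phi> ?v)" using \<omega> \<omega>' by simp_all
    show "sgn (eval_real a (coeff f i)) = \<sigma> (coeff f i)" if "f \<in> C \<union> N" for f i
      using that sgn_D by blast
  qed
  then obtain y where y: "\<And>f. f \<in> C \<Longrightarrow> s (poly (map_poly \<phi> f) (\<phi> ?v)) = sgn (poly (map_poly (eval_real a) f) y)"
    by blast
  have "sgn (eval_real (a(d := y)) f) = \<sigma> f" if f: "f \<in> F" for f
  proof -
    let ?b = "a(d := y)"
    note \<psi>b = ring_hom_eval_real[of ?b]
    have tC: "t f \<in> C" using CN(2) f by blast
    have "map_poly (eval_real ?b) (q f) = map_poly (eval_real a) (q f)"
      by (intro poly_eqI) (auto simp: map_poly_hom(1)[OF \<psi>] map_poly_hom(1)[OF \<psi>b] intro!: eval_real_cong[OF q(1)[OF f]])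
    then have "eval_real ?b f = poly (map_poly (eval_real a) (q f)) y"
      using map_poly_hom(7)[OF \<psi>b, of "q f" ?v] q(2)[OF f] by (simp add: eval_real_var)
    also have "map_poly (eval_real a) (q f) = map_poly (eval_real a) (t f)"
    proof (intro poly_eqI)
      fix i
      have "sgn (eval_real a (coeff (q f - t f) i)) = 0"
        using sgn_D[of "q f - t f" i] t(1)[OF f] f by (auto simp: \<sigma>.null_poly_def)
      then show "coeff (map_poly (eval_real a) (q f)) i = coeff (map_poly (eval_real a) (t f)) i"
        by (simp add: map_poly_hom(1)[OF \<psi>] ring_homD(6)[OF \<psi>] sgn_zero_iff)
    qed
    also have "sgn (poly (map_poly (eval_real a) (t f)) y) = s (poly (map_poly \<phi> (t f)) (\<phi> ?v))"
      using y[OF tC] by simp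
    also have "\<dots> = \<sigma> (poly (t f) ?v)" by (simp only: map_poly_hom(7)[OF \<phi>] s\<phi>)
    also have "\<dots> = \<sigma> f"
      using \<sigma>.null_poly_eval[OF t(1)[OF f], of ?v] \<sigma>.cong_null[of f "poly (t f) ?v"] q(2)[OF f] by simp
    finally show ?thesis .
  qed
  then show ?case by blast
qed

section \<open>The Positivstellensatz\<close>

definition generators :: "('n, real) mpoly list \<Rightarrow> ('n, real) mpoly set" where
  "generators f = {(\<Prod>i<length f. (f ! i) ^ \<epsilon> i) * q\<^sup>2 | \<epsilon> q. \<forall>i. \<epsilon> i \<in> {0, 1::nat}}"

lemma preordering_generators: "preordering f = {sum_list ts | ts. set ts \<subseteq> generators f}"
  by (simp add: preordering_def generators_def)

lemma generators_in_preordering: "g \<in> generators f \<Longrightarrow> g \<in> preordering f"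
  unfolding preordering_generators by (intro CollectI exI[of _ "[g]"]) simp

lemma preordering_induct [consumes 1, case_names zero add]:
  assumes "t \<in> preordering f" "P 0" "\<And>g t. g \<in> generators f \<Longrightarrow> t \<in> preordering f \<Longrightarrow> P t \<Longrightarrow> P (g + t)"
  shows "P t"
proof -
  obtain ts where ts: "t = sum_list ts" "set ts \<subseteq> generators f"
    using assms(1) by (auto simp: preordering_generators)
  have "sum_list us \<in> preordering f" if "set us \<subseteq> generators f" for us
    using that by (auto simp: preordering_generators)
  then have "set ts \<subseteq> generators f \<Longrightarrow> P (sum_list ts)"
    by (induction ts) (simp_all add: assms(2,3))
  then show ?thesis using ts by simp
qed

lemma preordering_add: "s \<in> preordering f \<Longrightarrow> t \<in> preordering f \<Longrightarrow> s + t \<in> preordering f"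
proof -
  assume "s \<in> preordering f" "t \<in> preordering f"
  then obtain xs ys where "s = sum_list xs" "set xs \<subseteq> generators f" "t = sum_list ys" "set ys \<subseteq> generators f"
    by (auto simp: preordering_generators)
  then show ?thesis
    unfolding preordering_generators by (intro CollectI exI[of _ "xs @ ys"]) auto
qed

lemma preordering_zero: "0 \<in> preordering f"
  unfolding preordering_generators by (intro CollectI exI[of _ "[]"]) simp

text \<open>
  Exponents add up to at most two, and an even part of an exponent is moved into the square.
\<close>

lemma generators_mult:
  assumes "g \<in> generators f" "h \<in> generators f"
  shows "g * h \<in> generators f"
proof -
  obtain \<epsilon> q \<delta> r where g: "g = (\<Prod>i<length f. (f ! i) ^ \<epsilon> i) * q\<^sup>2" "\<forall>i. \<epsilon> i \<in> {0, 1::nat}"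
    and h: "h = (\<Prod>i<length f. (f ! i) ^ \<delta> i) * r\<^sup>2" "\<forall>i. \<delta> i \<in> {0, 1::nat}"
    using assms by (auto simp: generators_def)
  let ?\<eta> = "\<lambda>i. (\<epsilon> i + \<delta> i) mod 2" and ?c = "\<Prod>i<length f. (f ! i) ^ ((\<epsilon> i + \<delta> i) div 2)"
  have split: "x ^ \<epsilon> i * x ^ \<delta> i = x ^ ?\<eta> i * (x ^ ((\<epsilon> i + \<delta> i) div 2))\<^sup>2" for x :: "('a, real) mpoly" and i
  proof -
    have "\<epsilon> i + \<delta> i = ?\<eta> i + ((\<epsilon> i + \<delta> i) div 2) * 2" by simp
    then show ?thesis by (metis power_add power_mult)
  qed
  have "(\<Prod>i<length f. (f ! i) ^ \<epsilon> i) * (\<Prod>i<length f. (f ! i) ^ \<delta> i)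
      = (\<Prod>i<length f. (f ! i) ^ ?\<eta> i) * ?c\<^sup>2"
    by (simp only: split prod_power_distrib flip: prod.distrib)
  then have "g * h = (\<Prod>i<length f. (f ! i) ^ ?\<eta> i) * (?c * q * r)\<^sup>2"
    unfolding g h by (simp add: power_mult_distrib ac_simps)
  then show ?thesis
    unfolding generators_def by (intro CollectI exI[of _ ?\<eta>] exI[of _ "?c * q * r"]) auto
qed

lemma preordering_mult:
  assumes "s \<in> preordering f" "t \<in> preordering f"
  shows "s * t \<in> preordering f"
proof -
  have 1: "g * t \<in> preordering f" if g: "g \<in> generators f" for g
    using assms(2)
  proof (induction rule: preordering_induct)
    case (add h t)
    then show ?case
      using preordering_add[OF generators_in_preordering[OF generators_mult[OF g]], of h "g * t"]
      by (simp add: distrib_left)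
  qed (simp add: preordering_zero)
  show ?thesis
    using assms(1)
  proof (induction rule: preordering_induct)
    case (add h s)
    then show ?case using preordering_add[OF 1, of h "s * t"] by (simp add: distrib_right)
  qed (simp add: preordering_zero)
qed

lemma preordering_square: "q\<^sup>2 \<in> preordering f"
  by (rule generators_in_preordering) (auto simp: generators_def intro!: exI[of _ "\<lambda>_. 0"] exI[of _ q])

lemma preordering_constraint:
  assumes "i < length f"
  shows "f ! i \<in> preordering f"
proof (rule generators_in_preordering)
  let ?\<epsilon> = "\<lambda>j. if j = i then 1 else 0 :: nat"
  have "(\<Prod>j<length f. (f ! j) ^ ?\<epsilon> j) = (\<Prod>j<length f. if j = i then f ! j else 1)"
    by (intro prod.cong) auto
  also have "\<dots> = f ! i" using assms by (simp add: prod.delta)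
  finally have "f ! i = (\<Prod>j<length f. (f ! j) ^ ?\<epsilon> j) * 1\<^sup>2" by simp
  then show "f ! i \<in> generators f" unfolding generators_def by (intro CollectI exI[of _ ?\<epsilon>] exI[of _ 1]) simp
qed

lemma precone_preordering: "precone (preordering f)"
  unfolding precone_def using preordering_add preordering_mult preordering_square by blast

lemma preordering_snoc:
  assumes "t \<in> preordering (f @ [g])"
  shows "\<exists>t1\<in>preordering f. \<exists>t2\<in>preordering f. t = t1 + t2 * g"
  using assms
proof (induction rule: preordering_induct)
  case zero
  show ?case using preordering_zero[of f] by (intro bexI[of _ 0]) auto
next
  case (add h t)
  then obtain t1 t2 where t: "t1 \<in> preordering f" "t2 \<in> preordering f" "t = t1 + t2 * g" by blast
  obtain \<epsilon> q where h: "h = (\<Prod>i<Suc (length f). ((f @ [g]) ! i) ^ \<epsilon> i) * q\<^sup>2" and \<epsilon>: "\<forall>i. \<epsilon> i \<in> {0, 1::nat}"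
    using add.hyps(1) by (auto simp: generators_def)
  define c where "c = (\<Prod>i<length f. (f ! i) ^ \<epsilon> i) * q\<^sup>2"
  have c: "c \<in> preordering f"
    using \<epsilon> by (intro generators_in_preordering) (auto simp: generators_def c_def)
  have "(\<Prod>i<length f. ((f @ [g]) ! i) ^ \<epsilon> i) = (\<Prod>i<length f. (f ! i) ^ \<epsilon> i)"
    by (intro prod.cong) (auto simp: nth_append)
  then have "h = c * g ^ \<epsilon> (length f)" by (simp add: h c_def ac_simps)
  moreover have "\<epsilon> (length f) = 0 \<or> \<epsilon> (length f) = 1" using \<epsilon> by auto
  ultimately have "h + t = (c + t1) + t2 * g \<or> h + t = t1 + (c + t2) * g"
    by (auto simp: t(3) algebra_simps)
  then show ?case using preordering_add[OF c t(1)] preordering_add[OF c t(2)] t(1,2) by blast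
qed

lemma eval_eq_subst: "eval p x = subst_poly (\<lambda>r. r) x p"
proof -
  have "(\<Prod>i\<in>UNIV. x i ^ Poly_Mapping.lookup m i) = (\<Prod>i\<in>Poly_Mapping.keys m. x i ^ Poly_Mapping.lookup m i)" for m
    by (rule prod.mono_neutral_right) (auto simp: in_keys_iff)
  then show ?thesis by (simp add: eval_def subst_poly_def)
qed

lemma ring_hom_eval: "ring_hom (\<lambda>p. eval p x)" for x :: "'n::finite \<Rightarrow> real"
  unfolding eval_eq_subst by (rule ring_hom_subst[OF ring_hom_real])

text \<open>
  A proper preordering is contained in the nonnegative part of a sign function, which has a real
  point on the constraints by the Artin-Lang property. The variables are numbered to compare the
  polynomial ring over \<open>'n\<close> with the one over the natural numbers.
\<close>

theorem positivstellensatz: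
  fixes f :: "('n::finite, real) mpoly list"
  assumes "semialg_set f = {}"
  shows "- 1 \<in> preordering f"
proof (rule ccontr)
  assume neg: "- 1 \<notin> preordering f"
  have "1 \<in> preordering f" using preordering_square[of 1 f] by simp
  then obtain \<sigma>0 where \<sigma>0: "sign_ring \<sigma>0" "\<And>t. t \<in> preordering f \<Longrightarrow> 0 \<le> \<sigma>0 t"
    using precone_imp_sign_ring[OF precone_preordering, of "{1}" f] neg by auto
  obtain e :: "'n \<Rightarrow> nat" where e: "bij_betw e UNIV {..<CARD('n)}"
    using ex_bij_betw_finite_nat[of "UNIV :: 'n set"] by (auto simp: atLeast0LessThan)
  have inj: "inj e" using e by (simp add: bij_betw_def)
  have e_less: "e i < CARD('n)" for i using e by (auto simp: bij_betw_def)
  define emb :: "('n, real) mpoly \<Rightarrow> nat_mpoly" where "emb = subst_poly const_poly (\<lambda>i. var_poly (e i))"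
  \<comment> \<open>Indices outside the range of e are sent to arbitrary variables; only proj (emb p) = p matters.\<close>
  define proj :: "nat_mpoly \<Rightarrow> ('n, real) mpoly" where "proj = subst_poly const_poly (\<lambda>k. var_poly (inv e k))"
  note homs = ring_hom_const_poly
  have emb: "ring_hom emb" and proj: "ring_hom proj"
    unfolding emb_def proj_def by (rule ring_hom_subst[OF homs])+
  have id: "ring_hom (\<lambda>x. x)" by (simp add: ring_hom_def)
  have proj_emb: "proj (emb p) = p" for p
  proof -
    have "(proj \<circ> emb) p = (\<lambda>x. x) p"
      by (rule ring_hom_eqI[OF ring_hom_comp[OF proj emb] id])
         (simp_all add: emb_def proj_def subst_const subst_var homs inv_f_f[OF inj])
    then show ?thesis by simp
  qed
  have emb_gen: "emb (const_poly r) = const_poly r" "emb (var_poly i) = var_poly (e i)" for r i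
    by (simp_all add: emb_def subst_const subst_var homs)
  have emb_in: "emb p \<in> polys_in CARD('n)" for p
    by (induction p rule: mpoly_induct)
       (auto simp: ring_homD(3,4)[OF emb] emb_gen e_less intro: polys_in.intros)
  have "sign_ring (\<sigma>0 \<circ> proj)"
    by (rule sign_ring.comp_hom[OF \<sigma>0(1)]) (rule ring_homD[OF proj])+
  then obtain a where a: "\<forall>g\<in>emb ` set f. sgn (eval_real a g) = (\<sigma>0 \<circ> proj) g"
    using real_point_with_signs[of "\<sigma>0 \<circ> proj" "emb ` set f" "CARD('n)"] emb_in by auto
  have ev: "eval_real a (emb p) = eval p (\<lambda>i. a (e i))" for p
  proof -
    have "(eval_real a \<circ> emb) p = eval p (\<lambda>i. a (e i))"
      by (rule ring_hom_eqI[OF ring_hom_comp[OF ring_hom_eval_real emb] ring_hom_eval])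
         (simp_all add: eval_eq_subst emb_def subst_const subst_var homs ring_hom_real eval_real_const eval_real_var)
    then show ?thesis by simp
  qed
  have "0 \<le> eval (f ! i) (\<lambda>i. a (e i))" if i: "i < length f" for i
  proof -
    have "sgn (eval (f ! i) (\<lambda>i. a (e i))) = \<sigma>0 (f ! i)"
      using a i by (simp add: ev[symmetric] proj_emb)
    then show ?thesis using \<sigma>0(2)[OF preordering_constraint[OF i]] by (simp add: sgn_if split: if_splits)
  qed
  moreover have eq: "(\<lambda>j. (\<chi> i. a (e i)) $ j) = (\<lambda>i. a (e i))" by simp
  ultimately have "(\<chi> i. a (e i)) \<in> semialg_set f"
    unfolding semialg_set_def mem_Collect_eq eq by blast
  then show False using assms by simp
qed

text \<open>
  If \<open>r\<close> is positive on \<open>K\<^sub>f\<close>, the additional constraint \<open>-r \<ge> 0\<close> is infeasible, so \<open>-1\<close> has the form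
  \<open>t\<^sub>1 - t\<^sub>2 r\<close>.
\<close>

lemma denominator_for_strict_positivity:
  fixes f :: "('n::finite, real) mpoly list"
  assumes "\<And>x. x \<in> semialg_set f \<Longrightarrow> 0 < eval r (\<lambda>j. x $ j)"
  shows "\<exists>t1\<in>preordering f. \<exists>t2\<in>preordering f. t2 * r = 1 + t1"
proof -
  have "eval (- r) y = - eval r y" for y :: "'n \<Rightarrow> real" by (rule ring_homD(5)[OF ring_hom_eval])
  then have "semialg_set (f @ [- r]) \<subseteq> {x \<in> semialg_set f. eval r (\<lambda>j. x $ j) \<le> 0}"
    by (auto simp: semialg_set_def nth_append less_Suc_eq)
  then have "semialg_set (f @ [- r]) = {}" using assms by force
  then obtain t1 t2 where "t1 \<in> preordering f" "t2 \<in> preordering f" "- 1 = t1 + t2 * (- r)"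
    using preordering_snoc[OF positivstellensatz] by blast
  moreover from this have "t2 * r = 1 + t1" by (simp add: algebra_simps)
  ultimately show ?thesis by blast
qed

section \<open>Boundedness of the multiplication operators\<close>

lemma quadratic_form_discriminant:
  fixes A B C :: real
  assumes "\<And>x y. 0 \<le> A * x\<^sup>2 + 2 * B * (x * y) + C * y\<^sup>2"
  shows "B\<^sup>2 \<le> A * C"
proof (cases "A = 0")
  case True
  have "B = 0"
  proof (rule ccontr)
    assume "B \<noteq> 0"
    \<comment> \<open>At this point the form has the value -1.\<close>
    then show False using assms[of "- (C + 1) / (2 * B)" 1] True by simp
  qed
  then show ?thesis using True by simp
next
  case False
  have "0 \<le> A" using assms[of 1 0] by simp
  \<comment> \<open>This is the value of the form at (-B, A).\<close>
  have "0 \<le> A * (A * C - B\<^sup>2)"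
    using assms[of "- B" A] by (simp add: power2_eq_square algebra_simps)
  then show ?thesis using False \<open>0 \<le> A\<close> by (simp add: zero_le_mult_iff)
qed

text \<open>
  The quotients of consecutive terms of a log-convex sequence increase, so the first of them is at
  most the exponential growth rate.
\<close>

lemma log_convex_growth:
  fixes a :: "nat \<Rightarrow> real"
  assumes nonneg: "\<And>n. 0 \<le> a n" and convex: "\<And>n. (a (Suc n))\<^sup>2 \<le> a n * a (Suc (Suc n))"
    and bound: "\<And>n. a n \<le> K * \<mu> ^ n" and \<mu>: "0 < \<mu>"
  shows "a 1 \<le> \<mu> * a 0"
proof (rule ccontr)
  assume "\<not> ?thesis"
  then have less: "\<mu> * a 0 < a 1" by simp
  then have a1: "0 < a 1" using nonneg[of 0] \<mu> by (metis le_less_trans mult_nonneg_nonneg less_imp_le)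
  have a0: "0 < a 0"
  proof (rule ccontr)
    assume "\<not> ?thesis"
    then have "a 0 = 0" using nonneg[of 0] by simp
    then show False using convex[of 0] a1 by simp
  qed
  define \<rho> where "\<rho> = a 1 / a 0"
  have \<rho>: "\<mu> < \<rho>" using less a0 by (simp add: \<rho>_def pos_less_divide_eq)
  have step: "0 < a n \<and> \<rho> * a n \<le> a (Suc n)" for n
  proof (induction n)
    case 0
    then show ?case using a0 by (simp add: \<rho>_def)
  next
    case (Suc n)
    then have pos: "0 < a (Suc n)" using \<rho> \<mu> by (meson less_le_trans less_trans mult_pos_pos)
    have "\<rho> * a (Suc n) * a n \<le> a (Suc n) * a (Suc n)"
      using Suc pos by (simp add: mult.assoc mult.left_commute mult_le_cancel_left_pos)
    also have "\<dots> \<le> a (Suc (Suc n)) * a n"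
      using convex[of n] by (simp add: power2_eq_square mult.commute)
    finally show ?case using Suc pos by simp
  qed
  have lower: "\<rho> ^ n * a 0 \<le> a n" for n
  proof (induction n)
    case (Suc n)
    have "\<rho> ^ Suc n * a 0 = \<rho> * (\<rho> ^ n * a 0)" by simp
    also have "\<dots> \<le> \<rho> * a n" using Suc \<rho> \<mu> by (intro mult_left_mono) auto
    also have "\<dots> \<le> a (Suc n)" using step by blast
    finally show ?case .
  qed simp
  have "1 < \<rho> / \<mu>" using \<rho> \<mu> by simp
  then obtain n where "K / a 0 < (\<rho> / \<mu>) ^ n" using real_arch_pow by blast
  then have "K * \<mu> ^ n < \<rho> ^ n * a 0" using a0 \<mu> by (simp add: power_divide field_simps)
  then show False using lower[of n] bound[of n] by simp
qed

text \<open>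
  Splitting \<open>p\<close> into real and imaginary part reduces statements about \<open>p p\<^sup>*\<close> to sums of two squares of
  real polynomials.
\<close>

lemma norm_square_real_poly:
  fixes p :: "('n::finite, complex) mpoly"
  shows "\<exists>u\<in>preordering f. p * conj_poly p = complexify u \<and> (\<forall>x. eval u (\<lambda>j. x $ j) = (cmod (eval_at p x))\<^sup>2)"
proof -
  define r where "r = Poly_Mapping.map Re p"
  define i where "i = Poly_Mapping.map Im p"
  have lookup: "Poly_Mapping.lookup r m = Re (Poly_Mapping.lookup p m)"
    "Poly_Mapping.lookup i m = Im (Poly_Mapping.lookup p m)" for m
    by (simp_all add: r_def i_def lookup_map_0)
  have p: "p = complexify r + scale_poly \<i> (complexify i)"
    by (rule poly_mapping_eqI) (simp add: lookup lookup_add complex_eq_iff)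
  have cp: "conj_poly p = complexify r - scale_poly \<i> (complexify i)"
    by (rule poly_mapping_eqI) (simp add: lookup lookup_minus complex_eq_iff)
  have ii: "Poly_Mapping.single 0 \<i> * Poly_Mapping.single 0 \<i> = (- 1 :: ('n, complex) mpoly)"
    by (simp add: mult_single) (metis single_one single_uminus)
  have "scale_poly \<i> (complexify i) * scale_poly \<i> (complexify i)
      = (Poly_Mapping.single 0 \<i> * Poly_Mapping.single 0 \<i>) * (complexify i * complexify i)"
    by (simp only: scale_conv_mult ac_simps)
  then have "p * conj_poly p = complexify r * complexify r + complexify i * complexify i"
    by (simp add: cp ii) (simp add: p algebra_simps)
  then have "p * conj_poly p = complexify (r\<^sup>2 + i\<^sup>2)"
    by (simp add: complexify_add complexify_mult power2_eq_square)
  moreover have "r\<^sup>2 + i\<^sup>2 \<in> preordering f" by (intro preordering_add preordering_square)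
  moreover have "eval (r\<^sup>2 + i\<^sup>2) (\<lambda>j. x $ j) = (cmod (eval_at p x))\<^sup>2" for x :: "real ^ 'n"
  proof -
    let ?M = "\<lambda>m. \<Prod>j\<in>UNIV. (x $ j) ^ Poly_Mapping.lookup m j"
    have sub: "eval q (\<lambda>j. x $ j) = (\<Sum>m\<in>Poly_Mapping.keys p. Poly_Mapping.lookup q m * ?M m)"
      if "Poly_Mapping.keys q \<subseteq> Poly_Mapping.keys p" for q :: "('n, real) mpoly"
      unfolding eval_def using that by (intro sum.mono_neutral_left) (auto simp: in_keys_iff)
    have "eval_at p x = (\<Sum>m\<in>Poly_Mapping.keys p. Poly_Mapping.lookup p m * complex_of_real (?M m))"
      by (simp add: eval_at_def eval_def)
    then have ev: "Re (eval_at p x) = (\<Sum>m\<in>Poly_Mapping.keys p. Re (Poly_Mapping.lookup p m) * ?M m)"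
      "Im (eval_at p x) = (\<Sum>m\<in>Poly_Mapping.keys p. Im (Poly_Mapping.lookup p m) * ?M m)"
      by (simp_all del: of_real_prod of_real_power)
    have "Poly_Mapping.keys r \<subseteq> Poly_Mapping.keys p" "Poly_Mapping.keys i \<subseteq> Poly_Mapping.keys p"
      by (auto simp: in_keys_iff lookup)
    from this[THEN sub] have "Re (eval_at p x) = eval r (\<lambda>j. x $ j)" "Im (eval_at p x) = eval i (\<lambda>j. x $ j)"
      by (simp_all only: ev lookup)
    moreover have "eval (r\<^sup>2 + i\<^sup>2) (\<lambda>j. x $ j) = (eval r (\<lambda>j. x $ j))\<^sup>2 + (eval i (\<lambda>j. x $ j))\<^sup>2"
      using ring_homD(3,7)[OF ring_hom_eval[of "\<lambda>j. x $ j"]] by simp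
    ultimately show ?thesis by (simp add: cmod_power2)
  qed
  ultimately show ?thesis by blast
qed

lemma cmod_le_sup_norm:
  assumes "bounded (eval_at p ` K)" "x \<in> K"
  shows "cmod (eval_at p x) \<le> sup_norm_on K p"
proof -
  obtain B where "\<And>x. x \<in> K \<Longrightarrow> cmod (eval_at p x) \<le> B"
    using assms(1) by (auto simp: bounded_iff)
  then have "bdd_above ((\<lambda>x. cmod (eval_at p x)) ` K)" by (rule bdd_aboveI2)
  then show ?thesis using assms(2) by (auto simp: sup_norm_on_def intro: cSUP_upper)
qed

lemma sup_norm_nonneg:
  assumes "bounded (eval_at p ` K)"
  shows "0 \<le> sup_norm_on K p"
proof (cases "K = {}")
  case False
  then obtain x where "x \<in> K" by blast
  then show ?thesis using cmod_le_sup_norm[OF assms, of x] norm_ge_zero[of "eval_at p x"] by linarith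
qed (simp add: sup_norm_on_def)

context
  fixes f :: "('n::finite, real) mpoly list" and L :: "('n, complex) mpoly \<Rightarrow> complex"
  assumes lin: "linear_functional L" and pos: "nonneg_on_preordering f L"
begin

interpretation L: Vector_Spaces.linear scale_poly "(*)" L
  using lin by (simp add: linear_functional_def)

definition real_part :: "('n, real) mpoly \<Rightarrow> real" where
  "real_part w = Re (L (complexify w))"

lemma real_part_add: "real_part (v + w) = real_part v + real_part w"
  by (simp add: real_part_def complexify_add L.add)

lemma real_part_scale: "real_part (const_poly c * w) = c * real_part w"
proof -
  have "complexify (const_poly c :: ('n, real) mpoly) = Poly_Mapping.single 0 (complex_of_real c)"
    by (rule poly_mapping_eqI) (simp add: const_poly_def lookup_single when_def)
  then have "complexify (const_poly c * w) = scale_poly (complex_of_real c) (complexify w)"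
    by (simp add: complexify_mult scale_conv_mult)
  then show ?thesis by (simp add: real_part_def L.scale)
qed

lemma real_part_nonneg: "t \<in> preordering f \<Longrightarrow> 0 \<le> real_part t"
  using pos by (auto simp: nonneg_on_preordering_def real_part_def complex_nonneg_Reals_iff)

lemma real_part_cauchy_schwarz:
  assumes u: "t \<in> preordering f"
  shows "(real_part (u * t))\<^sup>2 \<le> real_part t * real_part (u * (u * t))"
proof (rule quadratic_form_discriminant)
  fix x y :: real
  let ?z = "const_poly x + const_poly y * u"
  have "t * ?z\<^sup>2 = const_poly (x\<^sup>2) * t + const_poly (2 * (x * y)) * (u * t) + const_poly (y\<^sup>2) * (u * (u * t))"
  proof -
    have two: "const_poly (2 * (x * y)) = (2 :: ('n, real) mpoly) * (const_poly x * const_poly y)"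
    proof -
      have "const_poly 2 = (2 :: ('n, real) mpoly)"
        using ring_homD(9)[OF ring_hom_const_poly, of 2] by simp
      then show ?thesis by (simp only: ring_homD(4)[OF ring_hom_const_poly])
    qed
    show ?thesis
      unfolding two ring_homD(7)[OF ring_hom_const_poly] by (simp add: power2_eq_square algebra_simps)
  qed
  moreover have "0 \<le> real_part (t * ?z\<^sup>2)"
    using u by (intro real_part_nonneg preordering_mult preordering_square)
  ultimately show "0 \<le> real_part t * x\<^sup>2 + 2 * real_part (u * t) * (x * y) + real_part (u * (u * t)) * y\<^sup>2"
    by (simp only: real_part_add real_part_scale) (simp add: algebra_simps)
qed

text \<open>
  With \<open>t\<^sub>2 (\<mu> - u) = 1 + t\<^sub>1\<close>, the numbers \<open>a\<^sub>n = L(u\<^sup>n v)\<close> and \<open>b\<^sub>n = L(t\<^sub>2 u\<^sup>n v)\<close> satisfy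
  \<open>a\<^sub>n + b\<^sub>n\<^sub>+\<^sub>1 \<le> \<mu> b\<^sub>n\<close>. The unknown factor \<open>t\<^sub>2\<close> therefore affects only the constant in
  \<open>a\<^sub>n \<le> \<mu> b\<^sub>0 \<mu>\<^sup>n\<close>, and log-convexity of \<open>a\<^sub>n\<close> removes this constant.
\<close>

lemma real_part_bound:
  assumes u: "u \<in> preordering f" and v: "v \<in> preordering f" and \<mu>: "0 < \<mu>"
    and less: "\<And>x. x \<in> semialg_set f \<Longrightarrow> eval u (\<lambda>j. x $ j) < \<mu>"
  shows "real_part (u * v) \<le> \<mu> * real_part v"
proof -
  have "eval (const_poly \<mu> - u) (\<lambda>j. x $ j) = \<mu> - eval u (\<lambda>j. x $ j)" for x :: "real ^ 'n"
    by (simp add: eval_eq_subst subst_const ring_homD(6)[OF ring_hom_subst] ring_hom_real)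
  then obtain t1 t2 where t: "t1 \<in> preordering f" "t2 \<in> preordering f" "t2 * (const_poly \<mu> - u) = 1 + t1"
    using denominator_for_strict_positivity[of f "const_poly \<mu> - u"] less by auto
  define a where "a n = real_part (u ^ n * v)" for n
  define b where "b n = real_part (t2 * (u ^ n * v))" for n
  have "1 \<in> preordering f" using preordering_square[of 1 f] by simp
  then have un: "u ^ n * v \<in> preordering f" for n
    by (induction n) (auto simp: mult.assoc intro: u v preordering_mult)
  have step: "a n + b (Suc n) \<le> \<mu> * b n" for n
  proof -
    let ?w = "u ^ n * v"
    have "const_poly \<mu> * t2 = 1 + t1 + u * t2" using t(3) by (simp add: algebra_simps)
    then have "const_poly \<mu> * (t2 * ?w) = (1 + t1 + u * t2) * ?w"
      by (simp only: mult.assoc[symmetric])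
    also have "\<dots> = ?w + t1 * ?w + t2 * (u ^ Suc n * v)"
      by (simp add: algebra_simps)
    finally have "const_poly \<mu> * (t2 * ?w) = ?w + t1 * ?w + t2 * (u ^ Suc n * v)" .
    from arg_cong[OF this, of real_part] have "\<mu> * b n = a n + real_part (t1 * ?w) + b (Suc n)"
      by (simp only: real_part_scale real_part_add a_def b_def)
    then show ?thesis using real_part_nonneg[OF preordering_mult[OF t(1) un[of n]]] by simp
  qed
  have a_nonneg: "0 \<le> a n" and b_nonneg: "0 \<le> b n" for n
    unfolding a_def b_def
    using real_part_nonneg[OF un] real_part_nonneg[OF preordering_mult[OF t(2) un]] by blast+
  have b_le: "b n \<le> b 0 * \<mu> ^ n" for n
  proof (induction n)
    case (Suc n)
    have "b (Suc n) \<le> \<mu> * b n" using step[of n] a_nonneg[of n] by simp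
    also have "\<dots> \<le> \<mu> * (b 0 * \<mu> ^ n)" using Suc \<mu> by simp
    finally show ?case by (simp add: ac_simps)
  qed simp
  have "a 1 \<le> \<mu> * a 0"
  proof (rule log_convex_growth[OF a_nonneg _ _ \<mu>])
    show "(a (Suc n))\<^sup>2 \<le> a n * a (Suc (Suc n))" for n
      using real_part_cauchy_schwarz[OF un[of n], of u] by (simp add: a_def mult.assoc)
    show "a n \<le> (\<mu> * b 0) * \<mu> ^ n" for n
    proof -
      have "a n \<le> \<mu> * b n" using step[of n] b_nonneg[of "Suc n"] by simp
      also have "\<dots> \<le> \<mu> * (b 0 * \<mu> ^ n)" using b_le[of n] \<mu> by simp
      finally show ?thesis by (simp add: mult.assoc)
    qed
  qed
  then show ?thesis by (simp add: a_def)
qed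

lemma gns_norm_class: "gns_norm L (gns_class L q) = sqrt (Re (L (q * conj_poly q)))"
  by (simp add: gns_norm_def gns_inner_class[OF lin pos])

text \<open>
  The previous bound applies with \<open>\<mu> = c\<^sup>2\<close> for every \<open>c\<close> larger than the supremum; only then is \<open>c\<^sup>2 - p p\<^sup>*\<close>
  strictly positive on \<open>K\<^sub>f\<close>. The claim follows by letting \<open>c\<close> tend to the supremum.
\<close>

lemma gns_op_norm_le:
  assumes bdd: "bounded (eval_at p ` semialg_set f)" and X: "X \<in> gns_space L"
  shows "gns_norm L (gns_op L p X) \<le> sup_norm_on (semialg_set f) p * gns_norm L X"
proof -
  let ?s = "sup_norm_on (semialg_set f) p"
  obtain q where q: "X = gns_class L q" using X by (auto simp: gns_space_def)
  obtain u where u: "p * conj_poly p = complexify u" "u \<in> preordering f"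
    "\<And>x. eval u (\<lambda>j. x $ j) = (cmod (eval_at p x))\<^sup>2" using norm_square_real_poly[of f p] by blast
  obtain v where v: "q * conj_poly q = complexify v" "v \<in> preordering f"
    using norm_square_real_poly[of f q] by blast
  have "(p * q) * conj_poly (p * q) = (p * conj_poly p) * (q * conj_poly q)"
    by (simp add: conj_mult ac_simps)
  also have "\<dots> = complexify (u * v)" by (simp add: u v complexify_mult)
  finally have norms: "gns_norm L (gns_op L p X) = sqrt (real_part (u * v))" "gns_norm L X = sqrt (real_part v)"
    by (simp_all add: q gns_op_class[OF lin pos] gns_norm_class v real_part_def)
  note le = cmod_le_sup_norm[OF bdd] and s = sup_norm_nonneg[OF bdd]
  have bound: "gns_norm L (gns_op L p X) \<le> c * gns_norm L X" if c: "?s < c" for c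
  proof -
    have "real_part (u * v) \<le> c\<^sup>2 * real_part v"
    proof (rule real_part_bound[OF u(2) v(2)])
      show "0 < c\<^sup>2" using c s by simp
      show "eval u (\<lambda>j. x $ j) < c\<^sup>2" if "x \<in> semialg_set f" for x
        unfolding u(3) using le[OF that] c by (intro power_strict_mono) auto
    qed
    then have "sqrt (real_part (u * v)) \<le> sqrt (c\<^sup>2 * real_part v)" by simp
    then show ?thesis using c s by (simp add: norms real_sqrt_mult)
  qed
  show ?thesis
  proof (cases "gns_norm L X = 0")
    case True
    then show ?thesis using bound[of "?s + 1"] by simp
  next
    case False
    then have pos: "0 < gns_norm L X" using real_part_nonneg[OF v(2)] by (simp add: norms less_le)
    have "gns_norm L (gns_op L p X) / gns_norm L X \<le> ?s"
      by (rule dense_ge) (use bound pos in \<open>simp add: pos_divide_le_eq\<close>)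
    then show ?thesis using pos by (simp add: pos_divide_le_eq)
  qed
qed

end

theorem proposition2:
  fixes f :: "('n::finite, real) mpoly list"
    and L :: "('n, complex) mpoly \<Rightarrow> complex"
    and p :: "('n, complex) mpoly"
  assumes "linear_functional L"
    and "nonneg_on_preordering f L"
    and "bounded (eval_at p ` semialg_set f)"
  shows "gns_bounded L (gns_op L p)
    \<and> gns_opnorm L (gns_op L p) \<le> sup_norm_on (semialg_set f) p"
proof
  let ?s = "sup_norm_on (semialg_set f) p"
  note le = gns_op_norm_le[OF assms]
  show "gns_bounded L (gns_op L p)" unfolding gns_bounded_def using le by blast
  have norm0: "gns_norm L (gns_class L 0) = 0"
  proof -
    interpret L: Vector_Spaces.linear scale_poly "(*)" L
      using assms(1) by (simp add: linear_functional_def)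
    show ?thesis by (simp add: gns_norm_class[OF assms(1,2)] L.zero)
  qed
  have zero: "gns_class L 0 \<in> gns_space L" by (simp add: gns_space_def)
  show "gns_opnorm L (gns_op L p) \<le> ?s"
    unfolding gns_opnorm_def
  proof (rule cSup_least)
    show "{gns_norm L (gns_op L p X) | X. X \<in> gns_space L \<and> gns_norm L X \<le> 1} \<noteq> {}"
      using zero norm0 by (metis (mono_tags, lifting) empty_Collect_eq zero_le_one)
  next
    fix y assume "y \<in> {gns_norm L (gns_op L p X) | X. X \<in> gns_space L \<and> gns_norm L X \<le> 1}"
    then obtain X where X: "X \<in> gns_space L" "gns_norm L X \<le> 1" "y = gns_norm L (gns_op L p X)" by blast
    have "y \<le> ?s * gns_norm L X" using le[OF X(1)] X(3) by simp
    also have "\<dots> \<le> ?s * 1" using X(2) sup_norm_nonneg[OF assms(3)] by (intro mult_left_mono)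
    finally show "y \<le> ?s" by simp
  qed
qed

end
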